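(* Let $A=\sum_{i=1}^r A_ix_i$, with $A_i\in M_n(\mathbb C)$ and $A_i^*=A_i$ for all $i$, be an unsplittable Hermitian matrix pencil, let $S=\sum_{i=1}^rA_i\otimes s_i$ be the associated matrix semicircle and $\eta(X)=\sum_{i=1}^rA_iXA_i$ its covariance map. Then $S$ is non-singular, the equation $\eta(C)=C^{-1}$ has a unique positive definite solution $C$, and the spectral density $f$ of $S$ satisfies $f(0)=\frac1\pi\,\mathrm{tr}(C)$.
   Context: Notation: $\mathrm{tr}=\frac1n\mathrm{Tr}$ is the normalized trace on $M_n(\mathbb C)$. A pencil $\sum_iA_ix_i$ of size $n$ is splittable if there are subspaces $\mathcal R,\mathcal L\subset\mathbb C^n$ with $\dim\mathcal R=\dim\mathcal L=s$, $1\le s\le n-1$, and $A_i(\mathcal R)\subseteq\mathcal L$ for all $i$; it is unsplittable if it is nonzero (some $A_i\neq0$) and not splittable. Matrix semicircle: $(\mathcal A,\varphi)$ is a non-commutative probability space with $\varphi$ a faithful tracial state; $s_1,\dots,s_r\in\mathcal A$ are freely independent self-adjoint elements, each with the semicircular distribution $\frac1{2\pi}\sqrt{4-x^2}\,dx$ on $[-2,2]$. With $\mathbb E=\mathrm{id}_{M_n(\mathbb C)}\otimes\varphi$, the matrix Cauchy transform is $G_S(z)=\mathbb E[(zI\otimes1-S)^{-1}]$ for $\Im z>0$, and the spectral density (when it exists) is $f(x)=\frac1\pi\lim_{\varepsilon\downarrow0}\Im[-\mathrm{tr}\,G_S(x+i\varepsilon)]$. Non-singularity: put $W(u)=iG_S(iu)$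 for $\Re u>0$. For $t\in\mathbb R$, $\alpha>0$ the Stolz cone is $\Gamma_\alpha(it)=\{u\in\mathbb C:\Re u>0,\ |\Im u-t|\le\alpha\Re u\}$. $S$ is non-singular at $t_0\in\mathbb R$ if there exist $\delta>0$ and $\alpha>0$ such that for every $t$ with $|t-t_0|<\delta$: $W$ is bounded on $\Gamma_\alpha(it)\cap\{|u-it|<\delta\}$, and the limit $W(it+0^+):=\lim_{u\to it,\,u\in\Gamma_\alpha(it)}W(u)$ exists; and moreover $t\mapsto W(it+0^+)$ is continuous on $(t_0-\delta,t_0+\delta)$. $S$ is non-singular if it is non-singular at every $t_0\in\mathbb R$. *)

theory Defs
  imports "HOL-Analysis.Analysis"
begin

(* Unital C*-algebras.  The inherited class real_normed_algebra_1 supplies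
   norm (x * y) <= norm x * norm y and norm 1 = 1; homogeneity of the norm under
   complex scalars and isometry of the involution follow from the C*-identity. *)

class cstar_algebra = real_normed_algebra_1 + banach +
  fixes scaleC :: "complex \<Rightarrow> 'a \<Rightarrow> 'a"
    and star :: "'a \<Rightarrow> 'a"
  assumes scaleC_add_right: "scaleC c (x + y) = scaleC c x + scaleC c y"
    and scaleC_add_left: "scaleC (c + d) x = scaleC c x + scaleC d x"
    and scaleC_scaleC: "scaleC c (scaleC d x) = scaleC (c * d) x"
    and scaleC_of_real: "scaleC (complex_of_real a) x = a *\<^sub>R x"
    and mult_scaleC_left: "scaleC c x * y = scaleC c (x * y)"
    and mult_scaleC_right: "x * scaleC c y = scaleC c (x * y)"
    and star_star: "star (star x) = x"
    and star_add: "star (x + y) = star x + star y"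
    and star_scaleC: "star (scaleC c x) = scaleC (cnj c) (star x)"
    and star_mult: "star (x * y) = star y * star x"
    and norm_star_mult_self: "norm (star x * x) = (norm x)\<^sup>2"

instantiation complex :: cstar_algebra
begin

definition scaleC_complex :: "complex \<Rightarrow> complex \<Rightarrow> complex" where
  "scaleC_complex c x = c * x"

definition star_complex :: "complex \<Rightarrow> complex" where
  "star_complex x = cnj x"

instance
  by standard
    (simp_all add: scaleC_complex_def star_complex_def algebra_simps scaleR_conv_of_real
      norm_mult power2_eq_square)

end

locale cstar_prob_space =
  fixes \<phi> :: "'a::cstar_algebra \<Rightarrow> complex"
  assumes state_add: "\<phi> (x + y) = \<phi> x + \<phi> y"
    and state_scaleC: "\<phi> (scaleC c x) = c * \<phi> x"
    and state_one: "\<phi> 1 = 1"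
    and state_pos: "\<phi> (star x * x) \<in> \<real>\<^sub>\<ge>\<^sub>0"
    and state_tracial: "\<phi> (x * y) = \<phi> (y * x)"
    and state_faithful: "\<phi> (star x * x) = 0 \<Longrightarrow> x = 0"

inductive_set unital_subalgebra_gen :: "'a::cstar_algebra \<Rightarrow> 'a set" for x :: 'a where
  gen: "x \<in> unital_subalgebra_gen x"
| one: "1 \<in> unital_subalgebra_gen x"
| add: "\<lbrakk>a \<in> unital_subalgebra_gen x; b \<in> unital_subalgebra_gen x\<rbrakk>
    \<Longrightarrow> a + b \<in> unital_subalgebra_gen x"
| mult: "\<lbrakk>a \<in> unital_subalgebra_gen x; b \<in> unital_subalgebra_gen x\<rbrakk>
    \<Longrightarrow> a * b \<in> unital_subalgebra_gen x"
| scaleC: "a \<in> unital_subalgebra_gen x \<Longrightarrow> scaleC c a \<in> unital_subalgebra_gen x"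

(* Alternating products a_0 a_1 ... a_(k-1) of centred elements, where a_j lies in the
   algebra generated by s_(idx j), have vanishing expectation.  Only neighbouring
   indices are required to be distinct. *)

definition freely_independent ::
    "('a::cstar_algebra \<Rightarrow> complex) \<Rightarrow> ('i \<Rightarrow> 'a) \<Rightarrow> 'i set \<Rightarrow> bool" where
  "freely_independent \<phi> s I \<longleftrightarrow>
    (\<forall>(k::nat) (idx :: nat \<Rightarrow> 'i) (a :: nat \<Rightarrow> 'a).
      0 < k \<longrightarrow>
      (\<forall>j<k. idx j \<in> I \<and> a j \<in> unital_subalgebra_gen (s (idx j)) \<and> \<phi> (a j) = 0) \<longrightarrow>
      (\<forall>j. Suc j < k \<longrightarrow> idx j \<noteq> idx (Suc j)) \<longrightarrow>
      \<phi> (prod_list (map a [0..<k])) = 0)"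

(* The distribution of a self-adjoint element is the compactly supported probability
   measure with the same moments, so equality of distributions is equality of moments. *)

definition semicircular :: "('a::cstar_algebra \<Rightarrow> complex) \<Rightarrow> 'a \<Rightarrow> bool" where
  "semicircular \<phi> x \<longleftrightarrow> star x = x \<and>
    (\<forall>k::nat. \<phi> (x ^ k) =
      complex_of_real (integral {-2..2} (\<lambda>t::real. t ^ k * (sqrt (4 - t\<^sup>2) / (2 * pi)))))"

definition adjoint_mat :: "complex^'n^'n \<Rightarrow> complex^'n^'n" where
  "adjoint_mat A = (\<chi> i j. cnj (A $ j $ i))"

definition hermitian_mat :: "complex^'n^'n \<Rightarrow> bool" where
  "hermitian_mat A \<longleftrightarrow> adjoint_mat A = A"

(* The quadratic form of a Hermitian matrix is real-valued, so Re loses nothing. *)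

definition posdef_mat :: "complex^'n^'n \<Rightarrow> bool" where
  "posdef_mat A \<longleftrightarrow> hermitian_mat A \<and>
    (\<forall>v. v \<noteq> 0 \<longrightarrow> 0 < Re (\<Sum>i\<in>UNIV. cnj (v $ i) * (A *v v) $ i))"

definition ntr :: "complex^'n^'n \<Rightarrow> complex" where
  "ntr A = trace A / of_nat CARD('n)"

(* A pencil is given by its coefficient matrices A 1, ..., A r.  The prefix vec refers
   to complex linear algebra on complex^'n, as opposed to subspace and dim over the reals. *)

definition splittable :: "nat \<Rightarrow> (nat \<Rightarrow> complex^'n^'n) \<Rightarrow> bool" where
  "splittable r A \<longleftrightarrow>
    (\<exists>(R :: (complex^'n) set) (L :: (complex^'n) set) s.
      vec.subspace R \<and> vec.subspace L \<and> vec.dim R = s \<and> vec.dim L = s \<and>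
      1 \<le> s \<and> s \<le> CARD('n) - 1 \<and> (\<forall>i\<in>{1..r}. (*v) (A i) ` R \<subseteq> L))"

definition unsplittable :: "nat \<Rightarrow> (nat \<Rightarrow> complex^'n^'n) \<Rightarrow> bool" where
  "unsplittable r A \<longleftrightarrow> (\<exists>i\<in>{1..r}. A i \<noteq> 0) \<and> \<not> splittable r A"

definition covariance_map ::
    "nat \<Rightarrow> (nat \<Rightarrow> complex^'n^'n) \<Rightarrow> complex^'n^'n \<Rightarrow> complex^'n^'n" where
  "covariance_map r A X = (\<Sum>i=1..r. A i ** X ** A i)"

(* The tensor product of M_n(C) with the algebra 'a is identified with n by n matrices
   over 'a. *)

definition mat_tensor :: "complex^'n^'n \<Rightarrow> 'a::cstar_algebra \<Rightarrow> 'a^'n^'n" (infixr "\<otimes>\<^sub>M" 75) where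
  "A \<otimes>\<^sub>M a = (\<chi> i j. scaleC (A $ i $ j) a)"

definition matrix_semicircle ::
    "nat \<Rightarrow> (nat \<Rightarrow> complex^'n^'n) \<Rightarrow> (nat \<Rightarrow> 'a::cstar_algebra) \<Rightarrow> 'a^'n^'n" where
  "matrix_semicircle r A s = (\<Sum>i=1..r. A i \<otimes>\<^sub>M s i)"

definition mat_expectation :: "('a::cstar_algebra \<Rightarrow> complex) \<Rightarrow> 'a^'n^'n \<Rightarrow> complex^'n^'n" where
  "mat_expectation \<phi> X = (\<chi> i j. \<phi> (X $ i $ j))"

(* Only used for Im z > 0, where the resolvent of a self-adjoint S exists. *)

definition matrix_cauchy ::
    "('a::cstar_algebra \<Rightarrow> complex) \<Rightarrow> 'a^'n^'n \<Rightarrow> complex \<Rightarrow> complex^'n^'n" where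
  "matrix_cauchy \<phi> S z = mat_expectation \<phi> (matrix_inv (mat z \<otimes>\<^sub>M 1 - S))"

definition has_spectral_density_at ::
    "('a::cstar_algebra \<Rightarrow> complex) \<Rightarrow> 'a^'n^'n \<Rightarrow> real \<Rightarrow> real \<Rightarrow> bool" where
  "has_spectral_density_at \<phi> S x d \<longleftrightarrow>
    ((\<lambda>\<epsilon>::real. 1 / pi * Im (- ntr (matrix_cauchy \<phi> S (of_real x + \<i> * of_real \<epsilon>))))
      \<longlongrightarrow> d) (at_right 0)"

definition W_transform ::
    "('a::cstar_algebra \<Rightarrow> complex) \<Rightarrow> 'a^'n^'n \<Rightarrow> complex \<Rightarrow> complex^'n^'n" where
  "W_transform \<phi> S u = mat \<i> ** matrix_cauchy \<phi> S (\<i> * u)"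

definition stolz_cone :: "real \<Rightarrow> real \<Rightarrow> complex set" where
  "stolz_cone \<alpha> t = {u. 0 < Re u \<and> \<bar>Im u - t\<bar> \<le> \<alpha> * Re u}"

definition stolz_limit :: "(complex \<Rightarrow> complex^'n^'n) \<Rightarrow> real \<Rightarrow> real \<Rightarrow> complex^'n^'n" where
  "stolz_limit W \<alpha> t = Lim (at (\<i> * of_real t) within stolz_cone \<alpha> t) W"

definition nonsingular_at ::
    "('a::cstar_algebra \<Rightarrow> complex) \<Rightarrow> 'a^'n^'n \<Rightarrow> real \<Rightarrow> bool" where
  "nonsingular_at \<phi> S t0 \<longleftrightarrow>
    (\<exists>\<delta>>0. \<exists>\<alpha>>0.
      (\<forall>t. \<bar>t - t0\<bar> < \<delta> \<longrightarrow>
        bounded (W_transform \<phi> S ` (stolz_cone \<alpha> t \<inter> {u. cmod (u - \<i> * of_real t) < \<delta>})) \<and>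
        (\<exists>L. (W_transform \<phi> S \<longlongrightarrow> L) (at (\<i> * of_real t) within stolz_cone \<alpha> t))) \<and>
      continuous_on {t0 - \<delta><..<t0 + \<delta>} (stolz_limit (W_transform \<phi> S) \<alpha>))"

definition nonsingular :: "('a::cstar_algebra \<Rightarrow> complex) \<Rightarrow> 'a^'n^'n \<Rightarrow> bool" where
  "nonsingular \<phi> S \<longleftrightarrow> (\<forall>t0. nonsingular_at \<phi> S t0)"

end

theory Submission
  imports Defs "HOL-Complex_Analysis.Conformal_Mappings"
begin

text \<open>The proof replaces the operator \<open>S\<close> by an equation. Freeness and the semicircle law make
  \<open>W(u) = i G(iu)\<close> a solution of \<open>W(u) (u + \<eta>(W(u))) = 1\<close> with positive real part (\<open>W_transform_dyson\<close>);
  from then on only this equation is used, together with the fact that \<open>\<eta>\<close> comes from an unsplittable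
  pencil.

  The equation. In the basis of free products of Chebyshev polynomials each \<open>s i\<close> acts as a creation
  plus an annihilation operator (\<open>fock_step\<close>). If \<open>z G = 1 + \<eta>(G) G\<close> and \<open>G\<close> is small, then the sum over
  all words of \<open>G A\<^sub>i G A\<^sub>j \<dots> G\<close> tensored with the basis element of the word inverts \<open>z - S\<close>, and the empty
  word alone contributes to its expectation, so \<open>G\<close> is the Cauchy transform for large \<open>z\<close>. Analytic
  continuation carries the equation to the whole upper half-plane, once the resolvent is known to
  exist there (\<open>resolvent_exists\<close>).

  Stability. Let \<open>X\<^sub>1, X\<^sub>2\<close> be the real parts of two solutions. Writing
  \<open>W\<^sub>1 - W\<^sub>2 = B X\<^sub>2\<close>, the map \<open>Z \<mapsto> W\<^sub>1 \<eta>(Z) W\<^sub>2\<close> is a contraction for a weighted Hilbert-Schmidt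
  norm, and the loss is a sum of weighted squares of \<open>A\<^sub>i B - B' A\<^sub>i\<close> plus terms proportional to
  \<open>Re u\<close> (\<open>dyson_gap\<close>). An unsplittable pencil is intertwined with itself by scalars only
  (\<open>intertwining_scalar\<close>), so a small loss forces \<open>B\<close> to be nearly scalar. This yields two bounds for
  \<open>\<parallel>W(u) - W(v)\<parallel> / |u - v|\<close> in terms of the trace \<open>x\<close> of the real part: a multiple of \<open>x / Re u\<close> and
  a multiple of \<open>1 / x\<^sup>2\<close> (\<open>dyson_stability\<close>). In the product of the square of the first and the second
  \<open>x\<close> cancels, and what remains is strong enough for Hoelder continuity of \<open>W\<close> with exponent \<open>1/3\<close> on
  bounded parts of the half-plane (\<open>W_holder\<close>). Non-singularity at every point follows.

  Boundedness. Away from the origin \<open>\<parallel>W(u)\<parallel> \<le> 4 n / |u|\<close> holds for every pencil (\<open>dyson_bound\<close>). On the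
  positive half-line near the origin a blow-up sequence would produce \<open>w \<ge> 0\<close> with
  \<open>rank \<eta>(w) \<le> rank w\<close>, which unsplittability excludes (\<open>hermitian_solution_bounded\<close>); stability
  spreads the bound to a complex neighbourhood.

  The density. The limit \<open>C = W(0+)\<close> is positive definite and satisfies \<open>\<eta>(C) C = 1\<close>; the case without
  loss of the gap identity shows that such a \<open>C\<close> is unique (\<open>dyson_zero_unique\<close>), and the normalised
  trace of \<open>C\<close> is \<open>\<pi> f(0)\<close>.\<close>

section \<open>Matrices over a normed algebra\<close>

lemma matrix_add_rdistrib: "((A + B) ** C) = (A ** C) + (B ** (C :: 'a::semiring_1^'p^'n))"
  by (simp add: matrix_matrix_mult_def vec_eq_iff sum.distrib distrib_right)

lemma matrix_diff_ldistrib: "A ** (B - C) = A ** B - A ** (C :: 'a::ring_1^'p^'n)"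
  by (simp add: matrix_matrix_mult_def vec_eq_iff sum_subtractf right_diff_distrib)

lemma matrix_diff_rdistrib: "(A - B) ** C = A ** C - B ** (C :: 'a::ring_1^'p^'n)"
  by (simp add: matrix_matrix_mult_def vec_eq_iff sum_subtractf left_diff_distrib)

lemma matrix_minus_left: "(- A) ** B = - (A ** (B :: 'a::ring_1^'p^'n))"
  by (simp add: matrix_matrix_mult_def vec_eq_iff sum_negf)

lemma matrix_minus_right: "A ** (- B) = - (A ** (B :: 'a::ring_1^'p^'n))"
  by (simp add: matrix_matrix_mult_def vec_eq_iff sum_negf)

lemma matrix_scaleR_left: "(k *\<^sub>R A) ** B = k *\<^sub>R (A ** (B :: 'a::real_algebra_1^'p^'n))"
  by (simp add: matrix_matrix_mult_def vec_eq_iff scaleR_sum_right)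

lemma matrix_scaleR_right: "A ** (k *\<^sub>R B) = k *\<^sub>R (A ** (B :: 'a::real_algebra_1^'p^'n))"
  by (simp add: matrix_matrix_mult_def vec_eq_iff scaleR_sum_right)

lemma matrix_sum_left: "(\<Sum>i\<in>I. f i) ** B = (\<Sum>i\<in>I. f i ** (B :: 'a::ring_1^'p^'n))"
  by (induction I rule: infinite_finite_induct) (auto simp: matrix_add_rdistrib)

lemma matrix_sum_right: "B ** (\<Sum>i\<in>I. f i) = (\<Sum>i\<in>I. B ** (f i :: 'a::ring_1^'p^'n))"
  by (induction I rule: infinite_finite_induct) (auto simp: matrix_add_ldistrib)

lemmas matrix_ring_simps = matrix_add_ldistrib matrix_add_rdistrib matrix_diff_ldistrib
  matrix_diff_rdistrib matrix_minus_left matrix_minus_right matrix_scaleR_left matrix_scaleR_right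
  matrix_mul_assoc

lemma power2_norm_vec: "(norm x)\<^sup>2 = (\<Sum>i\<in>UNIV. (norm (x $ i))\<^sup>2)"
  by (simp add: norm_vec_def L2_set_def sum_nonneg)

lemma norm_matrix_mult_le:
  fixes A :: "'a::real_normed_algebra_1^'m^'n" and B :: "'a^'p^'m"
  shows "norm (A ** B) \<le> norm A * norm B"
proof (rule power2_le_imp_le)
  have entry: "(norm ((A ** B) $ i $ j))\<^sup>2
      \<le> (\<Sum>k\<in>UNIV. (norm (A $ i $ k))\<^sup>2) * (\<Sum>k\<in>UNIV. (norm (B $ k $ j))\<^sup>2)" for i j
  proof -
    have "norm ((A ** B) $ i $ j) \<le> (\<Sum>k\<in>UNIV. norm (A $ i $ k) * norm (B $ k $ j))"
      unfolding matrix_matrix_mult_def by (auto intro!: order_trans[OF norm_sum] sum_mono norm_mult_ineq)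
    then have "(norm ((A ** B) $ i $ j))\<^sup>2 \<le> (\<Sum>k\<in>UNIV. norm (A $ i $ k) * norm (B $ k $ j))\<^sup>2"
      by (simp add: power_mono)
    also have "\<dots> \<le> (\<Sum>k\<in>UNIV. (norm (A $ i $ k))\<^sup>2) * (\<Sum>k\<in>UNIV. (norm (B $ k $ j))\<^sup>2)"
      by (rule Cauchy_Schwarz_ineq_sum)
    finally show ?thesis .
  qed
  have "(norm (A ** B))\<^sup>2 = (\<Sum>i\<in>UNIV. \<Sum>j\<in>UNIV. (norm ((A ** B) $ i $ j))\<^sup>2)"
    by (simp add: power2_norm_vec)
  also have "\<dots> \<le> (\<Sum>i\<in>UNIV. \<Sum>j\<in>UNIV. (\<Sum>k\<in>UNIV. (norm (A $ i $ k))\<^sup>2) * (\<Sum>k\<in>UNIV. (norm (B $ k $ j))\<^sup>2))"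
    by (intro sum_mono entry)
  also have "\<dots> = (\<Sum>i\<in>UNIV. \<Sum>k\<in>UNIV. (norm (A $ i $ k))\<^sup>2) * (\<Sum>j\<in>UNIV. \<Sum>k\<in>UNIV. (norm (B $ k $ j))\<^sup>2)"
    by (simp add: sum_product)
  also have "(\<Sum>j\<in>UNIV. \<Sum>k\<in>UNIV. (norm (B $ k $ j))\<^sup>2) = (\<Sum>k\<in>UNIV. \<Sum>j\<in>UNIV. (norm (B $ k $ j))\<^sup>2)"
    by (rule sum.swap)
  also have "(\<Sum>i\<in>UNIV. \<Sum>k\<in>UNIV. (norm (A $ i $ k))\<^sup>2) * (\<Sum>k\<in>UNIV. \<Sum>j\<in>UNIV. (norm (B $ k $ j))\<^sup>2)
      = (norm A * norm B)\<^sup>2"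
    by (simp add: power2_norm_vec power_mult_distrib)
  finally show "(norm (A ** B))\<^sup>2 \<le> (norm A * norm B)\<^sup>2" .
qed simp

lemma norm_matrix_vector_mult_le:
  fixes A :: "complex^'m^'n"
  shows "norm (A *v x) \<le> norm A * norm x"
proof (rule power2_le_imp_le)
  have entry: "(norm ((A *v x) $ i))\<^sup>2 \<le> (\<Sum>k\<in>UNIV. (norm (A $ i $ k))\<^sup>2) * (\<Sum>k\<in>UNIV. (norm (x $ k))\<^sup>2)" for i
  proof -
    have "norm ((A *v x) $ i) \<le> (\<Sum>k\<in>UNIV. norm (A $ i $ k) * norm (x $ k))"
      unfolding matrix_vector_mult_def by (auto intro!: order_trans[OF norm_sum] sum_mono norm_mult_ineq)
    then have "(norm ((A *v x) $ i))\<^sup>2 \<le> (\<Sum>k\<in>UNIV. norm (A $ i $ k) * norm (x $ k))\<^sup>2"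
      by (simp add: power_mono)
    also have "\<dots> \<le> (\<Sum>k\<in>UNIV. (norm (A $ i $ k))\<^sup>2) * (\<Sum>k\<in>UNIV. (norm (x $ k))\<^sup>2)"
      by (rule Cauchy_Schwarz_ineq_sum)
    finally show ?thesis .
  qed
  have "(norm (A *v x))\<^sup>2 = (\<Sum>i\<in>UNIV. (norm ((A *v x) $ i))\<^sup>2)"
    by (simp add: power2_norm_vec)
  also have "\<dots> \<le> (\<Sum>i\<in>UNIV. (\<Sum>k\<in>UNIV. (norm (A $ i $ k))\<^sup>2) * (\<Sum>k\<in>UNIV. (norm (x $ k))\<^sup>2))"
    by (intro sum_mono entry)
  also have "\<dots> = (norm A * norm x)\<^sup>2"
    by (simp add: power2_norm_vec power_mult_distrib sum_distrib_right)
  finally show "(norm (A *v x))\<^sup>2 \<le> (norm A * norm x)\<^sup>2" .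
qed simp

lemma scaleR_matrix_vector: "(k *\<^sub>R A) *v x = k *\<^sub>R ((A :: complex^'m^'n) *v x)"
  by (simp add: matrix_vector_mult_def vec_eq_iff scaleR_sum_right)

lemma matrix_vector_scaleR: "A *v (k *\<^sub>R x) = k *\<^sub>R ((A :: complex^'m^'n) *v x)"
  by (simp add: matrix_vector_mult_def vec_eq_iff scaleR_sum_right)

lemma bounded_bilinear_matrix_mult:
  "bounded_bilinear (\<lambda>(A :: 'a::real_normed_algebra_1^'m^'n) (B :: 'a^'p^'m). A ** B)"
proof
  show "\<exists>K. \<forall>A B. norm ((A :: 'a^'m^'n) ** (B :: 'a^'p^'m)) \<le> norm A * norm B * K"
    by (rule exI[of _ 1]) (simp add: norm_matrix_mult_le)
qed (simp_all add: matrix_ring_simps)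

lemmas tendsto_matrix_mult [tendsto_intros] = bounded_bilinear.tendsto[OF bounded_bilinear_matrix_mult]
lemmas continuous_on_matrix_mult [continuous_intros] =
  bounded_bilinear.continuous_on[OF bounded_bilinear_matrix_mult]

section \<open>Adjoints, forms and the Loewner order\<close>

lemma adjoint_mat_nth [simp]: "adjoint_mat A $ i $ j = cnj (A $ j $ i)"
  by (simp add: adjoint_mat_def)

lemma adjoint_adjoint [simp]: "adjoint_mat (adjoint_mat A) = A"
  by (simp add: vec_eq_iff)

lemma adjoint_add: "adjoint_mat (A + B) = adjoint_mat A + adjoint_mat B"
  by (simp add: vec_eq_iff)

lemma adjoint_diff: "adjoint_mat (A - B) = adjoint_mat A - adjoint_mat B"
  by (simp add: vec_eq_iff)

lemma adjoint_scaleR: "adjoint_mat (k *\<^sub>R A) = k *\<^sub>R adjoint_mat A"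
  by (simp add: vec_eq_iff)

lemma adjoint_zero [simp]: "adjoint_mat 0 = 0"
  by (simp add: vec_eq_iff)

lemma adjoint_sum: "adjoint_mat (\<Sum>i\<in>I. f i) = (\<Sum>i\<in>I. adjoint_mat (f i))"
  by (induction I rule: infinite_finite_induct) (auto simp: adjoint_add)

lemma adjoint_mult: "adjoint_mat (A ** B) = adjoint_mat B ** adjoint_mat A"
  by (simp add: vec_eq_iff matrix_matrix_mult_def mult.commute)

lemma adjoint_mat_scalar: "adjoint_mat (mat c) = mat (cnj c)"
  by (simp add: vec_eq_iff mat_def)

lemma adjoint_one [simp]: "adjoint_mat (mat 1) = mat 1"
  by (simp add: adjoint_mat_scalar)

lemma norm_adjoint [simp]: "norm (adjoint_mat A) = norm A"
proof -
  have "(norm (adjoint_mat A))\<^sup>2 = (norm A)\<^sup>2"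
    by (simp add: power2_norm_vec) (rule sum.swap)
  then show ?thesis by simp
qed

lemma bounded_linear_adjoint: "bounded_linear adjoint_mat"
  by (rule bounded_linear_intro[of _ 1]) (auto simp: adjoint_add adjoint_scaleR)

lemmas tendsto_adjoint [tendsto_intros] = bounded_linear.tendsto[OF bounded_linear_adjoint]
lemmas continuous_on_adjoint [continuous_intros] =
  bounded_linear.continuous_on[OF bounded_linear_adjoint]

text \<open>The inner product of \<open>\<complex>\<^sup>n\<close>, conjugate-linear in the first argument.\<close>

definition cip :: "complex^'n \<Rightarrow> complex^'n \<Rightarrow> complex" where
  "cip v w = (\<Sum>i\<in>UNIV. cnj (v $ i) * w $ i)"

lemma cip_add_left: "cip (u + v) w = cip u w + cip v w"
  by (simp add: cip_def distrib_right sum.distrib)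

lemma cip_add_right: "cip w (u + v) = cip w u + cip w v"
  by (simp add: cip_def distrib_left sum.distrib)

lemma cip_diff_left: "cip (u - v) w = cip u w - cip v w"
  by (simp add: cip_def left_diff_distrib sum_subtractf)

lemma cip_diff_right: "cip w (u - v) = cip w u - cip w v"
  by (simp add: cip_def right_diff_distrib sum_subtractf)

lemma cip_smult_left: "cip (c *s u) w = cnj c * cip u w"
  by (simp add: cip_def sum_distrib_left mult.assoc)

lemma cip_smult_right: "cip w (c *s u) = c * cip w u"
  by (simp add: cip_def sum_distrib_left mult.left_commute)

lemma cip_scaleR_left: "cip (k *\<^sub>R u) w = k * cip u w"
  by (simp add: cip_def sum_distrib_left scaleR_conv_of_real[where 'a = complex] mult.assoc)

lemma cip_scaleR_right: "cip w (k *\<^sub>R u) = k * cip w u"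
  by (simp add: cip_def sum_distrib_left scaleR_conv_of_real[where 'a = complex] mult.left_commute)

lemma cip_zero [simp]: "cip 0 w = 0" "cip w 0 = 0"
  by (auto simp: cip_def)

lemma cip_sum_left: "cip (\<Sum>i\<in>I. f i) w = (\<Sum>i\<in>I. cip (f i) w)"
  by (induction I rule: infinite_finite_induct) (auto simp: cip_add_left)

lemma cip_sum_right: "cip w (\<Sum>i\<in>I. f i) = (\<Sum>i\<in>I. cip w (f i))"
  by (induction I rule: infinite_finite_induct) (auto simp: cip_add_right)

lemma cip_commute: "cip w v = cnj (cip v w)"
  by (simp add: cip_def mult.commute)

lemma cip_self: "cip v v = complex_of_real ((norm v)\<^sup>2)"
  unfolding cip_def power2_norm_vec of_real_sum
  by (rule sum.cong) (simp_all only: complex_norm_square mult.commute)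

lemma cip_axis: "cip (axis k 1) v = v $ k"
  by (simp add: cip_def axis_def if_distrib if_distribR cong: if_cong)

lemma cip_ext: "(\<And>v. cip v x = 0) \<Longrightarrow> x = 0"
  using cip_axis by (metis vec_eq_iff zero_index)

lemma cip_mult_left: "cip (A *v v) w = cip v (adjoint_mat A *v w)"
  unfolding cip_def matrix_vector_mult_def
  by (simp add: sum_distrib_left sum_distrib_right, subst sum.swap) (simp add: ac_simps)

lemma cip_mult_right: "cip v (A *v w) = cip (adjoint_mat A *v v) w"
  by (simp add: cip_mult_left)

lemma Re_cip: "Re (cip v w) = inner v w"
  by (simp add: cip_def inner_vec_def inner_complex_def)

lemma norm_cip_le: "cmod (cip v w) \<le> norm v * norm w"
proof (cases "cip v w = 0")
  case False
  define c where "c = cnj (cip v w) / cmod (cip v w)"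
  have "Re (cip v (c *s w)) \<le> norm v * norm (c *s w)"
    unfolding Re_cip by (rule norm_cauchy_schwarz)
  moreover have "cip v (c *s w) = cmod (cip v w)"
    using False by (simp add: cip_smult_right c_def field_simps flip: complex_norm_square)
      (simp add: power2_eq_square)
  moreover have "(norm (c *s w))\<^sup>2 = (norm w)\<^sup>2"
    using False by (simp add: power2_norm_vec norm_mult c_def norm_divide)
  ultimately show ?thesis by (simp add: power2_eq_iff_nonneg)
qed simp

abbreviation qform :: "complex^'n^'n \<Rightarrow> complex^'n \<Rightarrow> real" where
  "qform P v \<equiv> Re (cip v (P *v v))"

definition psd :: "complex^'n^'n \<Rightarrow> bool" where
  "psd P \<longleftrightarrow> hermitian_mat P \<and> (\<forall>v. 0 \<le> qform P v)"

definition loewner :: "complex^'n^'n \<Rightarrow> complex^'n^'n \<Rightarrow> bool" (infix "\<preceq>" 50) where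
  "P \<preceq> Q \<longleftrightarrow> psd (Q - P)"

lemma posdef_iff: "posdef_mat P \<longleftrightarrow> hermitian_mat P \<and> (\<forall>v. v \<noteq> 0 \<longrightarrow> 0 < qform P v)"
  by (simp add: posdef_mat_def cip_def)

lemma posdef_imp_psd: "posdef_mat P \<Longrightarrow> psd P"
  unfolding posdef_iff psd_def by (metis cip_zero(1) less_eq_real_def zero_complex.simps(1))

lemma psd_adj: "psd P \<Longrightarrow> adjoint_mat P = P"
  by (simp add: hermitian_mat_def psd_def)

lemma psd_qform: "psd P \<Longrightarrow> 0 \<le> qform P v"
  by (simp add: psd_def)

lemma psd_zero [simp]: "psd 0"
  by (simp add: psd_def hermitian_mat_def)

lemma psd_add: "psd P \<Longrightarrow> psd Q \<Longrightarrow> psd (P + Q)"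
  by (auto simp: psd_def hermitian_mat_def adjoint_add matrix_vector_mult_add_rdistrib cip_add_right)

lemma psd_scaleR: "psd P \<Longrightarrow> 0 \<le> k \<Longrightarrow> psd (k *\<^sub>R P)"
  by (auto simp: psd_def hermitian_mat_def adjoint_scaleR scaleR_matrix_vector cip_scaleR_right)

lemma psd_sum: "(\<And>i. i \<in> I \<Longrightarrow> psd (f i)) \<Longrightarrow> psd (\<Sum>i\<in>I. f i)"
  by (induction I rule: infinite_finite_induct) (auto intro: psd_add)

lemma psd_conj: "psd P \<Longrightarrow> psd (M ** P ** adjoint_mat M)"
  by (simp add: psd_def hermitian_mat_def adjoint_mult matrix_mul_assoc)
    (simp add: cip_mult_right[of _ M] flip: matrix_vector_mul_assoc)

lemma psd_one [simp]: "psd (mat 1)"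
  by (simp add: psd_def hermitian_mat_def cip_self)

lemma psd_gram: "psd (M ** adjoint_mat M)"
  using psd_conj[OF psd_one, of M] by simp

lemma loewner_trans: "P \<preceq> Q \<Longrightarrow> Q \<preceq> R \<Longrightarrow> P \<preceq> R"
  unfolding loewner_def using psd_add by fastforce

lemma loewner_qform: "P \<preceq> Q \<Longrightarrow> qform P v \<le> qform Q v"
  by (auto simp: loewner_def psd_def matrix_vector_mult_diff_rdistrib cip_diff_right)

lemma loewnerI:
  "\<lbrakk>hermitian_mat P; hermitian_mat Q; \<And>v. qform P v \<le> qform Q v\<rbrakk> \<Longrightarrow> P \<preceq> Q"
  by (auto simp: loewner_def psd_def hermitian_mat_def adjoint_diff matrix_vector_mult_diff_rdistrib
      cip_diff_right)

lemma loewner_conj: "P \<preceq> Q \<Longrightarrow> M ** P ** adjoint_mat M \<preceq> M ** Q ** adjoint_mat M"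
  unfolding loewner_def using psd_conj[of "Q - P" M] by (simp add: matrix_ring_simps)

lemma psd_limit:
  fixes f :: "nat \<Rightarrow> complex^'n^'n"
  assumes "\<And>k. psd (f k)" and "f \<longlonglongrightarrow> P"
  shows "psd P"
proof -
  have "(\<lambda>k. adjoint_mat (f k)) \<longlonglongrightarrow> adjoint_mat P" by (intro tendsto_intros assms)
  then have "(\<lambda>k. f k) \<longlonglongrightarrow> adjoint_mat P" using assms(1) by (simp add: psd_adj)
  then have "adjoint_mat P = P" using assms(2) LIMSEQ_unique by blast
  moreover have "0 \<le> qform P v" for v
  proof -
    have "(\<lambda>k. qform (f k) v) \<longlonglongrightarrow> qform P v"
      unfolding cip_def matrix_vector_mult_def using assms(2)
      by (auto intro!: tendsto_intros)
    then show ?thesis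
      by (rule LIMSEQ_le_const) (use assms(1) psd_qform in blast)
  qed
  ultimately show ?thesis by (simp add: psd_def hermitian_mat_def)
qed

lemma closed_psd: "closed {P :: complex^'n^'n. psd P}"
  unfolding closed_sequential_limits using psd_limit by blast

section \<open>Rank-one decompositions with dual families\<close>

lemma psd_qform_eq_0:
  assumes "psd P" and "qform P v = 0"
  shows "P *v v = 0"
proof (rule ccontr)
  \<comment> \<open>the form at \<open>v - t a\<close> is \<open>- 2 t |a|\<^sup>2 + t\<^sup>2 q\<close>, negative for this small \<open>t\<close> unless \<open>a = 0\<close>\<close>
  define a where "a = P *v v"
  define q where "q = qform P a"
  define t where "t = (norm a)\<^sup>2 / (q + 1)"
  assume "P *v v \<noteq> 0"
  then have a: "(norm a)\<^sup>2 > 0" by (simp add: a_def)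
  have q: "q \<ge> 0" unfolding q_def by (rule psd_qform[OF assms(1)])
  then have t: "t > 0" using a by (simp add: t_def)
  have cross: "cip v (P *v a) = cip a a" "cip a (P *v v) = cip a a"
    using cip_mult_right[of v P a] assms(1) by (simp_all add: psd_adj a_def)
  have "0 \<le> qform P (v - t *\<^sub>R a)"
    by (rule psd_qform[OF assms(1)])
  also have "\<dots> = - 2 * t * (norm a)\<^sup>2 + t\<^sup>2 * q"
    using assms(2) cross unfolding q_def
    by (simp add: matrix_vector_mult_diff_distrib cip_diff_left cip_diff_right
        matrix_vector_scaleR cip_scaleR_left cip_scaleR_right cip_self power2_eq_square
        algebra_simps del: of_real_power)
  finally have "0 \<le> t * (t * q - 2 * (norm a)\<^sup>2)"
    by (simp add: algebra_simps power2_eq_square)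
  then have "2 * (norm a)\<^sup>2 \<le> t * q"
    using t by (simp add: zero_le_mult_iff)
  also have "\<dots> \<le> (norm a)\<^sup>2"
    using a q by (simp add: t_def field_simps)
  finally show False using a by simp
qed

text \<open>The rank-one matrix \<open>b b\<^sup>*\<close>.\<close>

definition outer :: "complex^'n \<Rightarrow> complex^'n^'n" where
  "outer b = (\<chi> i j. b $ i * cnj (b $ j))"

lemma outer_mult_vec: "outer b *v w = cip b w *s b"
  by (simp add: outer_def matrix_vector_mult_def cip_def vec_eq_iff sum_distrib_left
      sum_distrib_right ac_simps)

lemma adjoint_outer: "adjoint_mat (outer b) = outer b"
  by (simp add: outer_def vec_eq_iff mult.commute)

lemma sum_matrix_vector_mult: "(\<Sum>i\<in>I. f i) *v (x :: complex^'n) = (\<Sum>i\<in>I. f i *v x)"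
  by (induction I rule: infinite_finite_induct) (auto simp: matrix_vector_mult_add_rdistrib)

lemma qform_outer: "qform (outer b) w = (cmod (cip b w))\<^sup>2"
proof -
  have "cip w (outer b *v w) = cip b w * cnj (cip b w)"
    by (simp add: outer_mult_vec cip_smult_right cip_commute[of w b])
  also have "Re \<dots> = (cmod (cip b w))\<^sup>2"
    by (metis Re_complex_of_real complex_norm_square)
  finally show ?thesis .
qed

text \<open>Every positive semidefinite matrix is a sum of rank-one matrices over a family that comes
  with a dual family: Gaussian elimination removes one coordinate direction that the matrix does
  not kill, and the remainder kills it.\<close>

lemma psd_biorthogonal:
  fixes P :: "complex^'n^'n"
  assumes "psd P"
  shows "\<exists>I b d. P = (\<Sum>k\<in>I. outer (b k)) \<and> I \<subseteq> {k. P *v axis k 1 \<noteq> 0} \<and>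
    (\<forall>j\<in>I. \<forall>k\<in>I. cip (b j) (d k) = (if j = k then 1 else 0))"
  using assms
proof (induction "card {k. P *v axis k 1 \<noteq> 0}" arbitrary: P rule: less_induct)
  case less
  show ?case
  proof (cases "\<forall>k. P *v axis k 1 = 0")
    case True
    have "P = 0"
      using True by (simp add: vec_eq_iff matrix_vector_mult_def axis_def if_distrib cong: if_cong)
    then show ?thesis by (intro exI[of _ "{}"]) simp
  next
    case False
    then obtain k where k: "P *v axis k 1 \<noteq> 0" by blast
    define s where "s = qform P (axis k 1)"
    have s: "s > 0"
      using psd_qform[OF less.prems, of "axis k 1"] psd_qform_eq_0[OF less.prems, of "axis k 1"] k
      by (auto simp: s_def less_le)
    define v where "v = (1 / sqrt s) *\<^sub>R (axis k 1 :: complex^'n)"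
    define b where "b = P *v v"
    have adjP: "adjoint_mat P = P" using less.prems by (rule psd_adj)
    have Pv: "cip v (P *v w) = cip b w" for w
      unfolding b_def by (simp add: cip_mult_left adjP)
    have "cip b v = cnj (cip b v)" using Pv[of v] cip_commute[of b v] by (simp add: b_def)
    moreover have "Re (cip b v) = 1"
      using s by (simp add: b_def v_def cip_mult_left adjP matrix_vector_scaleR cip_scaleR_left
          cip_scaleR_right flip: s_def)
    ultimately have bv: "cip b v = 1"
      by (simp add: complex_eq_iff)
    have vb: "cip v b = 1" using Pv[of v] bv by (simp add: b_def)
    define P' where "P' = P - outer b"
    have psd': "psd P'"
      unfolding psd_def hermitian_mat_def
    proof (intro conjI allI)
      show "adjoint_mat P' = P'" by (simp add: P'_def adjoint_diff adjoint_outer adjP)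
      fix w
      define c where "c = cip b w"
      have "0 \<le> qform P (w - c *s v)" by (rule psd_qform[OF less.prems])
      also have "cip (w - c *s v) (P *v (w - c *s v)) = cip w (P *v w) - c * cip w b
          - cnj c * cip b w + cnj c * c * cip b v"
        by (simp add: bv vb matrix_vector_mult_diff_distrib cip_diff_left cip_diff_right
            vector_scalar_commute cip_smult_left cip_smult_right Pv algebra_simps flip: b_def)
      also have "cip w b = cnj c" using cip_commute[of w b] by (simp add: c_def)
      also have "cip w (P *v w) - c * cnj c - cnj c * cip b w + cnj c * c * cip b v = cip w (P *v w) - c * cnj c"
        by (simp add: bv c_def)
      also have "Re \<dots> = qform P w - (cmod c)\<^sup>2"
        by (metis Re_complex_of_real complex_norm_square minus_complex.simps(1))
      finally show "0 \<le> qform P' w"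
        by (simp add: P'_def matrix_vector_mult_diff_rdistrib cip_diff_right qform_outer c_def)
    qed
    have P'v: "P' *v v = 0"
      by (simp add: P'_def matrix_vector_mult_diff_rdistrib outer_mult_vec bv flip: b_def)
    then have P'k: "P' *v axis k 1 = 0"
      using s by (simp add: v_def matrix_vector_scaleR)
    have keep: "P' *v axis j 1 = 0" if "P *v axis j 1 = 0" for j
    proof -
      have "cip b (axis j 1) = cip v (P *v axis j 1)" by (simp add: Pv)
      then show ?thesis
        using that by (simp add: P'_def matrix_vector_mult_diff_rdistrib outer_mult_vec)
    qed
    have "card {j. P' *v axis j 1 \<noteq> 0} < card {j. P *v axis j 1 \<noteq> 0}"
      by (rule psubset_card_mono) (use P'k k keep in auto)
    then obtain I b' d' where I: "P' = (\<Sum>j\<in>I. outer (b' j))" "I \<subseteq> {j. P' *v axis j 1 \<noteq> 0}"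
      "\<forall>j\<in>I. \<forall>l\<in>I. cip (b' j) (d' l) = (if j = l then 1 else 0)"
      using less.hyps[OF _ psd'] by blast
    have kI: "k \<notin> I" using I(2) P'k by auto
    have fin: "finite I" by simp
    have "(\<Sum>j\<in>I. (cmod (cip (b' j) v))\<^sup>2) = qform P' v"
      by (simp add: I(1) sum_matrix_vector_mult cip_sum_right qform_outer)
    also have "\<dots> = 0" by (simp add: P'v)
    finally have b'v: "cip (b' j) v = 0" if "j \<in> I" for j
      using that by (simp add: sum_nonneg_eq_0_iff fin)
    define B where "B = (\<lambda>j. if j = k then b else b' j)"
    define D where "D = (\<lambda>j. if j = k then v else d' j - cip b (d' j) *s v)"
    have "P = outer b + P'" by (simp add: P'_def)
    also have "P' = (\<Sum>j\<in>I. outer (B j))"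
      unfolding I(1) using kI by (intro sum.cong) (auto simp: B_def)
    finally have "P = (\<Sum>j\<in>insert k I. outer (B j))"
      using kI fin by (simp add: B_def)
    moreover have "insert k I \<subseteq> {j. P *v axis j 1 \<noteq> 0}"
      using I(2) k keep by auto
    moreover have "\<forall>j\<in>insert k I. \<forall>l\<in>insert k I. cip (B j) (D l) = (if j = l then 1 else 0)"
      using kI I(3) bv b'v by (auto simp: B_def D_def cip_diff_right cip_smult_right)
    ultimately show ?thesis by blast
  qed
qed

lemma psd_factor:
  fixes P :: "complex^'n^'n"
  assumes "psd P"
  obtains B :: "complex^'n^'n" where "P = B ** adjoint_mat B"
proof -
  obtain I b where P: "P = (\<Sum>k\<in>I. outer (b k :: complex^'n))" and I: "finite (I :: 'n set)"
    using psd_biorthogonal[OF assms] by (metis finite_class.finite)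
  define B :: "complex^'n^'n" where "B = (\<chi> i k. if k \<in> I then b k $ i else 0)"
  have "P = B ** adjoint_mat B"
    by (simp add: vec_eq_iff B_def P matrix_matrix_mult_def outer_def if_distrib if_distribR sum.If_cases
        cong: if_cong)
  then show ?thesis by (rule that)
qed

section \<open>Weighted Hilbert-Schmidt forms\<close>

text \<open>The square of the Hilbert-Schmidt norm of \<open>P\<^sup>1\<^sup>/\<^sup>2 Z Q\<^sup>1\<^sup>/\<^sup>2\<close> for positive semidefinite \<open>P\<close> and \<open>Q\<close>,
  written without square roots.\<close>

definition wt :: "complex^'n^'n \<Rightarrow> complex^'n^'n \<Rightarrow> complex^'n^'n \<Rightarrow> real" where
  "wt P Q Z = Re (trace (P ** Z ** Q ** adjoint_mat Z))"

lemma trace_scaleR: "trace (k *\<^sub>R A) = k *\<^sub>R trace (A :: complex^'n^'n)"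
  by (simp add: trace_def scaleR_sum_right)

lemma trace_zero [simp]: "trace 0 = (0 :: complex)"
  by (simp add: trace_def)

lemma trace_sum: "trace (\<Sum>i\<in>I. f i) = (\<Sum>i\<in>I. trace (f i :: complex^'n^'n))"
  by (induction I rule: infinite_finite_induct) (auto simp: trace_add)

lemma power2_norm_trace: "(norm Z)\<^sup>2 = Re (trace (Z ** adjoint_mat Z))"
proof -
  have "complex_of_real ((norm Z)\<^sup>2) = trace (Z ** adjoint_mat Z)"
    by (simp only: power2_norm_vec trace_def matrix_matrix_mult_def of_real_sum complex_norm_square)
      simp
  then show ?thesis by (metis Re_complex_of_real)
qed

lemma wt_gram: "wt (B ** adjoint_mat B) (D ** adjoint_mat D) Z = (norm (adjoint_mat B ** Z ** D))\<^sup>2"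
  unfolding wt_def power2_norm_trace
  by (simp add: adjoint_mult matrix_mul_assoc) (metis matrix_mul_assoc trace_mul_sym)

lemma wt_one: "wt (mat 1) (mat 1) Z = (norm Z)\<^sup>2"
  by (simp add: wt_def power2_norm_trace)

lemma wt_nonneg: "psd P \<Longrightarrow> psd Q \<Longrightarrow> 0 \<le> wt P Q Z"
  by (metis psd_factor wt_gram zero_le_power2)

lemma wt_diff_left: "wt (P - P') Q Z = wt P Q Z - wt P' Q Z"
  by (simp add: wt_def matrix_ring_simps trace_sub)

lemma wt_diff_middle: "wt P (Q - Q') Z = wt P Q Z - wt P Q' Z"
  by (simp add: wt_def matrix_ring_simps trace_sub)

lemma wt_scaleR_left: "wt (k *\<^sub>R P) Q Z = k * wt P Q Z"
  by (simp add: wt_def matrix_ring_simps trace_scaleR)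

lemma wt_scaleR_middle: "wt P (k *\<^sub>R Q) Z = k * wt P Q Z"
  by (simp add: wt_def matrix_ring_simps trace_scaleR)

lemma wt_scaleR_right: "wt P Q (k *\<^sub>R Z) = k\<^sup>2 * wt P Q Z"
  by (simp add: wt_def matrix_ring_simps trace_scaleR adjoint_scaleR power2_eq_square)

lemma wt_mono: "P \<preceq> P' \<Longrightarrow> Q \<preceq> Q' \<Longrightarrow> psd P' \<Longrightarrow> psd Q \<Longrightarrow> wt P Q Z \<le> wt P' Q' Z"
  using wt_nonneg[of "P' - P" Q Z] wt_nonneg[of P' "Q' - Q" Z]
  by (simp add: loewner_def wt_diff_left wt_diff_middle)

lemma wt_cauchy_schwarz:
  assumes "psd P" "psd Q"
  shows "wt P Q B - wt P Q (F - B) \<le> 2 * sqrt (wt P Q B * wt P Q F)"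
proof -
  obtain S T where S: "P = S ** adjoint_mat S" and T: "Q = T ** adjoint_mat T"
    using assms psd_factor by metis
  define b where "b = adjoint_mat S ** B ** T"
  define f where "f = adjoint_mat S ** F ** T"
  have "wt P Q (F - B) = (norm (f - b))\<^sup>2"
    by (simp add: S T wt_gram b_def f_def matrix_ring_simps)
  moreover have "(norm b - norm f)\<^sup>2 \<le> (norm (f - b))\<^sup>2"
    by (metis abs_ge_zero norm_minus_commute norm_triangle_ineq3 power2_abs power_mono)
  moreover have "wt P Q B = (norm b)\<^sup>2" "wt P Q F = (norm f)\<^sup>2"
    by (simp_all add: S T wt_gram b_def f_def)
  moreover from this have "sqrt (wt P Q B * wt P Q F) = norm b * norm f"
    by (simp add: real_sqrt_mult)
  ultimately show ?thesis
    using zero_le_power2[of "norm f"] unfolding power2_diff by linarith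
qed

lemma wt_add_le:
  assumes "psd P" "psd Q"
  shows "wt P Q (B - F) \<le> 2 * wt P Q B + 2 * wt P Q F"
proof -
  obtain S T where S: "P = S ** adjoint_mat S" and T: "Q = T ** adjoint_mat T"
    using assms psd_factor by metis
  define b where "b = adjoint_mat S ** B ** T"
  define f where "f = adjoint_mat S ** F ** T"
  have "wt P Q (B - F) = (norm (b - f))\<^sup>2"
    by (simp add: S T wt_gram b_def f_def matrix_ring_simps)
  also have "\<dots> \<le> (norm b + norm f)\<^sup>2"
    by (intro power_mono norm_triangle_ineq4) simp
  also have "\<dots> \<le> 2 * (norm b)\<^sup>2 + 2 * (norm f)\<^sup>2"
    using zero_le_power2[of "norm b - norm f"] by (simp add: power2_eq_square algebra_simps)
  finally show ?thesis by (simp add: S T wt_gram b_def f_def)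
qed

section \<open>The covariance map of a Hermitian pencil\<close>

locale hermitian_pencil =
  fixes r :: nat and A :: "nat \<Rightarrow> complex^'n^'n"
  assumes pencil_adj: "i \<in> {1..r} \<Longrightarrow> adjoint_mat (A i) = A i"
begin

abbreviation \<eta> :: "complex^'n^'n \<Rightarrow> complex^'n^'n" where
  "\<eta> \<equiv> covariance_map r A"

lemma \<eta>_add: "\<eta> (X + Y) = \<eta> X + \<eta> Y"
  by (simp add: covariance_map_def matrix_ring_simps sum.distrib)

lemma \<eta>_diff: "\<eta> (X - Y) = \<eta> X - \<eta> Y"
  by (simp add: covariance_map_def matrix_ring_simps sum_subtractf)

lemma \<eta>_scaleR: "\<eta> (k *\<^sub>R X) = k *\<^sub>R \<eta> X"
  by (simp add: covariance_map_def matrix_ring_simps scaleR_sum_right)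

lemma \<eta>_adjoint: "adjoint_mat (\<eta> X) = \<eta> (adjoint_mat X)"
  unfolding covariance_map_def adjoint_sum
  by (rule sum.cong) (auto simp: adjoint_mult pencil_adj matrix_mul_assoc)

lemma \<eta>_psd: "psd X \<Longrightarrow> psd (\<eta> X)"
  unfolding covariance_map_def by (rule psd_sum) (metis pencil_adj psd_conj)

lemma \<eta>_mono: "X \<preceq> Y \<Longrightarrow> \<eta> X \<preceq> \<eta> Y"
  unfolding loewner_def by (metis \<eta>_diff \<eta>_psd)

lemma trace_\<eta>: "trace (P ** \<eta> Q) = trace (\<eta> P ** Q)"
proof -
  have "trace (P ** (A i ** Q ** A i)) = trace (A i ** P ** A i ** Q)" for i
    by (metis matrix_mul_assoc trace_mul_sym)
  then show ?thesis
    by (simp add: covariance_map_def matrix_sum_left matrix_sum_right trace_sum)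
qed

definition pencil_size :: real where
  "pencil_size = (\<Sum>i=1..r. (norm (A i))\<^sup>2)"

lemma pencil_size_nonneg: "0 \<le> pencil_size"
  by (simp add: pencil_size_def sum_nonneg)

lemma norm_\<eta>_le: "norm (\<eta> X) \<le> pencil_size * norm X"
proof -
  have "norm (A i ** X ** A i) \<le> (norm (A i))\<^sup>2 * norm X" for i
  proof -
    have "norm (A i ** X ** A i) \<le> norm (A i ** X) * norm (A i)" by (rule norm_matrix_mult_le)
    also have "\<dots> \<le> norm (A i) * norm X * norm (A i)"
      by (intro mult_right_mono norm_matrix_mult_le) simp
    finally show ?thesis by (simp add: power2_eq_square ac_simps)
  qed
  then show ?thesis
    unfolding covariance_map_def pencil_size_def sum_distrib_right
    by (intro order_trans[OF norm_sum] sum_mono)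
qed

lemma bounded_linear_\<eta>: "bounded_linear \<eta>"
  by (rule bounded_linear_intro[of _ pencil_size])
    (simp_all add: \<eta>_add \<eta>_scaleR norm_\<eta>_le mult.commute[of "norm _"])

lemmas tendsto_\<eta> = bounded_linear.tendsto[OF bounded_linear_\<eta>]
lemmas continuous_on_\<eta> = bounded_linear.continuous_on[OF bounded_linear_\<eta>]

text \<open>A Cauchy-Schwarz inequality for the covariance map with the defect written out. The sum of the
  weighted squares of \<open>A\<^sub>i B - B' A\<^sub>i\<close> expands into four terms, and the symmetry of \<open>\<eta>\<close> under the trace
  identifies each of them; \<open>B\<close> and \<open>B'\<close> are \<open>Z\<close> and \<open>\<eta>(Z)\<close> in the coordinates given by \<open>X\<^sub>2\<close> and \<open>Y\<^sub>2\<close>.\<close>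

lemma gap_identity:
  assumes X: "adjoint_mat X1 = X1" "adjoint_mat X2 = X2" "adjoint_mat Y2 = Y2"
    and Y1: "\<eta> X1 = Y1 - d1 *\<^sub>R mat 1" and Y2: "\<eta> X2 = Y2 - d2 *\<^sub>R mat 1"
    and B': "\<eta> (B ** X2) = B' ** Y2"
  shows "wt X1 Y2 B' = wt Y1 X2 B - d1 * wt (mat 1) X2 B - d2 * wt X1 (mat 1) B'
    - (\<Sum>i=1..r. wt X1 X2 (A i ** B - B' ** A i))"
proof -
  define b where "b = adjoint_mat B"
  define b' where "b' = adjoint_mat B'"
  have B'adj: "\<eta> (X2 ** b) = Y2 ** b'"
    using arg_cong[OF B', of adjoint_mat] by (simp add: \<eta>_adjoint adjoint_mult X b_def b'_def)
  have expand: "trace (X1 ** (A i ** B - B' ** A i) ** X2 ** adjoint_mat (A i ** B - B' ** A i))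
     = trace (X1 ** (A i ** (B ** X2 ** b) ** A i)) - trace (X1 ** (A i ** (B ** X2) ** A i) ** b')
       - trace (X1 ** B' ** (A i ** (X2 ** b) ** A i)) + trace (X1 ** B' ** (A i ** X2 ** A i) ** b')"
    if "i \<in> {1..r}" for i
    using pencil_adj[OF that]
    by (simp add: adjoint_diff adjoint_mult matrix_ring_simps trace_add trace_sub flip: b_def b'_def)
  have "(\<Sum>i=1..r. trace (X1 ** (A i ** B - B' ** A i) ** X2 ** adjoint_mat (A i ** B - B' ** A i)))
     = trace (X1 ** \<eta> (B ** X2 ** b)) - trace (X1 ** \<eta> (B ** X2) ** b')
       - trace (X1 ** B' ** \<eta> (X2 ** b)) + trace (X1 ** B' ** \<eta> X2 ** b')"
    by (simp add: expand sum.distrib sum_subtractf covariance_map_def matrix_sum_left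
        matrix_sum_right trace_sum)
  also have "trace (X1 ** \<eta> (B ** X2 ** b)) = trace (Y1 ** B ** X2 ** b) - d1 *\<^sub>R trace (B ** X2 ** b)"
    by (simp add: trace_\<eta> Y1 matrix_ring_simps trace_sub trace_scaleR)
  also have "trace (X1 ** \<eta> (B ** X2) ** b') = trace (X1 ** B' ** Y2 ** b')"
    by (simp add: B' matrix_mul_assoc)
  also have "trace (X1 ** B' ** \<eta> (X2 ** b)) = trace (X1 ** B' ** Y2 ** b')"
    by (simp add: B'adj matrix_mul_assoc)
  also have "trace (X1 ** B' ** \<eta> X2 ** b') = trace (X1 ** B' ** Y2 ** b') - d2 *\<^sub>R trace (X1 ** B' ** b')"
    by (simp add: Y2 matrix_ring_simps trace_sub trace_scaleR)
  finally show ?thesis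
    by (simp add: wt_def flip: b_def b'_def Re_sum)
qed

end

section \<open>Positive definite matrices\<close>

lemma posdef_lower_bound:
  fixes P :: "complex^'n^'n"
  assumes "posdef_mat P"
  obtains c where "c > 0" and "c *\<^sub>R mat 1 \<preceq> P"
proof -
  have cont: "continuous_on (sphere 0 1) (qform P)"
    unfolding cip_def matrix_vector_mult_def by (intro continuous_intros)
  have "axis undefined 1 \<in> sphere (0 :: complex^'n) 1"
    by (simp add: norm_vec_def L2_set_def axis_def if_distrib if_distribR cong: if_cong)
  then have ne: "sphere (0 :: complex^'n) 1 \<noteq> {}" by blast
  obtain w :: "complex^'n" where w: "norm w = 1" and min: "\<And>v. norm v = 1 \<Longrightarrow> qform P w \<le> qform P v"
    using continuous_attains_inf[OF compact_sphere ne cont] by auto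
  have bound: "qform P w * (norm v)\<^sup>2 \<le> qform P v" for v
  proof (cases "v = 0")
    case False
    have "qform P w \<le> qform P ((1 / norm v) *\<^sub>R v)"
      using False by (intro min) simp
    also have "\<dots> = qform P v / (norm v)\<^sup>2"
      by (simp add: matrix_vector_scaleR cip_scaleR_left cip_scaleR_right power2_eq_square)
    finally show ?thesis using False by (simp add: field_simps)
  qed simp
  show ?thesis
  proof
    have "w \<noteq> 0" using w by auto
    then show "qform P w > 0" using assms by (auto simp: posdef_iff)
    show "qform P w *\<^sub>R mat 1 \<preceq> P"
      using assms bound
      by (intro loewnerI) (auto simp: posdef_iff hermitian_mat_def adjoint_scaleR scaleR_matrix_vector
          cip_scaleR_right cip_self simp flip: of_real_power)
  qed
qed

lemma psd_lower_imp_posdef: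
  assumes "c > 0" and "c *\<^sub>R mat 1 \<preceq> P" and "psd P"
  shows "posdef_mat P"
proof -
  have "0 < qform P v" if "v \<noteq> 0" for v
  proof -
    have "0 < c * (norm v)\<^sup>2" using that assms(1) by simp
    also have "\<dots> \<le> qform P v"
      using loewner_qform[OF assms(2), of v]
      by (simp add: scaleR_matrix_vector cip_scaleR_right cip_self del: of_real_power)
    finally show ?thesis .
  qed
  then show ?thesis using assms(3) by (auto simp: posdef_iff psd_def)
qed

lemma posdef_inverse:
  fixes P :: "complex^'n^'n"
  assumes "posdef_mat P"
  obtains Q where "P ** Q = mat 1" and "Q ** P = mat 1"
proof -
  have "\<forall>x. P *v x = 0 \<longrightarrow> x = 0"
    using assms unfolding posdef_iff by (metis cip_zero(2) less_irrefl zero_complex.simps(1))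
  then obtain Q where "Q ** P = mat 1"
    using matrix_left_invertible_ker by blast
  then show ?thesis using that matrix_left_right_inverse by blast
qed

lemma wt_lower:
  assumes "a *\<^sub>R mat 1 \<preceq> P" "b *\<^sub>R mat 1 \<preceq> Q" "0 \<le> a" "0 \<le> b" "psd P"
  shows "a * b * (norm Z)\<^sup>2 \<le> wt P Q Z"
  using wt_mono[OF assms(1,2,5), of Z] assms(4)
  by (simp add: wt_scaleR_left wt_scaleR_middle wt_one psd_scaleR mult_ac)

lemma wt_posdef_eq_0:
  assumes "posdef_mat P" "posdef_mat Q" "wt P Q Z \<le> 0"
  shows "Z = 0"
proof -
  obtain a where a: "a > 0" "a *\<^sub>R mat 1 \<preceq> P" using posdef_lower_bound[OF assms(1)] .
  obtain b where b: "b > 0" "b *\<^sub>R mat 1 \<preceq> Q" using posdef_lower_bound[OF assms(2)] .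
  have "a * b * (norm Z)\<^sup>2 \<le> 0"
    using wt_lower[OF a(2) b(2), of Z] a(1) b(1) assms(3) posdef_imp_psd[OF assms(1)] by linarith
  then show ?thesis using a(1) b(1) by (simp add: mult_le_0_iff)
qed

lemma posdef_one: "posdef_mat (mat 1)"
  by (rule psd_lower_imp_posdef[of 1]) (auto simp: loewner_def)

section \<open>Real part of a matrix\<close>

definition rp :: "complex^'n^'n \<Rightarrow> complex^'n^'n" where
  "rp W = (1/2) *\<^sub>R (W + adjoint_mat W)"

definition rtr :: "complex^'n^'n \<Rightarrow> real" where
  "rtr W = Re (trace W)"

lemma adjoint_rp [simp]: "adjoint_mat (rp W) = rp W"
  by (simp add: rp_def adjoint_scaleR adjoint_add add.commute)

text \<open>Congruence by an inverse preserves the real part: since \<open>W V = 1\<close>, one has \<open>W (V + V\<^sup>*) W\<^sup>* = W\<^sup>* + W\<close>.\<close>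

lemma rp_conj:
  assumes "W ** V = mat 1"
  shows "W ** rp V ** adjoint_mat W = rp W"
proof -
  have "adjoint_mat V ** adjoint_mat W = mat 1"
    by (metis adjoint_mult adjoint_one assms)
  then have "W ** adjoint_mat V ** adjoint_mat W = W" by (metis matrix_mul_assoc matrix_mul_rid)
  then show ?thesis
    by (simp add: rp_def matrix_ring_simps assms add.commute)
qed

lemma rp_conj':
  assumes "V ** W = mat 1"
  shows "adjoint_mat W ** rp V ** W = rp W"
proof -
  have "adjoint_mat W ** adjoint_mat V = mat 1"
    by (metis adjoint_mult adjoint_one assms)
  then have "adjoint_mat W ** adjoint_mat V ** W = W" "adjoint_mat W ** V ** W = adjoint_mat W"
    using assms by (simp, metis matrix_mul_assoc matrix_mul_rid)
  then show ?thesis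
    by (simp add: rp_def matrix_ring_simps)
qed

lemma rtr_rp: "rtr (rp W) = rtr W"
  by (simp add: rtr_def rp_def trace_scaleR trace_add trace_def)

lemma psd_norm_le_rtr:
  assumes "psd P"
  shows "norm P \<le> rtr P" and "P \<preceq> rtr P *\<^sub>R mat 1"
proof -
  obtain B where B: "P = B ** adjoint_mat B" using psd_factor[OF assms] .
  have tr: "rtr P = (norm B)\<^sup>2" by (simp add: B rtr_def power2_norm_trace)
  show "norm P \<le> rtr P"
    using norm_matrix_mult_le[of B "adjoint_mat B"] unfolding tr by (simp add: B power2_eq_square)
  show "P \<preceq> rtr P *\<^sub>R mat 1"
  proof (rule loewnerI)
    fix v
    have "qform P v = (norm (adjoint_mat B *v v))\<^sup>2"
      by (simp add: B cip_mult_right[of v B] cip_self flip: matrix_vector_mul_assoc del: of_real_power)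
    also have "\<dots> \<le> (norm B * norm v)\<^sup>2"
      by (intro power_mono) (use norm_matrix_vector_mult_le[of "adjoint_mat B" v] in auto)
    also have "\<dots> = qform (rtr P *\<^sub>R mat 1) v"
      by (simp add: tr scaleR_matrix_vector cip_scaleR_right cip_self power_mult_distrib
          del: of_real_power)
    finally show "qform P v \<le> qform (rtr P *\<^sub>R mat 1) v" .
  qed (use assms in \<open>auto simp: psd_def hermitian_mat_def adjoint_scaleR\<close>)
qed

lemma rtr_le_norm: "\<bar>rtr (W :: complex^'n^'n)\<bar> \<le> real CARD('n) * norm W"
proof -
  have "\<bar>rtr W\<bar> \<le> (\<Sum>i\<in>UNIV. cmod (W $ i $ i))"
    unfolding rtr_def trace_def by (intro order_trans[OF abs_Re_le_cmod] norm_sum)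
  also have "\<dots> \<le> (\<Sum>i\<in>(UNIV :: 'n set). norm W)"
    by (intro sum_mono) (meson Finite_Cartesian_Product.norm_nth_le order_trans)
  finally show ?thesis by simp
qed

lemma rtr_nonneg: "psd P \<Longrightarrow> 0 \<le> rtr P"
  using psd_norm_le_rtr(1) norm_ge_zero order_trans by blast

lemma mat_scalar_commute: "mat c ** M = M ** mat (c :: complex)"
  by (simp add: matrix_matrix_mult_def mat_def vec_eq_iff if_distrib if_distribR mult.commute cong: if_cong)

lemma mat_of_real: "mat (complex_of_real c) = c *\<^sub>R mat 1"
  by (simp add: mat_def vec_eq_iff of_real_def)

lemma mat_plus: "mat (a + b) = mat a + mat (b :: 'a::monoid_add)"
  by (simp add: mat_def vec_eq_iff)

lemma mat_minus: "mat (a - b) = mat a - mat (b :: 'a::group_add)"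
  by (simp add: mat_def vec_eq_iff)

lemma mat_two_mult: "mat 2 ** M = M + (M :: complex^'n^'n)"
  by (simp add: matrix_matrix_mult_def mat_def vec_eq_iff if_distrib if_distribR cong: if_cong)

lemma wt_mat_mult: "wt P Q (mat c ** Z) = (cmod c)\<^sup>2 * wt P Q Z"
proof -
  have tr: "trace (mat a ** M) = a * trace M" for a and M :: "complex^'n^'n"
    by (simp add: trace_def matrix_matrix_mult_def mat_def if_distrib if_distribR sum_distrib_left cong: if_cong)
  have "P ** (mat c ** Z) ** Q ** adjoint_mat (mat c ** Z)
      = (P ** mat c) ** Z ** Q ** adjoint_mat Z ** mat (cnj c)"
    by (simp only: adjoint_mult adjoint_mat_scalar matrix_mul_assoc)
  also have "\<dots> = mat c ** (P ** Z ** Q ** adjoint_mat Z ** mat (cnj c))"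
    by (simp only: mat_scalar_commute[of c P, symmetric] matrix_mul_assoc)
  also have "P ** Z ** Q ** adjoint_mat Z ** mat (cnj c) = mat (cnj c) ** (P ** Z ** Q ** adjoint_mat Z)"
    by (rule mat_scalar_commute[symmetric])
  finally have "trace (P ** (mat c ** Z) ** Q ** adjoint_mat (mat c ** Z))
      = (c * cnj c) * trace (P ** Z ** Q ** adjoint_mat Z)"
    by (simp add: tr)
  then show ?thesis
    by (simp add: wt_def flip: complex_norm_square of_real_power)
qed

lemma rp_add: "rp (A + B) = rp A + rp B"
  by (simp add: rp_def adjoint_add algebra_simps)

lemma rp_mat: "rp (mat u) = Re u *\<^sub>R mat 1"
  by (simp add: rp_def adjoint_mat_scalar vec_eq_iff mat_def complex_add_cnj scaleR_conv_of_real[where 'a = complex])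

lemma norm_mat_mult: "norm (mat c ** M) = cmod c * norm (M :: complex^'n^'n)"
proof -
  have "(mat c ** M) $ i $ j = c * M $ i $ j" for i j
    by (simp add: matrix_matrix_mult_def mat_def if_distrib if_distribR cong: if_cong)
  then have "(norm (mat c ** M))\<^sup>2 = (cmod c * norm M)\<^sup>2"
    by (simp add: power2_norm_vec norm_mult power_mult_distrib sum_distrib_left)
  then show ?thesis by simp
qed

section \<open>Solutions of the Dyson equation\<close>

context hermitian_pencil
begin

lemma rp_\<eta>: "rp (\<eta> W) = \<eta> (rp W)"
  by (simp add: rp_def \<eta>_add \<eta>_scaleR \<eta>_adjoint)

text \<open>With \<open>z = iu\<close> and \<open>W = iG\<close> the Dyson equation \<open>z G = 1 + \<eta>(G) G\<close> reads \<open>W\<^sup>-\<^sup>1 = u + \<eta>(W)\<close>, and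
  the sign of the imaginary part of \<open>G\<close> becomes positivity of the real part of \<open>W\<close>.\<close>

definition dyson :: "complex \<Rightarrow> complex^'n^'n \<Rightarrow> bool" where
  "dyson u W \<longleftrightarrow> W ** (mat u + \<eta> W) = mat 1 \<and> (mat u + \<eta> W) ** W = mat 1 \<and> posdef_mat (rp W)"

text \<open>The relations between the real parts \<open>X\<close> of \<open>W\<close> and \<open>Y\<close> of \<open>V = W\<^sup>-\<^sup>1\<close>.\<close>

lemma dyson_re:
  assumes "dyson u W"
  defines "V \<equiv> mat u + \<eta> W" and "X \<equiv> rp W"
  defines "Y \<equiv> Re u *\<^sub>R mat 1 + \<eta> X"
  shows "W ** V = mat 1" "V ** W = mat 1" "posdef_mat X"
    "W ** Y ** adjoint_mat W = X" "adjoint_mat W ** Y ** W = X"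
    "V ** X ** adjoint_mat V = Y" "adjoint_mat V ** X ** V = Y"
    "adjoint_mat Y = Y" "\<eta> X = Y - Re u *\<^sub>R mat 1"
proof -
  show WV: "W ** V = mat 1" "V ** W = mat 1" and "posdef_mat X"
    using assms(1) by (auto simp: dyson_def V_def X_def)
  have Y: "Y = rp V" by (simp add: Y_def V_def X_def rp_add rp_\<eta> rp_mat)
  show "W ** Y ** adjoint_mat W = X" "adjoint_mat W ** Y ** W = X"
    "V ** X ** adjoint_mat V = Y" "adjoint_mat V ** X ** V = Y"
    using WV by (simp_all add: Y X_def rp_conj rp_conj')
  show "adjoint_mat Y = Y" by (simp add: Y)
  show "\<eta> X = Y - Re u *\<^sub>R mat 1" by (simp add: Y_def)
qed

lemma dyson_psd:
  assumes "dyson u W" "0 \<le> Re u"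
  shows "psd (rp W)" "psd (Re u *\<^sub>R mat 1 + \<eta> (rp W))"
  using dyson_re(3)[OF assms(1)] assms(2)
  by (auto intro!: psd_add psd_scaleR \<eta>_psd simp: posdef_imp_psd)

text \<open>The real part satisfies \<open>X = Re u W W\<^sup>* + W \<eta>(X) W\<^sup>*\<close>, so it is definite as soon as it is
  semidefinite.\<close>

lemma dysonI:
  assumes "W ** (mat u + \<eta> W) = mat 1" and "psd (rp W)" and "0 < Re u"
  shows "dyson u W"
proof -
  define V where "V = mat u + \<eta> W"
  have WV: "W ** V = mat 1" "V ** W = mat 1"
    using assms(1) matrix_left_right_inverse by (auto simp: V_def)
  have "rp W = W ** rp V ** adjoint_mat W" using WV by (simp add: rp_conj)
  also have "\<dots> = Re u *\<^sub>R (W ** adjoint_mat W) + W ** \<eta> (rp W) ** adjoint_mat W"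
    by (simp add: V_def rp_add rp_\<eta> rp_mat matrix_ring_simps)
  finally have X: "rp W = Re u *\<^sub>R (W ** adjoint_mat W) + W ** \<eta> (rp W) ** adjoint_mat W" .
  have pos: "0 < qform (rp W) v" if "v \<noteq> 0" for v
  proof -
    have "adjoint_mat V ** adjoint_mat W = mat 1" by (metis WV(1) adjoint_mult adjoint_one)
    then have "adjoint_mat W *v v \<noteq> 0"
      using that by (metis matrix_vector_mul_assoc matrix_vector_mul_lid matrix_vector_mult_0_right)
    then have "0 < Re u * (norm (adjoint_mat W *v v))\<^sup>2" using assms(3) by simp
    also have "\<dots> = qform (Re u *\<^sub>R (W ** adjoint_mat W)) v"
      by (simp add: scaleR_matrix_vector cip_scaleR_right cip_mult_right[of v W] cip_self
          flip: matrix_vector_mul_assoc del: of_real_power)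
    also have "\<dots> \<le> qform (rp W) v"
      using psd_qform[OF psd_conj[OF \<eta>_psd[OF assms(2)]], of v W]
        arg_cong[OF X, of "\<lambda>M. qform M v"]
      by (simp add: matrix_vector_mult_add_rdistrib cip_add_right)
    finally show ?thesis .
  qed
  show ?thesis
    using WV pos assms(2) by (auto simp: dyson_def V_def posdef_iff psd_def)
qed

text \<open>The map \<open>Z \<mapsto> W\<^sub>1 \<eta>(Z) W\<^sub>2\<close>, written in the coordinate \<open>B = Z X\<^sub>2\<^sup>-\<^sup>1\<close>, does not increase
  the form with the weights \<open>Re W\<^sub>1\<^sup>-\<^sup>1\<close> and \<open>X\<^sub>2 = Re W\<^sub>2\<close>; the loss is explicit.\<close>

lemma dyson_gap:
  assumes D1: "dyson u1 W1" and D2: "dyson u2 W2"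
  defines "X1 \<equiv> rp W1" and "X2 \<equiv> rp W2"
  defines "Y1 \<equiv> Re u1 *\<^sub>R mat 1 + \<eta> X1" and "Y2 \<equiv> Re u2 *\<^sub>R mat 1 + \<eta> X2"
  assumes B': "\<eta> (B ** X2) = B' ** Y2"
  shows "wt Y1 X2 B - wt Y1 X2 (W1 ** B' ** adjoint_mat (mat u2 + \<eta> W2))
    = Re u1 * wt (mat 1) X2 B + Re u2 * wt X1 (mat 1) B'
      + (\<Sum>i=1..r. wt X1 X2 (A i ** B - B' ** A i))"
proof -
  define V2 where "V2 = mat u2 + \<eta> W2"
  note R1 = dyson_re[OF D1, folded X1_def, folded Y1_def]
  note R2 = dyson_re[OF D2, folded V2_def X2_def, folded Y2_def]
  have "wt Y1 X2 (W1 ** B' ** adjoint_mat V2)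
      = Re (trace (Y1 ** W1 ** B' ** (adjoint_mat V2 ** X2 ** V2) ** adjoint_mat B' ** adjoint_mat W1))"
    by (simp add: wt_def adjoint_mult matrix_mul_assoc)
  also have "\<dots> = Re (trace ((adjoint_mat W1 ** Y1 ** W1) ** B' ** (adjoint_mat V2 ** X2 ** V2) ** adjoint_mat B'))"
    by (subst trace_mul_sym) (simp add: matrix_mul_assoc)
  also have "\<dots> = wt X1 Y2 B'"
    by (simp add: wt_def R1 R2)
  finally have "wt Y1 X2 (W1 ** B' ** adjoint_mat V2) = wt X1 Y2 B'" .
  moreover have "wt X1 Y2 B' = wt Y1 X2 B - Re u1 * wt (mat 1) X2 B - Re u2 * wt X1 (mat 1) B'
    - (\<Sum>i=1..r. wt X1 X2 (A i ** B - B' ** A i))"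
    by (rule gap_identity) (use B' R1 R2 in \<open>auto simp: X1_def X2_def\<close>)
  ultimately show ?thesis by (simp add: V2_def)
qed

text \<open>Here \<open>B = Z Q\<close> with \<open>Q = X\<^sub>2\<^sup>-\<^sup>1\<close>, and \<open>B' = \<eta>(Z) W\<^sub>2 Q W\<^sub>2\<^sup>*\<close> because \<open>W\<^sub>2 Q W\<^sub>2\<^sup>*\<close> is the inverse of
  \<open>Y\<^sub>2 = V\<^sub>2\<^sup>* X\<^sub>2 V\<^sub>2\<close>.\<close>

lemma dyson_coordinates:
  assumes D1: "dyson u1 W1" and D2: "dyson u2 W2"
  defines "X2 \<equiv> rp W2"
  defines "Y2 \<equiv> Re u2 *\<^sub>R mat 1 + \<eta> X2"
  assumes XQ: "X2 ** Q = mat 1" "Q ** X2 = mat 1"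
  obtains B' where "Z ** Q ** X2 = Z" "\<eta> (Z ** Q ** X2) = B' ** Y2"
    "(Z + W1 ** \<eta> Z ** W2) ** Q = Z ** Q + W1 ** B' ** adjoint_mat (mat u2 + \<eta> W2)"
proof -
  define V2 where "V2 = mat u2 + \<eta> W2"
  note R2 = dyson_re[OF D2, folded V2_def X2_def, folded Y2_def]
  define B' where "B' = \<eta> Z ** W2 ** Q ** adjoint_mat W2"
  have Z: "Z ** Q ** X2 = Z"
    using XQ by (metis matrix_mul_assoc matrix_mul_rid)
  have WV: "adjoint_mat W2 ** adjoint_mat V2 = mat 1"
    by (metis R2(2) adjoint_mult adjoint_one)
  have "B' ** Y2 = \<eta> Z ** W2 ** Q ** adjoint_mat W2 ** (adjoint_mat V2 ** X2 ** V2)"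
    by (simp only: B'_def R2)
  also have "\<dots> = \<eta> Z ** W2 ** Q ** (adjoint_mat W2 ** adjoint_mat V2) ** X2 ** V2"
    by (simp only: matrix_mul_assoc)
  also have "\<dots> = \<eta> Z ** W2 ** (Q ** X2) ** V2"
    by (simp only: WV matrix_mul_rid matrix_mul_assoc)
  also have "\<dots> = \<eta> Z ** (W2 ** V2)"
    by (simp only: XQ matrix_mul_rid matrix_mul_assoc)
  finally have B'Y: "B' ** Y2 = \<eta> Z" using R2(1) by simp
  have "W1 ** B' ** adjoint_mat V2 = W1 ** \<eta> Z ** W2 ** Q ** (adjoint_mat W2 ** adjoint_mat V2)"
    by (simp only: B'_def matrix_mul_assoc)
  then have "W1 ** B' ** adjoint_mat V2 = W1 ** \<eta> Z ** W2 ** Q"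
    by (simp add: WV)
  then show ?thesis
    using that[of B'] Z B'Y by (simp add: matrix_ring_simps V2_def)
qed

lemma dyson_difference:
  assumes D1: "dyson u1 W1" and D2: "dyson u2 W2"
  shows "(W1 - W2) + W1 ** \<eta> (W1 - W2) ** W2 = mat (u2 - u1) ** W1 ** W2"
proof -
  have "W1 ** (mat u1 + \<eta> W1) ** W2 = W2" "W1 ** ((mat u2 + \<eta> W2) ** W2) = W1"
    using D1 D2 by (simp_all add: dyson_def)
  then have e: "W1 - W2 = W1 ** ((mat u2 + \<eta> W2) - (mat u1 + \<eta> W1)) ** W2"
    by (simp only: matrix_diff_ldistrib matrix_diff_rdistrib matrix_mul_assoc)
  show ?thesis
    by (subst (1) e) (simp add: \<eta>_diff mat_minus matrix_ring_simps mat_scalar_commute[of _ W1])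
qed

lemma wt_minus: "wt P Q (- Z) = wt P Q Z"
  using wt_scaleR_right[of P Q "-1" Z] by simp

text \<open>At equal parameters the difference of two solutions is fixed by the contraction
  \<open>Z \<mapsto> - W\<^sub>1 \<eta>(Z) W\<^sub>2\<close>, so every term of the loss vanishes.\<close>

lemma dyson_no_loss:
  assumes D1: "dyson u W1" and D2: "dyson u W2" and u: "0 \<le> Re u"
  obtains B B' where "W1 - W2 = B ** rp W2" "Re u * wt (mat 1) (rp W2) B = 0"
    "\<And>i. i \<in> {1..r} \<Longrightarrow> A i ** B = B' ** A i"
proof -
  define X2 where "X2 = rp W2"
  have pd: "posdef_mat (rp W1)" "posdef_mat X2"
    using D1 D2 by (auto simp: dyson_def X2_def)
  note ps = posdef_imp_psd[OF pd(1)] posdef_imp_psd[OF pd(2)]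
  obtain Q where Q: "X2 ** Q = mat 1" "Q ** X2 = mat 1" using posdef_inverse[OF pd(2)] .
  define B where "B = (W1 - W2) ** Q"
  obtain B' where B': "B ** X2 = W1 - W2" "\<eta> (B ** X2) = B' ** (Re u *\<^sub>R mat 1 + \<eta> X2)"
    "((W1 - W2) + W1 ** \<eta> (W1 - W2) ** W2) ** Q = B + W1 ** B' ** adjoint_mat (mat u + \<eta> W2)"
    using dyson_coordinates[OF D1 D2, folded X2_def, OF Q, of "W1 - W2"] unfolding B_def .
  have "W1 ** B' ** adjoint_mat (mat u + \<eta> W2) = - B"
    using B'(3) unfolding dyson_difference[OF D1 D2] by (simp add: eq_neg_iff_add_eq_0 add.commute)
  then have sum0: "0 = Re u * wt (mat 1) X2 B + Re u * wt (rp W1) (mat 1) B'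
      + (\<Sum>i=1..r. wt (rp W1) X2 (A i ** B - B' ** A i))"
    using dyson_gap[OF D1 D2, folded X2_def, OF B'(2)] by (simp add: wt_minus)
  have nn: "0 \<le> Re u * wt (mat 1) X2 B" "0 \<le> Re u * wt (rp W1) (mat 1) B'"
    "\<And>i. 0 \<le> wt (rp W1) X2 (A i ** B - B' ** A i)"
    using u ps by (auto intro!: mult_nonneg_nonneg wt_nonneg)
  have "0 \<le> (\<Sum>i=1..r. wt (rp W1) X2 (A i ** B - B' ** A i))"
    by (intro sum_nonneg nn)
  with sum0 nn have z: "Re u * wt (mat 1) X2 B = 0"
     "(\<Sum>i=1..r. wt (rp W1) X2 (A i ** B - B' ** A i)) = 0" by linarith+
  have "A i ** B = B' ** A i" if "i \<in> {1..r}" for i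
    using z(2) nn(3) that wt_posdef_eq_0[OF pd, of "A i ** B - B' ** A i"]
    by (simp add: sum_nonneg_eq_0_iff)
  then show ?thesis using that B'(1) z(1) unfolding X2_def by metis
qed

lemma dyson_unique:
  assumes "dyson u W1" "dyson u W2" "0 < Re u"
  shows "W1 = W2"
proof -
  obtain B where B: "W1 - W2 = B ** rp W2" "Re u * wt (mat 1) (rp W2) B = 0"
    using dyson_no_loss[OF assms(1,2)] assms(3) by (metis less_imp_le)
  then have "B = 0"
    using wt_posdef_eq_0[OF posdef_one, of "rp W2" B] assms by (simp add: dyson_def)
  then show ?thesis using B(1) by simp
qed

text \<open>The gap identity for a single solution: the form of \<open>B = W X\<^sup>-\<^sup>1\<close> equals \<open>n\<close>, and \<open>u W\<^sup>2 X\<^sup>-\<^sup>1\<close> is the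
  difference of \<open>B\<close> and its contracted image, so the form of \<open>u W\<^sup>2 X\<^sup>-\<^sup>1\<close> is at most \<open>4 n\<close>. It equals
  \<open>|u|\<^sup>2 tr (X W X\<^sup>-\<^sup>1 W\<^sup>*)\<close>, and with \<open>W = X + K\<close> the trace is at least \<open>\<parallel>X\<parallel>\<^sup>2 + \<parallel>K\<parallel>\<^sup>2\<close>, because the
  commutator of \<open>X\<close> and \<open>K\<close> has a nonnegative form.\<close>

lemma dyson_bound:
  assumes D: "dyson u W" and u: "0 \<le> Re u"
  shows "cmod u * norm W \<le> 4 * real CARD('n)"
proof -
  define X where "X = rp W"
  define V where "V = mat u + \<eta> W"
  define Y where "Y = Re u *\<^sub>R mat 1 + \<eta> X"
  define K where "K = (1/2) *\<^sub>R (W - adjoint_mat W)"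
  note R = dyson_re[OF D, folded V_def X_def, folded Y_def]
  have ps: "psd X" "psd Y" using dyson_psd[OF D u] by (simp_all add: X_def Y_def)
  obtain Q where Q: "X ** Q = mat 1" "Q ** X = mat 1" using posdef_inverse[OF R(3)] .
  have adjQ: "adjoint_mat Q = Q"
    by (metis Q X_def adjoint_mult adjoint_one adjoint_rp matrix_mul_assoc matrix_mul_lid matrix_mul_rid)
  have psdQ: "psd Q"
    using psd_conj[OF ps(1), of Q] Q by (simp add: adjQ)
  have W: "W = X + K" "adjoint_mat W = X - K"
    by (simp_all add: X_def K_def rp_def algebra_simps flip: scaleR_add_left)
  have adjK: "adjoint_mat K = - K" by (simp add: K_def adjoint_scaleR adjoint_diff algebra_simps)
  have QXK: "M ** Q ** X = M" "M ** X ** Q = M" for M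
    by (simp_all add: Q flip: matrix_mul_assoc)
  define B where "B = W ** Q"
  obtain B' where B': "B ** X = W" "\<eta> (B ** X) = B' ** Y"
    "(W + W ** \<eta> W ** W) ** Q = B + W ** B' ** adjoint_mat V"
    using dyson_coordinates[OF D D, folded X_def, folded Y_def V_def, OF Q, of W] unfolding B_def .
  have YW: "adjoint_mat W ** Y ** W = X" "Y ** W = adjoint_mat V ** X"
    using R(5) by (simp, metis R(1,7) matrix_mul_assoc matrix_mul_rid)
  have WVa: "adjoint_mat W ** adjoint_mat V = mat 1" "adjoint_mat V ** adjoint_mat W = mat 1"
    by (metis R(2) adjoint_mult adjoint_one, metis R(1) adjoint_mult adjoint_one)
  have NB: "wt Y X B = real CARD('n)"
  proof -
    have "Y ** B ** X ** adjoint_mat B = Y ** (B ** X) ** adjoint_mat B"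
      by (simp only: matrix_mul_assoc)
    also have "\<dots> = (Y ** W) ** Q ** adjoint_mat W"
      unfolding B'(1) by (simp only: B_def adjoint_mult adjQ matrix_mul_assoc)
    also have "\<dots> = adjoint_mat V ** (X ** Q) ** adjoint_mat W"
      by (simp only: YW matrix_mul_assoc)
    also have "\<dots> = mat 1" by (simp add: Q WVa)
    finally show ?thesis by (simp add: wt_def trace_I)
  qed
  have le: "wt Y X (W ** B' ** adjoint_mat V) \<le> wt Y X B"
  proof -
    have "0 \<le> Re u * wt (mat 1) X B + Re u * wt X (mat 1) B'
      + (\<Sum>i=1..r. wt X X (A i ** B - B' ** A i))"
      using u ps by (intro add_nonneg_nonneg mult_nonneg_nonneg sum_nonneg wt_nonneg) auto
    then show ?thesis
      using dyson_gap[OF D D, folded X_def, folded Y_def V_def, OF B'(2)] by simp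
  qed
  have "W + W ** \<eta> W ** W = mat 2 ** W - mat u ** W ** W"
  proof -
    have "W ** V ** W = W" by (simp add: R)
    then have "W ** mat u ** W + W ** \<eta> W ** W = W"
      by (simp add: V_def matrix_ring_simps)
    moreover have "mat 2 ** W = W + W"
      by (rule mat_two_mult)
    ultimately show ?thesis by (simp add: mat_scalar_commute[of u] algebra_simps)
  qed
  then have "(mat 2 ** W - mat u ** W ** W) ** Q = B + W ** B' ** adjoint_mat V" using B'(3) by simp
  moreover have "mat 2 ** W ** Q = B + B"
    by (metis B_def mat_two_mult matrix_mul_assoc)
  ultimately have uW: "mat u ** W ** W ** Q = B - W ** B' ** adjoint_mat V"
    by (simp add: matrix_ring_simps algebra_simps)
  have "wt Y X (mat u ** W ** W ** Q) \<le> 4 * real CARD('n)"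
    unfolding uW using wt_add_le[OF ps(2,1), of B "W ** B' ** adjoint_mat V"] le NB by simp
  moreover have "wt Y X (mat u ** W ** W ** Q) = (cmod u)\<^sup>2 * wt X Q W"
  proof -
    have "Y ** (W ** W ** Q) ** X ** adjoint_mat (W ** W ** Q)
       = (Y ** W) ** W ** (Q ** X) ** Q ** adjoint_mat W ** adjoint_mat W"
      by (simp only: adjoint_mult adjQ matrix_mul_assoc)
    also have "\<dots> = adjoint_mat V ** (X ** W ** Q ** adjoint_mat W ** adjoint_mat W)"
      by (simp only: Q YW matrix_mul_rid matrix_mul_assoc)
    finally have "trace (Y ** (W ** W ** Q) ** X ** adjoint_mat (W ** W ** Q))
       = trace (adjoint_mat V ** (X ** W ** Q ** adjoint_mat W ** adjoint_mat W))"
      by (rule arg_cong)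
    also have "\<dots> = trace (X ** W ** Q ** adjoint_mat W ** adjoint_mat W ** adjoint_mat V)"
      by (rule trace_mul_sym)
    also have "X ** W ** Q ** adjoint_mat W ** adjoint_mat W ** adjoint_mat V
       = X ** W ** Q ** adjoint_mat W ** (adjoint_mat W ** adjoint_mat V)"
      by (simp only: matrix_mul_assoc)
    finally have "wt Y X (W ** W ** Q) = wt X Q W" by (simp add: WVa wt_def)
    then show ?thesis using wt_mat_mult[of Y X u "W ** W ** Q"] by (simp add: matrix_mul_assoc)
  qed
  ultimately have e1: "(cmod u)\<^sup>2 * wt X Q W \<le> 4 * real CARD('n)" by simp
  have e2: "(norm X)\<^sup>2 + (norm K)\<^sup>2 \<le> wt X Q W"
  proof -
    have "wt Q Q (X ** K - K ** X) = 2 * Re (trace (K ** K)) - 2 * Re (trace (X ** K ** Q ** K))"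
    proof -
      have adjc: "adjoint_mat (X ** K - K ** X) = X ** K - K ** X"
        by (simp add: adjoint_diff adjoint_mult adjK matrix_ring_simps X_def)
      have "Q ** (X ** K - K ** X) ** Q ** (X ** K - K ** X)
         = K ** K - K ** Q ** K ** X - Q ** K ** X ** K + Q ** K ** K ** X"
        by (simp add: matrix_ring_simps Q QXK)
      moreover have "trace (K ** Q ** K ** X) = trace (X ** K ** Q ** K)"
        by (metis trace_mul_sym matrix_mul_assoc)
      moreover have "trace (Q ** K ** X ** K) = trace (X ** K ** Q ** K)"
        by (metis trace_mul_sym matrix_mul_assoc)
      moreover have "trace (Q ** K ** K ** X) = trace (K ** K)"
        by (metis Q(1) trace_mul_sym matrix_mul_assoc matrix_mul_rid matrix_mul_lid)
      ultimately show ?thesis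
        by (simp add: wt_def adjc trace_add trace_sub)
    qed
    moreover have "(norm K)\<^sup>2 = - Re (trace (K ** K))"
      by (simp add: power2_norm_trace adjK matrix_minus_right trace_def sum_negf)
    moreover have "wt X Q W = Re (trace (X ** X)) - Re (trace (X ** K ** Q ** K))"
    proof -
      have "X ** W ** Q ** adjoint_mat W = X ** X - X ** K + X ** K - X ** K ** Q ** K"
      proof -
        have "X ** W ** Q ** adjoint_mat W = X ** (X + K) ** Q ** (X - K)"
          by (simp only: W(2) flip: W(1))
        also have "\<dots> = X ** X - X ** K + X ** K - X ** K ** Q ** K"
          by (simp add: matrix_ring_simps Q QXK)
        finally show ?thesis .
      qed
      then show ?thesis by (simp add: wt_def trace_sub)
    qed
    moreover have "(norm X)\<^sup>2 = Re (trace (X ** X))"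
      by (simp add: power2_norm_trace X_def)
    ultimately show ?thesis using wt_nonneg[OF psdQ psdQ, of "X ** K - K ** X"] by linarith
  qed
  have e3: "(norm W)\<^sup>2 \<le> 2 * ((norm X)\<^sup>2 + (norm K)\<^sup>2)"
  proof -
    have "(norm W)\<^sup>2 \<le> (norm X + norm K)\<^sup>2"
      unfolding W by (intro power_mono norm_triangle_ineq) simp
    also have "\<dots> \<le> 2 * ((norm X)\<^sup>2 + (norm K)\<^sup>2)"
      using zero_le_power2[of "norm X - norm K"] by (simp add: power2_eq_square algebra_simps)
    finally show ?thesis .
  qed
  have "(norm W)\<^sup>2 \<le> 2 * wt X Q W" using e2 e3 by argo
  then have "(cmod u)\<^sup>2 * (norm W)\<^sup>2 \<le> (cmod u)\<^sup>2 * (2 * wt X Q W)"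
    by (intro mult_left_mono) simp_all
  with e1 have "(cmod u)\<^sup>2 * (norm W)\<^sup>2 \<le> 8 * real CARD('n)" by linarith
  also have "\<dots> \<le> (4 * real CARD('n))\<^sup>2"
  proof -
    have "1 \<le> real CARD('n)" by (simp add: Suc_leI)
    moreover from this have "real CARD('n) * 1 \<le> real CARD('n) * real CARD('n)"
      by (intro mult_left_mono) auto
    ultimately show ?thesis unfolding power2_eq_square by linarith
  qed
  finally have "(cmod u * norm W)\<^sup>2 \<le> (4 * real CARD('n))\<^sup>2" by (simp add: power_mult_distrib)
  then show ?thesis by (rule power2_le_imp_le) simp
qed

end

lemma cip_minus_right: "cip w (- v) = - cip w v"
  using cip_diff_right[of w 0 v] by simp

lemma mat_mult_nth: "(mat c ** M) $ i $ j = c * (M :: complex^'n^'n) $ i $ j"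
  by (simp add: matrix_matrix_mult_def mat_def if_distrib if_distribR cong: if_cong)

lemma mat_mult_mat: "mat a ** mat b = (mat (a * b) :: complex^'n^'n)"
  by (simp add: vec_eq_iff mat_mult_nth) (simp add: mat_def)

section \<open>Unsplittable pencils\<close>

lemma card_basis:
  fixes E :: "(complex^'n) set"
  assumes "vec.independent E" "vec.span E = UNIV"
  shows "card E = CARD('n)"
  using assms by (metis vec.dim_eq_card_independent vec.dim_span vec_dim_card)

lemma dim_ge_one: "x \<in> S \<Longrightarrow> x \<noteq> 0 \<Longrightarrow> 1 \<le> vec.dim (S :: (complex^'n) set)"
  using vec.dim_eq_0[of S] by (metis One_nat_def Suc_leI bot_nat_0.not_eq_extremum singletonD subsetD)

lemma nonzero_matrix_vector: "M \<noteq> 0 \<Longrightarrow> \<exists>x. M *v x \<noteq> (0 :: complex^'n)"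
  by (auto simp: matrix_eq)

lemma subspace_kernel_mat: "vec.subspace {x. (M :: complex^'n^'n) *v x = 0}"
  by (auto simp: vec.subspace_def matrix_vector_right_distrib vector_scalar_commute)

lemma subspace_image_mat: "vec.subspace S \<Longrightarrow> vec.subspace ((*v) (M :: complex^'n^'n) ` S)"
  using linear_iff_module_hom matrix_vector_mul_linear_gen module_hom.subspace_image by blast

lemma span_image_mat: "vec.span ((*v) (M :: complex^'n^'n) ` S) = (*v) M ` vec.span S"
  using linear_iff_module_hom matrix_vector_mul_linear_gen module_hom.span_image by blast

lemma rank_nullity:
  fixes M :: "complex^'n^'n"
  shows "vec.dim {x. M *v x = 0} + vec.dim (range ((*v) M)) = CARD('n)"
proof (rule antisym)
  obtain K where K: "K \<subseteq> {x. M *v x = 0}" "vec.independent K" "{x. M *v x = 0} \<subseteq> vec.span K"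
    "card K = vec.dim {x. M *v x = 0}"
    using vec.basis_exists by blast
  define E where "E = vec.extend_basis K"
  have E: "K \<subseteq> E" "vec.independent E" "vec.span E = UNIV"
    using K(2) by (auto simp: E_def vec.extend_basis_superset vec.independent_extend_basis)
  have cardE: "card E = CARD('n)" and finE: "finite E"
    using E(2,3) by (simp_all add: card_basis vec.finiteI_independent)
  have kspan: "vec.span K = {x. M *v x = 0}"
    using K subspace_kernel_mat by (metis vec.span_minimal subset_antisym)
  have "range ((*v) M) \<subseteq> vec.span ((*v) M ` (E - K))"
  proof
    fix z assume "z \<in> range ((*v) M)"
    then obtain x where x: "z = M *v x" by auto
    have "x \<in> vec.span ((E - K) \<union> K)" using E by (simp add: sup.absorb1)
    then obtain a b where ab: "x = a + b" "a \<in> vec.span (E - K)" "b \<in> vec.span K"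
      unfolding vec.span_Un by auto
    then have "z = M *v a" using kspan by (auto simp: x matrix_vector_right_distrib)
    then show "z \<in> vec.span ((*v) M ` (E - K))" using ab(2) by (simp add: span_image_mat)
  qed
  then have "vec.dim (range ((*v) M)) \<le> card ((*v) M ` (E - K))"
    by (rule vec.dim_le_card) (use finE in simp)
  also have "\<dots> \<le> card (E - K)" using finE by (intro card_image_le) simp
  also have "\<dots> = card E - card K" using E(1) finE by (simp add: card_Diff_subset finite_subset)
  finally show "vec.dim {x. M *v x = 0} + vec.dim (range ((*v) M)) \<le> CARD('n)"
    using cardE K(4) card_mono[OF finE E(1)] by simp
  obtain T where T: "T \<subseteq> range ((*v) M)" "vec.independent T" "range ((*v) M) \<subseteq> vec.span T"
    "card T = vec.dim (range ((*v) M))"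
    using vec.basis_exists by blast
  obtain S where S: "(*v) M ` S = T" "card S = card T" "finite S"
  proof -
    have "inj_on (inv ((*v) M)) T" using T(1) by (rule inj_on_inv_into)
    moreover have "(*v) M ` inv ((*v) M) ` T = T"
      using T(1) by (force simp: image_image f_inv_into_f)
    ultimately show ?thesis
      using that[of "inv ((*v) M) ` T"] vec.finiteI_independent[OF T(2)] by (simp add: card_image)
  qed
  have "UNIV \<subseteq> vec.span (S \<union> K)"
  proof
    fix x
    have "M *v x \<in> (*v) M ` vec.span S" using T(3) S(1) by (simp flip: span_image_mat) blast
    then obtain y where y: "y \<in> vec.span S" "M *v x = M *v y" by auto
    then have "x - y \<in> vec.span K" by (simp add: kspan matrix_vector_mult_diff_distrib)
    moreover have "x = y + (x - y)" by simp
    ultimately show "x \<in> vec.span (S \<union> K)" unfolding vec.span_Un using y(1) by blast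
  qed
  then have "vec.dim (UNIV :: (complex^'n) set) \<le> card (S \<union> K)"
    by (rule vec.dim_le_card) (use S(3) vec.finiteI_independent[OF K(2)] in simp)
  also have "\<dots> \<le> card S + card K" by (rule card_Un_le)
  finally show "CARD('n) \<le> vec.dim {x. M *v x = 0} + vec.dim (range ((*v) M))"
    using S(2) T(4) K(4) by (simp add: card_cart_basis)
qed

text \<open>The entire function \<open>l \<mapsto> det (B - l)\<close> tends to infinity at infinity, so it has a zero.\<close>

lemma eigenvector_exists:
  fixes B :: "complex^'n^'n"
  obtains l v where "v \<noteq> 0" and "(B - mat l) *v v = 0"
proof -
  define f where "f l = det (B - mat l)" for l
  have "f holomorphic_on UNIV"
    unfolding f_def det_def
  proof (intro holomorphic_intros)
    fix p :: "'n \<Rightarrow> 'n" and i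
    show "(\<lambda>l. (B - mat l) $ i $ p i) holomorphic_on UNIV"
      by (cases "i = p i") (auto simp: mat_def intro!: holomorphic_intros)
  qed
  moreover have "\<forall>\<^sub>F l in at_infinity. C \<le> cmod (f l)" for C
  proof -
    have det_mat: "det (mat c :: complex^'n^'n) = c ^ CARD('n)" for c
      by (subst det_diagonal) (auto simp: mat_def)
    have entry: "((\<lambda>l. (mat (inverse l) ** B - mat 1) $ i $ j) \<longlongrightarrow> (- mat 1 :: complex^'n^'n) $ i $ j) at_infinity"
      for i j
    proof -
      have "((\<lambda>l::complex. inverse l * B $ i $ j - mat 1 $ i $ j) \<longlongrightarrow> 0 * B $ i $ j - mat 1 $ i $ j) at_infinity"
        by (intro tendsto_intros tendsto_inverse_0)
      then show ?thesis
        by (simp add: matrix_matrix_mult_def mat_def if_distrib if_distribR cong: if_cong)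
    qed
    have "((\<lambda>l. det (mat (inverse l) ** B - mat 1)) \<longlongrightarrow> det (- mat 1 :: complex^'n^'n)) at_infinity"
      unfolding det_def by (intro tendsto_intros entry)
    moreover have "- mat 1 = (mat (- 1) :: complex^'n^'n)" by (simp add: mat_def vec_eq_iff)
    then have "cmod (det (- mat 1 :: complex^'n^'n)) = 1"
      by (simp add: det_mat norm_power)
    ultimately have "((\<lambda>l. cmod (det (mat (inverse l) ** B - mat 1))) \<longlongrightarrow> 1) at_infinity"
      using tendsto_norm by fastforce
    then have ev: "\<forall>\<^sub>F l in at_infinity. 1/2 < cmod (det (mat (inverse l) ** B - mat 1))"
      by (rule order_tendstoD) simp
    have big: "\<forall>\<^sub>F l in at_infinity. max 1 (2 * C) \<le> cmod l"
      unfolding eventually_at_infinity by blast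
    show ?thesis
      using ev big
    proof eventually_elim
      case (elim l)
      then have l: "l \<noteq> 0" "1 \<le> cmod l" "2 * C \<le> cmod l" by auto
      have "mat l ** mat (inverse l) = (mat 1 :: complex^'n^'n)"
        using l(1) by (simp add: mat_mult_mat)
      then have "B - mat l = mat l ** (mat (inverse l) ** B - mat 1)"
        by (simp add: matrix_diff_ldistrib matrix_mul_assoc)
      then have "cmod (f l) = cmod l ^ CARD('n) * cmod (det (mat (inverse l) ** B - mat 1))"
        by (simp add: f_def det_mul det_mat norm_mult norm_power)
      moreover have "cmod l ^ 1 \<le> cmod l ^ CARD('n)"
        using l(2) by (intro power_increasing) (auto simp: Suc_leI)
      ultimately have "cmod l * (1/2) \<le> cmod (f l)"
        using elim(1) mult_mono[of "cmod l" "cmod l ^ CARD('n)" "1/2" "cmod (det (mat (inverse l) ** B - mat 1))"]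
        by simp
      then show "C \<le> cmod (f l)" using l(3) by simp
    qed
  qed
  ultimately obtain l where "f l = 0" using Liouville_weak_inverse by blast
  then have "\<not> invertible (B - mat l)" by (simp add: f_def invertible_det_nz)
  then show ?thesis
    using that invertible_left_inverse matrix_left_invertible_ker by blast
qed

locale unsplittable_pencil = hermitian_pencil r A for r and A :: "nat \<Rightarrow> complex^'n^'n" +
  assumes unsplit: "unsplittable r A"
begin

lemma pencil_nonzero: "\<exists>i\<in>{1..r}. A i \<noteq> 0"
  using unsplit by (simp add: unsplittable_def)

text \<open>A proper nonzero subspace is spread over a space of strictly larger dimension: a smaller
  target could be enlarged to one of the same dimension.\<close>

lemma dim_expand:
  assumes "vec.subspace R" "vec.subspace L" and "\<And>i. i \<in> {1..r} \<Longrightarrow> (*v) (A i) ` R \<subseteq> L"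
    and dR: "1 \<le> vec.dim R" "vec.dim R < CARD('n)"
  shows "vec.dim R < vec.dim L"
proof (rule ccontr)
  assume "\<not> vec.dim R < vec.dim L"
  then have le: "vec.dim L \<le> vec.dim R" by simp
  obtain K where K: "K \<subseteq> L" "vec.independent K" "L \<subseteq> vec.span K" "card K = vec.dim L"
    using vec.basis_exists by blast
  define E where "E = vec.extend_basis K"
  have E: "K \<subseteq> E" "vec.independent E" "vec.span E = UNIV"
    using K(2) by (auto simp: E_def vec.extend_basis_superset vec.independent_extend_basis)
  have cardE: "card E = CARD('n)" and finE: "finite E"
    using E(2,3) by (simp_all add: card_basis vec.finiteI_independent)
  obtain T where T: "K \<subseteq> T" "T \<subseteq> E" "card T = vec.dim R"
    using exists_subset_between[of K "vec.dim R" E] K(4) le dR cardE E(1) finE by auto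
  have "vec.dim (vec.span T) = vec.dim R"
    using T E(2) by (metis vec.dim_eq_card_independent vec.dim_span vec.independent_mono)
  moreover have "(*v) (A i) ` R \<subseteq> vec.span T" if "i \<in> {1..r}" for i
    using assms(3)[OF that] K(3) vec.span_mono[OF T(1)] by blast
  ultimately have "splittable r A"
    unfolding splittable_def using assms(1) dR
    by (intro exI[of _ R] exI[of _ "vec.span T"] exI[of _ "vec.dim R"]) auto
  then show False using unsplit by (simp add: unsplittable_def)
qed

text \<open>The pencil maps the kernel of \<open>B\<close> into that of \<open>B'\<close> and the range of \<open>B\<close> into that of \<open>B'\<close>. If
  \<open>B \<noteq> 0\<close> both subspaces are proper and nonzero, so both dimensions grow, against rank-nullity.\<close>

lemma intertwining_zero:
  assumes int: "\<And>i. i \<in> {1..r} \<Longrightarrow> A i ** B = B' ** A i" and v: "v \<noteq> 0" "B *v v = 0"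
  shows "B = 0" and "B' = 0"
proof -
  define K where "K M = {x. M *v x = 0}" for M :: "complex^'n^'n"
  have subK: "vec.subspace (K M)" for M
    by (auto simp: K_def vec.subspace_def matrix_vector_right_distrib vector_scalar_commute)
  have subR: "vec.subspace (range ((*v) M))" for M :: "complex^'n^'n"
    by (rule subspace_image_mat) simp
  have nul: "vec.dim (K M) + vec.dim (range ((*v) M)) = CARD('n)" for M
    unfolding K_def by (rule rank_nullity)
  have K1: "1 \<le> vec.dim (K B)"
    using v by (intro dim_ge_one[of v]) (auto simp: K_def)
  have comm: "B' *v (A i *v x) = A i *v (B *v x)" if "i \<in> {1..r}" for i x
    using int[OF that] by (simp add: matrix_vector_mul_assoc)
  have AK: "(*v) (A i) ` K B \<subseteq> K B'" if "i \<in> {1..r}" for i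
    using comm[OF that] by (auto simp: K_def)
  have AR: "(*v) (A i) ` range ((*v) B) \<subseteq> range ((*v) B')" if "i \<in> {1..r}" for i
    by (auto simp flip: comm[OF that])
  show B0: "B = 0"
  proof (rule ccontr)
    assume "B \<noteq> 0"
    then obtain x where "B *v x \<noteq> 0" using nonzero_matrix_vector by blast
    then have R1: "1 \<le> vec.dim (range ((*v) B))" by (intro dim_ge_one[of "B *v x"]) auto
    have "vec.dim (K B) < vec.dim (K B')"
      using dim_expand[OF subK subK AK] K1 R1 nul[of B] by simp
    moreover have "vec.dim (range ((*v) B)) < vec.dim (range ((*v) B'))"
      using dim_expand[OF subR subR AR] K1 R1 nul[of B] by simp
    ultimately show False using nul[of B] nul[of B'] by simp
  qed
  have zero: "B' ** A i = 0" if "i \<in> {1..r}" for i using int[OF that] by (simp add: B0)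
  show "B' = 0"
  proof (rule ccontr)
    assume "B' \<noteq> 0"
    then obtain x where "B' *v x \<noteq> 0" using nonzero_matrix_vector by blast
    then have "1 \<le> vec.dim (range ((*v) B'))" by (intro dim_ge_one[of "B' *v x"]) auto
    then have lt: "vec.dim (K B') < CARD('n)" using nul[of B'] by simp
    have into: "A i *v y \<in> K B'" if "i \<in> {1..r}" for i y
      using zero[OF that] by (simp add: K_def matrix_vector_mul_assoc)
    show False
    proof (cases "vec.dim (K B') = 0")
      case True
      then have "K B' \<subseteq> {0}" by (simp add: vec.dim_eq_0)
      then have "A i = 0" if "i \<in> {1..r}" for i
        using into[OF that] nonzero_matrix_vector[of "A i"] by blast
      then show False using pencil_nonzero by blast
    next
      case False
      then have "1 \<le> vec.dim (K B')" by linarith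
      then have "vec.dim (K B') < vec.dim (K B')"
        using lt into by (intro dim_expand[OF subK subK]) auto
      then show False by simp
    qed
  qed
qed

text \<open>Subtracting an eigenvalue of \<open>B\<close> from both matrices reduces this to a singular \<open>B\<close>.\<close>

lemma intertwining_scalar:
  assumes int: "\<And>i. i \<in> {1..r} \<Longrightarrow> A i ** B = B' ** A i"
  obtains l where "B = mat l" and "B' = mat l"
proof -
  obtain l v where v: "v \<noteq> 0" "(B - mat l) *v v = 0" by (rule eigenvector_exists)
  have "A i ** (B - mat l) = (B' - mat l) ** A i" if "i \<in> {1..r}" for i
    using int[OF that] by (simp add: matrix_ring_simps mat_scalar_commute)
  then have "B - mat l = 0" "B' - mat l = 0" using intertwining_zero[OF _ v] by blast+
  then show ?thesis using that by simp
qed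

text \<open>The total defect is a seminorm of the pair \<open>(B, B')\<close> that vanishes on common scalars only, so it
  has a positive minimum on the compact set of unit pairs with \<open>tr B = 0\<close>.\<close>

lemma intertwining_quantitative:
  obtains C where "0 < C" and "\<And>B B'. \<exists>l. norm (B - mat l) \<le> C * (\<Sum>i=1..r. norm (A i ** B - B' ** A i))
    \<and> norm (B' - mat l) \<le> C * (\<Sum>i=1..r. norm (A i ** B - B' ** A i))"
proof -
  define g where "g p = (\<Sum>i=1..r. norm (A i ** fst p - snd p ** A i))" for p :: "(complex^'n^'n) \<times> (complex^'n^'n)"
  define S where "S = sphere (0 :: (complex^'n^'n) \<times> (complex^'n^'n)) 1 \<inter> {p. trace (fst p) = 0}"
  have "closed {p :: (complex^'n^'n) \<times> (complex^'n^'n). trace (fst p) = 0}"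
    unfolding trace_def by (intro closed_Collect_eq continuous_intros)
  then have cS: "compact S" unfolding S_def by (intro compact_Int_closed compact_sphere)
  have contg: "continuous_on S g" unfolding g_def by (intro continuous_intros)
  have hom: "g (k *\<^sub>R p) = \<bar>k\<bar> * g p" for k p
  proof -
    have "A i ** (k *\<^sub>R fst p) - (k *\<^sub>R snd p) ** A i = k *\<^sub>R (A i ** fst p - snd p ** A i)" for i
      by (simp add: matrix_ring_simps scaleR_diff_right)
    then show ?thesis by (simp add: g_def sum_distrib_left)
  qed
  have trm: "trace (mat l :: complex^'n^'n) = of_nat CARD('n) * l" for l
    by (simp add: trace_def mat_def)
  obtain m where m: "m > 0" and le: "\<And>p. p \<in> S \<Longrightarrow> m \<le> g p"
  proof (cases "S = {}")
    case True
    then show ?thesis using that[of 1] by simp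
  next
    case False
    obtain p where p: "p \<in> S" and min: "\<And>q. q \<in> S \<Longrightarrow> g p \<le> g q"
      using continuous_attains_inf[OF cS False contg] by auto
    have "g p \<noteq> 0"
    proof
      assume "g p = 0"
      then have "A i ** fst p = snd p ** A i" if "i \<in> {1..r}" for i
        using that by (simp add: g_def sum_nonneg_eq_0_iff)
      then obtain l where l: "fst p = mat l" "snd p = mat l" by (rule intertwining_scalar)
      then have "p = 0" using p trm by (auto simp: S_def prod_eq_iff)
      then show False using p by (simp add: S_def)
    qed
    moreover have "0 \<le> g p" by (simp add: g_def sum_nonneg)
    ultimately show ?thesis using that[of "g p"] min by simp
  qed
  show ?thesis
  proof (rule that[of "1 / m"])
    show "0 < 1 / m" using m by simp
    fix B B' :: "complex^'n^'n"
    define l where "l = trace B / of_nat CARD('n)"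
    define p where "p = (B - mat l, B' - mat l)"
    have gp: "g p = (\<Sum>i=1..r. norm (A i ** B - B' ** A i))"
      unfolding g_def p_def by (simp add: matrix_ring_simps mat_scalar_commute)
    have "m * norm p \<le> g p"
    proof (cases "p = 0")
      case True
      then show ?thesis using gp by (simp add: sum_nonneg)
    next
      case False
      have "trace (fst p) = 0" by (simp add: p_def trace_sub trm l_def)
      then have "(1 / norm p) *\<^sub>R p \<in> S"
        using False by (simp add: S_def trace_scaleR)
      then have "m \<le> g ((1 / norm p) *\<^sub>R p)" by (rule le)
      then show ?thesis using False by (simp add: hom field_simps)
    qed
    then have "norm p \<le> 1 / m * g p" using m by (simp add: field_simps)
    then have np: "norm p \<le> 1 / m * (\<Sum>i=1..r. norm (A i ** B - B' ** A i))" unfolding gp .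
    then show "\<exists>l. norm (B - mat l) \<le> 1 / m * (\<Sum>i=1..r. norm (A i ** B - B' ** A i))
      \<and> norm (B' - mat l) \<le> 1 / m * (\<Sum>i=1..r. norm (A i ** B - B' ** A i))"
      using norm_fst_le[of "B - mat l" "B' - mat l"] norm_snd_le[of "B' - mat l" "B - mat l"]
      by (intro exI[of _ l] conjI; intro order_trans[OF _ np]) (simp_all add: p_def)
  qed
qed

text \<open>Compactness over all normalised \<open>X\<close>: if \<open>X \<ge> W \<eta>(X) W\<^sup>*\<close> has a kernel \<open>L\<close>, then every \<open>A\<^sub>i\<close> maps
  \<open>W\<^sup>* L\<close> into \<open>L\<close>, which splits the pencil since \<open>W\<close> is invertible.\<close>

lemma real_part_comparable:
  fixes K :: real
  obtains c where "0 < c" and "\<And>W V X. \<lbrakk>W ** V = mat 1; norm W \<le> K; norm V \<le> K; psd X;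
     W ** \<eta> X ** adjoint_mat W \<preceq> X\<rbrakk> \<Longrightarrow> (c * rtr X) *\<^sub>R mat 1 \<preceq> X"
proof -
  define S where "S = {(W :: complex^'n^'n, V, X, v :: complex^'n). W ** V = mat 1 \<and> norm W \<le> K \<and> norm V \<le> K
     \<and> psd X \<and> rtr X = 1 \<and> psd (X - W ** \<eta> X ** adjoint_mat W) \<and> norm v = 1}"
  define g where "g = (\<lambda>(W :: complex^'n^'n, V :: complex^'n^'n, X, v :: complex^'n). qform X v)"
  have "compact S"
    unfolding compact_eq_bounded_closed
  proof
    have "S \<subseteq> cball 0 K \<times> cball 0 K \<times> cball 0 1 \<times> cball 0 1"
      using psd_norm_le_rtr(1) by (force simp: S_def)
    then show "bounded S"
      by (rule bounded_subset[rotated]) (intro bounded_Times bounded_cball)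
    have psdc: "closed (f -` {P. psd P})" if "continuous_on UNIV f"
      for f :: "((complex^'n^'n) \<times> (complex^'n^'n) \<times> (complex^'n^'n) \<times> (complex^'n)) \<Rightarrow> complex^'n^'n"
      using closed_vimage[OF closed_psd that] .
    have "S = {p. fst p ** fst (snd p) = mat 1} \<inter> {p. norm (fst p) \<le> K} \<inter> {p. norm (fst (snd p)) \<le> K}
      \<inter> (\<lambda>p. fst (snd (snd p))) -` {P. psd P} \<inter> {p. rtr (fst (snd (snd p))) = 1}
      \<inter> (\<lambda>p. fst (snd (snd p)) - fst p ** \<eta> (fst (snd (snd p))) ** adjoint_mat (fst p)) -` {P. psd P}
      \<inter> {p. norm (snd (snd (snd p))) = 1}"
      by (auto simp: S_def)
    also have "closed \<dots>"
      unfolding rtr_def trace_def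
      by (intro closed_Int closed_Collect_eq closed_Collect_le psdc continuous_intros continuous_on_\<eta>)
    finally show "closed S" .
  qed
  moreover have "continuous_on S g"
    unfolding g_def cip_def matrix_vector_mult_def case_prod_unfold by (intro continuous_intros)
  moreover have pos: "0 < g p" if "p \<in> S" for p
  proof -
    obtain W V X v where p: "p = (W, V, X, v)" by (cases p) auto
    note S = that[unfolded p S_def, simplified]
    have "qform X v \<noteq> 0"
    proof
      assume "qform X v = 0"
      then have Xv: "X *v v = 0" using S psd_qform_eq_0 by blast
      define L where "L = {x. X *v x = 0}"
      define R where "R = (*v) (adjoint_mat W) ` L"
      have subL: "vec.subspace L"
        by (auto simp: L_def vec.subspace_def matrix_vector_right_distrib vector_scalar_commute)
      then have subR: "vec.subspace R" unfolding R_def by (rule subspace_image_mat)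
      have WV: "adjoint_mat V ** adjoint_mat W = mat 1"
        using S by (metis adjoint_mult adjoint_one)
      have "inj ((*v) (adjoint_mat W))"
        using WV matrix_left_invertible_injective by blast
      then have dimR: "vec.dim R = vec.dim L"
        unfolding R_def by (intro vec.dim_image_eq matrix_vector_mul_linear_gen) (meson inj_on_subset subset_UNIV)
      have "v \<noteq> 0" using S by auto
      then have "1 \<le> vec.dim L" using Xv by (intro dim_ge_one[of v]) (auto simp: L_def)
      moreover have "vec.dim L < CARD('n)"
      proof -
        have "X \<noteq> 0" using S by (auto simp: rtr_def)
        then obtain x where "X *v x \<noteq> 0" using nonzero_matrix_vector by blast
        then have "1 \<le> vec.dim (range ((*v) X))" by (intro dim_ge_one[of "X *v x"]) auto
        then show ?thesis using rank_nullity[of X] by (simp add: L_def)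
      qed
      moreover have "(*v) (A i) ` R \<subseteq> L" if i: "i \<in> {1..r}" for i
      proof
        fix y assume "y \<in> (*v) (A i) ` R"
        then obtain x where x: "X *v x = 0" "y = A i *v (adjoint_mat W *v x)" by (auto simp: R_def L_def)
        have each: "qform (A j ** X ** A j) (adjoint_mat W *v x) = qform X (A j *v (adjoint_mat W *v x))" if "j \<in> {1..r}" for j
          using pencil_adj[OF that] by (simp add: cip_mult_right[of _ "A j"] flip: matrix_vector_mul_assoc)
        have "0 \<le> qform (X - W ** \<eta> X ** adjoint_mat W) x" using S by (blast intro: psd_qform)
        also have "\<dots> = - qform (\<eta> X) (adjoint_mat W *v x)"
          by (simp add: matrix_vector_mult_diff_rdistrib x(1) cip_minus_right cip_mult_right[of x W]
              flip: matrix_vector_mul_assoc)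
        also have "qform (\<eta> X) (adjoint_mat W *v x) = (\<Sum>j=1..r. qform X (A j *v (adjoint_mat W *v x)))"
          by (simp add: covariance_map_def sum_matrix_vector_mult cip_sum_right each)
        finally have "(\<Sum>j=1..r. qform X (A j *v (adjoint_mat W *v x))) \<le> 0" by simp
        moreover have nn: "0 \<le> qform X (A j *v (adjoint_mat W *v x))" for j
          using S by (blast intro: psd_qform)
        ultimately have "(\<Sum>j=1..r. qform X (A j *v (adjoint_mat W *v x))) = 0"
          by (simp add: antisym sum_nonneg)
        then have "qform X y = 0" using i nn by (simp add: sum_nonneg_eq_0_iff x)
        then have "X *v y = 0" using S by (intro psd_qform_eq_0) simp_all
        then show "y \<in> L" by (simp add: L_def)
      qed
      ultimately show False using dim_expand[OF subR subL] dimR by simp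
    qed
    then show ?thesis using S psd_qform[of X v] by (simp add: g_def p)
  qed
  ultimately obtain c where c: "c > 0" and cle: "\<And>p. p \<in> S \<Longrightarrow> c \<le> g p"
  proof (cases "S = {}")
    case True
    then show ?thesis using that[of 1] by simp
  next
    case False
    then show ?thesis
      using continuous_attains_inf[OF \<open>compact S\<close> False \<open>continuous_on S g\<close>] pos that by metis
  qed
  show ?thesis
  proof (rule that[OF c])
    fix W V X :: "complex^'n^'n"
    assume WV: "W ** V = mat 1" "norm W \<le> K" "norm V \<le> K" and X: "psd X"
      and XW: "W ** \<eta> X ** adjoint_mat W \<preceq> X"
    show "(c * rtr X) *\<^sub>R mat 1 \<preceq> X"
    proof (cases "rtr X = 0")
      case True
      then show ?thesis using X by (simp add: loewner_def)
    next
      case False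
      then have tr: "rtr X > 0" using rtr_nonneg[OF X] by simp
      define X' where "X' = (1 / rtr X) *\<^sub>R X"
      have X': "psd X'" "rtr X' = 1" using X tr by (auto simp: X'_def psd_scaleR rtr_def trace_scaleR)
      have "X' - W ** \<eta> X' ** adjoint_mat W = (1 / rtr X) *\<^sub>R (X - W ** \<eta> X ** adjoint_mat W)"
        by (simp add: X'_def \<eta>_scaleR matrix_ring_simps scaleR_diff_right)
      then have X'W: "psd (X' - W ** \<eta> X' ** adjoint_mat W)"
        using XW tr by (simp add: loewner_def psd_scaleR)
      have "c * rtr X * (norm v)\<^sup>2 \<le> qform X v" for v
      proof (cases "v = 0")
        case False
        then have "(W, V, X', (1 / norm v) *\<^sub>R v) \<in> S" using WV X' X'W by (simp add: S_def)
        then have "c \<le> qform X' ((1 / norm v) *\<^sub>R v)" using cle unfolding g_def by fastforce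
        also have "\<dots> = qform X v / (rtr X * (norm v)\<^sup>2)"
          by (simp add: X'_def matrix_vector_scaleR scaleR_matrix_vector cip_scaleR_left
              cip_scaleR_right power2_eq_square)
        finally show ?thesis using False tr by (simp add: field_simps)
      qed simp
      then show ?thesis
        using X by (intro loewnerI) (auto simp: psd_def hermitian_mat_def adjoint_scaleR scaleR_matrix_vector
            cip_scaleR_right cip_self simp flip: of_real_power of_real_mult)
    qed
  qed
qed

end

section \<open>Solutions on the positive half-line\<close>

lemma trace_outer: "trace (outer b ** M) = cip b (M *v b)"
proof -
  have "trace (outer b ** M) = (\<Sum>i\<in>UNIV. \<Sum>k\<in>UNIV. b $ i * cnj (b $ k) * M $ k $ i)"
    by (simp add: trace_def outer_def matrix_matrix_mult_def)
  also have "\<dots> = (\<Sum>k\<in>UNIV. \<Sum>i\<in>UNIV. b $ i * cnj (b $ k) * M $ k $ i)"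
    by (rule sum.swap)
  also have "\<dots> = cip b (M *v b)"
    by (simp add: cip_def matrix_vector_mult_def sum_distrib_left ac_simps)
  finally show ?thesis .
qed

text \<open>Inversion is antitone: expand the form of \<open>P\<close> at \<open>P\<^sup>-\<^sup>1 v - Q\<^sup>-\<^sup>1 v\<close>.\<close>

lemma loewner_inverse:
  assumes "P \<preceq> Q" and P: "P ** P' = mat 1" "psd P" and Q: "Q ** Q' = mat 1" "psd Q"
    and herm: "hermitian_mat P'" "hermitian_mat Q'"
  shows "Q' \<preceq> P'"
proof (rule loewnerI[OF herm(2,1)])
  fix v
  define a where "a = Q' *v v"
  define b where "b = P' *v v"
  have Qa: "Q *v a = v" and Pb: "P *v b = v"
    by (simp_all add: a_def b_def matrix_vector_mul_assoc P Q)
  have vb: "cip b (P *v a) = cip v a" "Re (cip a v) = Re (cip v a)" "Re (cip b v) = Re (cip v b)"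
    using cip_mult_right[of b P a] P(2) Pb cip_commute[of a v] cip_commute[of b v]
    by (simp_all add: psd_adj)
  have "0 \<le> qform P (b - a)" using P(2) by (rule psd_qform)
  also have "\<dots> = Re (cip v b) - 2 * Re (cip v a) + qform P a"
    using vb by (simp add: matrix_vector_mult_diff_distrib cip_diff_left cip_diff_right Pb)
  finally have "2 * Re (cip v a) \<le> Re (cip v b) + qform P a" by simp
  moreover have "qform P a \<le> qform Q a" using assms(1) by (rule loewner_qform)
  moreover have "qform Q a = Re (cip v a)" by (simp add: Qa vb)
  ultimately show "qform Q' v \<le> qform P' v" by (simp add: a_def b_def)
qed

lemma hermitian_inverse:
  assumes "adjoint_mat P = P" "P ** Q = mat 1"
  shows "adjoint_mat Q = Q"
proof -
  have "adjoint_mat Q ** P = mat 1" by (metis adjoint_mult adjoint_one assms)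
  then show ?thesis by (metis assms(2) matrix_mul_assoc matrix_mul_lid matrix_mul_rid)
qed

lemma hermitian_norm_bound:
  assumes "adjoint_mat M = M" "norm M \<le> e"
  shows "psd (e *\<^sub>R mat 1 + M)"
  unfolding psd_def hermitian_mat_def
proof (intro conjI allI)
  show "adjoint_mat (e *\<^sub>R mat 1 + M) = e *\<^sub>R mat 1 + M"
    by (simp add: adjoint_add adjoint_scaleR assms)
  fix v
  have "\<bar>qform M v\<bar> \<le> norm v * norm (M *v v)"
    using norm_cip_le[of v "M *v v"] abs_Re_le_cmod order_trans by blast
  also have "\<dots> \<le> norm v * (e * norm v)"
    using norm_matrix_vector_mult_le[of M v] mult_right_mono[OF assms(2), of "norm v"]
    by (intro mult_left_mono) auto
  finally have "- qform M v \<le> e * (norm v)\<^sup>2" by (simp add: power2_eq_square abs_le_iff ac_simps)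
  then show "0 \<le> qform (e *\<^sub>R mat 1 + M) v"
    by (simp add: matrix_vector_mult_add_rdistrib cip_add_right scaleR_matrix_vector cip_scaleR_right
        cip_self del: of_real_power)
qed

lemma psd_regularised_posdef: "psd P \<Longrightarrow> 0 < e \<Longrightarrow> posdef_mat (P + e *\<^sub>R mat 1)"
  by (rule psd_lower_imp_posdef[of e]) (auto simp: loewner_def intro!: psd_add psd_scaleR)

context unsplittable_pencil
begin

text \<open>The cardinalities of \<open>I\<close> and \<open>J\<close> are the ranks of \<open>w\<close> and \<open>\<eta>(w)\<close>. The pencil maps the range of \<open>w\<close>
  into that of \<open>\<eta>(w)\<close>, which is larger if \<open>w\<close> is singular; if \<open>w\<close> has full rank, then
  \<open>\<eta>(w) w = 0\<close> makes every \<open>A\<^sub>i\<close> vanish.\<close>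

lemma rank_expand:
  fixes I J :: "'n set"
  assumes w: "w = (\<Sum>k\<in>I. outer (b k))" "w \<noteq> 0"
    and bd: "\<And>j k. j \<in> I \<Longrightarrow> k \<in> I \<Longrightarrow> cip (b j) (d k) = (if j = k then 1 else 0)"
    and y: "\<eta> w = (\<Sum>k\<in>J. outer (c k))"
    and ce: "\<And>j k. j \<in> J \<Longrightarrow> k \<in> J \<Longrightarrow> cip (c j) (e k) = (if j = k then 1 else 0)"
    and zero: "\<eta> w ** w = 0"
  shows "card I < card J"
proof (rule ccontr)
  assume "\<not> card I < card J"
  then have le: "card J \<le> card I" by simp
  have wd: "w *v d k = b k" if "k \<in> I" for k
    using that by (simp add: w sum_matrix_vector_mult outer_mult_vec bd if_distrib if_distribR sum.delta cong: if_cong)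
  have qy: "qform (\<eta> w) v = (\<Sum>i=1..r. \<Sum>k\<in>I. (cmod (cip (b k) (A i *v v)))\<^sup>2)" for v
  proof -
    have "qform (A i ** w ** A i) v = qform w (A i *v v)" if "i \<in> {1..r}" for i
      using pencil_adj[OF that] by (simp add: cip_mult_right[of _ "A i"] flip: matrix_vector_mul_assoc)
    moreover have "qform w x = (\<Sum>k\<in>I. (cmod (cip (b k) x))\<^sup>2)" for x
      by (simp add: w sum_matrix_vector_mult cip_sum_right qform_outer)
    ultimately show ?thesis
      by (simp add: covariance_map_def sum_matrix_vector_mult cip_sum_right)
  qed
  have orth: "cip (b k) (A i *v v) = 0" if "qform (\<eta> w) v = 0" "i \<in> {1..r}" "k \<in> I" for i k v
  proof -
    have "(\<Sum>k\<in>I. (cmod (cip (b k) (A i *v v)))\<^sup>2) = 0"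
      using that(1,2) unfolding qy by (subst (asm) sum_nonneg_eq_0_iff) (auto intro: sum_nonneg)
    then show ?thesis using that(3) by (simp add: sum_nonneg_eq_0_iff)
  qed
  define R where "R = vec.span (b ` I)"
  define L where "L = vec.span (c ` J)"
  have injb: "inj_on b I" by (rule inj_onI) (metis bd zero_neq_one)
  have indep: "vec.independent (b ` I)"
  proof (rule vec.independent_if_scalars_zero)
    fix f x assume s: "(\<Sum>x\<in>b ` I. f x *s x) = 0" and "x \<in> b ` I"
    then obtain k where k: "k \<in> I" "x = b k" by auto
    have "0 = cip (d k) (\<Sum>x\<in>b ` I. f x *s x)" using s by simp
    also have "\<dots> = (\<Sum>j\<in>I. f (b j) * cip (d k) (b j))"
      by (simp add: sum.reindex[OF injb] cip_sum_right cip_smult_right)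
    also have "\<dots> = (\<Sum>j\<in>I. if j = k then f (b j) else 0)"
      using k(1) bd cip_commute[of "d k"] by (intro sum.cong) auto
    also have "\<dots> = f x" using k by simp
    finally show "f x = 0" by simp
  qed simp
  have dimR: "vec.dim R = card I"
    using vec.dim_eq_card_independent[OF indep] by (simp add: R_def card_image[OF injb])
  have dimL: "vec.dim L \<le> card J"
    unfolding L_def by (metis card_image_le finite_class.finite finite_imageI order_trans subset_refl vec.dim_le_card)
  have "I \<noteq> {}" using w by auto
  then have I1: "1 \<le> card I" by (simp add: Suc_leI card_gt_0_iff)
  have sub: "A i *v b k \<in> L" if i: "i \<in> {1..r}" and k: "k \<in> I" for i k
  proof -
    define x where "x = A i *v b k"
    define z where "z = x - (\<Sum>j\<in>J. cip (e j) x *s c j)"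
    have "cip v z = 0" for v
    proof -
      \<comment> \<open>\<open>z\<close> is \<open>x\<close> minus its projection to the range along the dual family; the adjoint projection
        sends \<open>v\<close> to a vector \<open>v'\<close> killed by \<open>\<eta>(w)\<close>\<close>
      define v' where "v' = v - (\<Sum>j\<in>J. cip (c j) v *s e j)"
      have "cip (c l) v' = 0" if "l \<in> J" for l
        using that by (simp add: v'_def cip_diff_right cip_sum_right cip_smult_right ce if_distrib
            if_distribR sum.delta cong: if_cong)
      then have "\<eta> w *v v' = 0"
        by (simp add: y sum_matrix_vector_mult outer_mult_vec)
      then have "cip (b k) (A i *v v') = 0" using orth[OF _ i k] by simp
      then have "cip x v' = 0" using pencil_adj[OF i] by (simp add: x_def cip_mult_left)
      then have "cip v' x = 0" using cip_commute[of v' x] by simp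
      moreover have "cip v' x = cip v z"
      proof -
        have "cnj (cip (c j) v) = cip v (c j)" for j using cip_commute[of v "c j"] by simp
        then show ?thesis
          by (simp add: v'_def z_def cip_diff_left cip_diff_right cip_sum_left cip_sum_right
              cip_smult_left cip_smult_right mult.commute)
      qed
      ultimately show ?thesis by simp
    qed
    then have "z = 0" by (rule cip_ext)
    then have "x = (\<Sum>j\<in>J. cip (e j) x *s c j)" by (simp add: z_def)
    also have "\<dots> \<in> L"
      unfolding L_def by (intro vec.span_sum vec.span_scale vec.span_base) auto
    finally show ?thesis by (simp add: x_def)
  qed
  show False
  proof (cases "card I < CARD('n)")
    case True
    have "(*v) (A i) ` R \<subseteq> L" if "i \<in> {1..r}" for i
    proof -
      have "(*v) (A i) ` R = vec.span ((*v) (A i) ` b ` I)"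
        unfolding R_def by (rule span_image_mat[symmetric])
      also have "\<dots> \<subseteq> L"
        using sub[OF that] by (intro vec.span_minimal) (auto simp: L_def)
      finally show ?thesis .
    qed
    then have "vec.dim R < vec.dim L"
      using I1 True dimR by (intro dim_expand) (auto simp: R_def L_def)
    then show False using dimR dimL le by simp
  next
    case False
    then have cardI: "card I = CARD('n)" using card_mono[of UNIV I] by simp
    have "vec.dim (UNIV :: (complex^'n) set) = card (b ` I)"
      by (simp add: card_image[OF injb] cardI card_cart_basis)
    then have spanU: "vec.span (b ` I) = UNIV"
      using indep vec.card_eq_dim[of "b ` I" UNIV] by auto
    have bb: "cip (A i *v b l) (b k) = 0" if "i \<in> {1..r}" "k \<in> I" "l \<in> I" for i k l
    proof -
      have "\<eta> w *v b l = 0"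
        using wd[OF that(3)] zero by (metis matrix_vector_mul_assoc matrix_vector_mult_0)
      then have "cip (b k) (A i *v b l) = 0" using orth[OF _ that(1,2)] by simp
      then show ?thesis using cip_commute[of "A i *v b l"] by simp
    qed
    have Ab: "A i *v b l = 0" if "i \<in> {1..r}" "l \<in> I" for i l
    proof -
      have "vec.subspace {x. cip (A i *v b l) x = 0}"
        by (auto simp: vec.subspace_def cip_add_right cip_smult_right)
      then have "vec.span (b ` I) \<subseteq> {x. cip (A i *v b l) x = 0}"
        using bb[OF that(1) _ that(2)] by (intro vec.span_minimal) auto
      then have "cip (A i *v b l) (A i *v b l) = 0" using spanU by auto
      then show ?thesis by (simp add: cip_self)
    qed
    have "A i = 0" if "i \<in> {1..r}" for i
    proof -
      have "vec.span (b ` I) \<subseteq> {x. A i *v x = 0}"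
        using Ab[OF that] by (intro vec.span_minimal subspace_kernel_mat) auto
      then show ?thesis using spanU nonzero_matrix_vector[of "A i"] by auto
    qed
    then show False using pencil_nonzero by blast
  qed
qed

text \<open>Blow-up analysis: along an unbounded sequence of Hermitian solutions \<open>W\<^sub>k\<close> with \<open>u\<^sub>k \<in> (0,1]\<close> the
  directions \<open>W\<^sub>k/\<parallel>W\<^sub>k\<parallel>\<close> converge to \<open>w\<close>, and
  \<open>W\<^sub>k\<^sup>-\<^sup>1/\<parallel>W\<^sub>k\<parallel>\<close> converges to \<open>\<eta>(w)\<close>.  For \<open>G = (\<eta>(w) + \<delta>)\<^sup>-\<^sup>1\<close> eventually \<open>\<eta>(G) \<le> W\<^sub>k\<^sup>-\<^sup>1\<parallel>W\<^sub>k\<parallel>\<close>, so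
  \<open>w \<eta>(G) w \<le> w\<close> and \<open>tr(\<eta>(w) G) = tr(w \<eta>(G)) \<le> rank w\<close>.  Letting \<open>\<delta> \<rightarrow> 0\<close> gives
  \<open>rank \<eta>(w) \<le> rank w\<close>, which is impossible.\<close>

lemma hermitian_solution_bounded:
  obtains K where "\<And>t W. \<lbrakk>0 < t; t \<le> 1; dyson (complex_of_real t) W; adjoint_mat W = W\<rbrakk> \<Longrightarrow> norm W \<le> K"
proof (rule ccontr)
  assume no: "\<not> thesis"
  have "\<exists>t W. 0 < t \<and> t \<le> 1 \<and> dyson (complex_of_real t) W \<and> adjoint_mat W = W \<and> real k < norm W" for k :: nat
  proof (rule ccontr)
    assume neg: "\<nexists>t W. 0 < t \<and> t \<le> 1 \<and> dyson (complex_of_real t) W \<and> adjoint_mat W = W \<and> real k < norm W"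
    have thesis by (rule that[of "real k"]) (use neg not_less in blast)
    then show False using no by contradiction
  qed
  then obtain t W where tW: "\<And>k. 0 < t k" "\<And>k. t k \<le> 1" "\<And>k. dyson (complex_of_real (t k)) (W k)"
    "\<And>k. adjoint_mat (W k) = W k" "\<And>k::nat. real k < norm (W k)"
    by metis
  define p where "p k = norm (W k)" for k
  define wk where "wk k = (1 / p k) *\<^sub>R W k" for k
  define yk where "yk k = (t k / p k) *\<^sub>R mat 1 + \<eta> (wk k)" for k
  have ppos: "p k > 0" for k using tW(5)[of k] of_nat_0_le_iff[of k, where 'a = real] unfolding p_def by linarith
  have rpW: "rp (W k) = W k" for k by (simp add: rp_def tW(4) scaleR_2[symmetric])
  have posW: "posdef_mat (W k)" for k using tW(3)[of k] by (simp add: dyson_def rpW)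
  have yk': "yk k = (1 / p k) *\<^sub>R (mat (complex_of_real (t k)) + \<eta> (W k))" for k
    by (simp add: yk_def wk_def \<eta>_scaleR mat_of_real scaleR_add_right)
  have wy: "wk k ** yk k = (1 / (p k)\<^sup>2) *\<^sub>R mat 1" "yk k ** W k = (1 / p k) *\<^sub>R mat 1" for k
    using tW(3)[of k] unfolding yk' by (simp_all add: wk_def dyson_def matrix_scaleR_left matrix_scaleR_right power2_eq_square)
  have "wk k \<in> sphere 0 1" for k using ppos[of k] by (simp add: wk_def p_def)
  then obtain w \<sigma> where w: "w \<in> sphere 0 1" and \<sigma>: "strict_mono \<sigma>" and lim: "(wk \<circ> \<sigma>) \<longlonglongrightarrow> w"
    using compact_sphere[of "0 :: complex^'n^'n" 1] unfolding compact_def by metis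
  have psdwk: "psd (wk k)" for k
    using posdef_imp_psd[OF posW] ppos[of k] by (simp add: wk_def psd_scaleR)
  have psdw: "psd w" by (rule psd_limit[OF _ lim]) (simp add: psdwk)
  have psdy: "psd (\<eta> w)" using psdw by (rule \<eta>_psd)
  have pinf: "filterlim p at_top sequentially"
    by (rule filterlim_at_top_mono[OF filterlim_real_sequentially]) (use tW(5) in \<open>auto simp: p_def less_imp_le\<close>)
  then have pinf\<sigma>: "filterlim (\<lambda>k. p (\<sigma> k)) at_top sequentially"
    using \<sigma> filterlim_compose filterlim_subseq by blast
  have inv0: "(\<lambda>k. 1 / p (\<sigma> k)) \<longlonglongrightarrow> 0"
    using tendsto_divide_0[OF tendsto_const filterlim_at_top_imp_at_infinity[OF pinf\<sigma>]] .
  have tp0: "(\<lambda>k. t (\<sigma> k) / p (\<sigma> k)) \<longlonglongrightarrow> 0"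
  proof (rule tendsto_sandwich[OF _ _ tendsto_const inv0])
    show "\<forall>\<^sub>F k in sequentially. 0 \<le> t (\<sigma> k) / p (\<sigma> k)"
      by (intro always_eventually allI divide_nonneg_pos ppos) (simp add: tW(1) less_imp_le)
    show "\<forall>\<^sub>F k in sequentially. t (\<sigma> k) / p (\<sigma> k) \<le> 1 / p (\<sigma> k)"
      by (intro always_eventually allI divide_right_mono tW(2)) (simp add: ppos less_imp_le)
  qed
  have "(\<lambda>k. yk (\<sigma> k)) \<longlonglongrightarrow> 0 *\<^sub>R mat 1 + \<eta> w"
    unfolding yk_def using lim tp0 by (intro tendsto_intros tendsto_\<eta>) (simp_all add: o_def)
  then have limy: "(\<lambda>k. yk (\<sigma> k)) \<longlonglongrightarrow> \<eta> w" by simp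
  have "(\<lambda>k. wk (\<sigma> k) ** yk (\<sigma> k)) \<longlonglongrightarrow> w ** \<eta> w"
    using lim limy by (intro tendsto_matrix_mult) (simp_all add: o_def)
  moreover have "(\<lambda>k. (1 / p (\<sigma> k)) ^ 2 *\<^sub>R (mat 1 :: complex^'n^'n)) \<longlonglongrightarrow> 0 ^ 2 *\<^sub>R mat 1"
    by (intro tendsto_intros inv0)
  then have "(\<lambda>k. wk (\<sigma> k) ** yk (\<sigma> k)) \<longlonglongrightarrow> 0" by (simp add: wy power_divide)
  ultimately have "w ** \<eta> w = 0" using LIMSEQ_unique by blast
  then have zero: "\<eta> w ** w = 0"
    using adjoint_mult[of w "\<eta> w"] psdw psdy by (simp add: psd_adj)
  obtain I :: "'n set" and b d where I: "w = (\<Sum>k\<in>I. outer (b k))"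
    "\<And>j k. j \<in> I \<Longrightarrow> k \<in> I \<Longrightarrow> cip (b j) (d k) = (if j = k then 1 else 0)"
    using psd_biorthogonal[OF psdw] by blast
  obtain J :: "'n set" and c e where J: "\<eta> w = (\<Sum>k\<in>J. outer (c k))"
    "\<And>j k. j \<in> J \<Longrightarrow> k \<in> J \<Longrightarrow> cip (c j) (e k) = (if j = k then 1 else 0)"
    using psd_biorthogonal[OF psdy] by blast
  have wd: "w *v d k = b k" if "k \<in> I" for k
    using that by (simp add: I sum_matrix_vector_mult outer_mult_vec if_distrib if_distribR sum.delta cong: if_cong)
  have yd: "\<eta> w *v e k = c k" if "k \<in> J" for k
    using that by (simp add: J sum_matrix_vector_mult outer_mult_vec if_distrib if_distribR sum.delta cong: if_cong)
  have trace_bound: "(\<Sum>j\<in>J. 1 / (1 + \<delta> * (norm (e j))\<^sup>2)) \<le> real (card I)" if \<delta>: "\<delta> > 0" for \<delta>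
  proof -
    define Q where "Q = \<eta> w + \<delta> *\<^sub>R mat 1"
    have posQ: "posdef_mat Q" unfolding Q_def using psdy \<delta> by (rule psd_regularised_posdef)
    obtain G where G: "Q ** G = mat 1" "G ** Q = mat 1" using posdef_inverse[OF posQ] .
    have adjG: "adjoint_mat G = G"
      using hermitian_inverse[OF _ G(1)] posdef_imp_psd[OF posQ] by (simp add: psd_adj)
    have psdG: "psd G"
      using psd_conj[OF posdef_imp_psd[OF posQ], of G] G by (simp add: adjG)
    have "\<forall>\<^sub>F k in sequentially. dist (yk (\<sigma> k)) (\<eta> w) < \<delta>" using limy \<delta> by (rule tendstoD)
    then obtain N where N: "\<And>k. k \<ge> N \<Longrightarrow> norm (yk (\<sigma> k) - \<eta> w) < \<delta>"
      by (auto simp: eventually_sequentially dist_norm)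
    have step: "psd (wk (\<sigma> k) - wk (\<sigma> k) ** \<eta> G ** wk (\<sigma> k))" if k: "k \<ge> N" for k
    proof -
      let ?k = "\<sigma> k"
      have psdyk: "psd (yk ?k)"
        unfolding yk_def using psdwk ppos[of ?k] tW(1)[of ?k]
        by (intro psd_add psd_scaleR \<eta>_psd) (auto simp: less_imp_le)
      have "psd (\<delta> *\<^sub>R mat 1 + (\<eta> w - yk ?k))"
        using N[OF k] psd_adj[OF psdy] psd_adj[OF psdyk]
        by (intro hermitian_norm_bound) (auto simp: adjoint_diff norm_minus_commute)
      then have "yk ?k \<preceq> Q" by (simp add: loewner_def Q_def algebra_simps)
      then have "G \<preceq> p ?k *\<^sub>R W ?k"
      proof (rule loewner_inverse[OF _ _ psdyk G(1) posdef_imp_psd[OF posQ]])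
        show "yk ?k ** (p ?k *\<^sub>R W ?k) = mat 1"
          using ppos[of ?k] by (simp add: matrix_scaleR_right wy)
      qed (simp_all add: hermitian_mat_def adjoint_scaleR tW(4) adjG)
      then have "\<eta> G \<preceq> p ?k *\<^sub>R \<eta> (W ?k)" using \<eta>_mono \<eta>_scaleR by metis
      moreover have "p ?k *\<^sub>R \<eta> (W ?k) \<preceq> p ?k *\<^sub>R (p ?k *\<^sub>R yk ?k)"
      proof -
        have "p ?k *\<^sub>R (p ?k *\<^sub>R yk ?k) - p ?k *\<^sub>R \<eta> (W ?k) = (p ?k * t ?k) *\<^sub>R mat 1"
          using ppos[of ?k] by (simp add: yk' scaleR_add_right mat_of_real)
        then show ?thesis using ppos[of ?k] tW(1)[of ?k] by (simp add: loewner_def psd_scaleR)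
      qed
      ultimately have "\<eta> G \<preceq> p ?k *\<^sub>R (p ?k *\<^sub>R yk ?k)" by (rule loewner_trans)
      then have "wk ?k ** \<eta> G ** adjoint_mat (wk ?k) \<preceq> wk ?k ** (p ?k *\<^sub>R (p ?k *\<^sub>R yk ?k)) ** adjoint_mat (wk ?k)"
        by (rule loewner_conj)
      moreover have "wk ?k ** (p ?k *\<^sub>R (p ?k *\<^sub>R yk ?k)) ** adjoint_mat (wk ?k) = wk ?k"
        using ppos[of ?k] psd_adj[OF psdwk[of ?k]]
        by (simp add: matrix_scaleR_right matrix_scaleR_left wy power2_eq_square)
      ultimately show ?thesis using psd_adj[OF psdwk[of ?k]] by (simp add: loewner_def)
    qed
    have "(\<lambda>k. wk (\<sigma> (k + N)) - wk (\<sigma> (k + N)) ** \<eta> G ** wk (\<sigma> (k + N))) \<longlonglongrightarrow> w - w ** \<eta> G ** w"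
      using LIMSEQ_ignore_initial_segment[OF lim, of N] by (intro tendsto_intros) (simp_all add: o_def)
    then have psdl: "psd (w - w ** \<eta> G ** w)" by (rule psd_limit[rotated]) (simp add: step)
    have bG: "qform (\<eta> G) (b i) \<le> 1" if "i \<in> I" for i
    proof -
      have "0 \<le> qform (w - w ** \<eta> G ** w) (d i)" using psdl by (rule psd_qform)
      also have "\<dots> = qform w (d i) - qform (\<eta> G) (w *v d i)"
        using psd_adj[OF psdw] by (simp add: matrix_vector_mult_diff_rdistrib cip_diff_right
            cip_mult_right[of _ w "\<eta> G *v _"] flip: matrix_vector_mul_assoc)
      also have "\<dots> = 1 - qform (\<eta> G) (b i)"
        using that cip_commute[of "d i" "b i"] by (simp add: wd I(2))
      finally show ?thesis by simp
    qed
    have cG: "1 / (1 + \<delta> * (norm (e j))\<^sup>2) \<le> qform G (c j)" if j: "j \<in> J" for j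
    proof -
      \<comment> \<open>minimise the form of \<open>Q = G\<^sup>-\<^sup>1\<close> on the line through \<open>G c\<^sub>j\<close> in the dual direction \<open>e\<^sub>j\<close>\<close>
      define a where "a = G *v c j"
      define q where "q = 1 + \<delta> * (norm (e j))\<^sup>2"
      have q: "q > 0" using \<delta> by (simp add: q_def add_pos_nonneg)
      have Qa: "Q *v a = c j" by (simp add: a_def matrix_vector_mul_assoc G)
      have ec: "cip (c j) (e j) = 1" "cip (e j) (c j) = 1"
        using J(2)[OF j j] cip_commute[of "e j" "c j"] by simp_all
      have ae: "cip a (Q *v e j) = 1"
        using cip_mult_right[of a Q "e j"] psd_adj[OF posdef_imp_psd[OF posQ]] by (simp add: Qa ec)
      have qe: "qform Q (e j) = q"
        by (simp add: Q_def matrix_vector_mult_add_rdistrib yd[OF j] cip_add_right ec scaleR_matrix_vector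
            cip_scaleR_right cip_self q_def del: of_real_power)
      have aa: "Re (cip a (c j)) = qform G (c j)" using cip_commute[of a "c j"] by (simp add: a_def)
      have "0 \<le> qform Q (a - (1 / q) *\<^sub>R e j)" by (rule psd_qform[OF posdef_imp_psd[OF posQ]])
      also have "\<dots> = qform G (c j) - 2 * (1 / q) + (1 / q) * ((1 / q) * q)"
        by (simp add: matrix_vector_mult_diff_distrib matrix_vector_scaleR cip_diff_left cip_diff_right
            cip_scaleR_left cip_scaleR_right Qa ae qe aa ec)
      also have "\<dots> = qform G (c j) - 1 / q" using q by simp
      finally show ?thesis by (simp add: q_def)
    qed
    have "(\<Sum>j\<in>J. 1 / (1 + \<delta> * (norm (e j))\<^sup>2)) \<le> (\<Sum>j\<in>J. qform G (c j))"
      by (intro sum_mono cG)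
    also have "\<dots> = Re (trace (\<eta> w ** G))"
      by (simp add: J(1) matrix_sum_left trace_sum trace_outer)
    also have "\<dots> = Re (trace (w ** \<eta> G))" by (simp add: trace_\<eta>)
    also have "\<dots> = (\<Sum>i\<in>I. qform (\<eta> G) (b i))"
      by (subst I(1)) (simp add: matrix_sum_left trace_sum trace_outer)
    also have "\<dots> \<le> (\<Sum>i\<in>I. 1)" by (intro sum_mono bG)
    finally show ?thesis by simp
  qed
  have "((\<lambda>\<delta>. \<Sum>j\<in>J. 1 / (1 + \<delta> * (norm (e j))\<^sup>2)) \<longlongrightarrow> (\<Sum>j\<in>J. 1 / (1 + 0 * (norm (e j))\<^sup>2))) (at_right 0)"
    by (intro tendsto_intros) simp_all
  moreover have "\<forall>\<^sub>F \<delta> in at_right (0::real). (\<Sum>j\<in>J. 1 / (1 + \<delta> * (norm (e j))\<^sup>2)) \<le> real (card I)"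
    using eventually_at_right_less[of "0::real"] by eventually_elim (rule trace_bound)
  ultimately have "(\<Sum>j\<in>J. 1 / (1 + 0 * (norm (e j))\<^sup>2)) \<le> real (card I)"
    by (rule tendsto_upperbound) simp
  then have "real (card J) \<le> real (card I)" by simp
  moreover have "card I < card J"
    by (rule rank_expand[OF I(1) _ I(2) J zero]) (use w in auto)
  ultimately show False by simp
qed

end

section \<open>Stability of the Dyson equation\<close>

lemma rtr_mono: "P \<preceq> Q \<Longrightarrow> rtr P \<le> rtr Q"
  using rtr_nonneg[of "Q - P"] by (simp add: loewner_def rtr_def trace_sub)

lemma rtr_scaleR_one: "rtr (k *\<^sub>R mat 1 :: complex^'n^'n) = k * real CARD('n)"
  by (simp add: rtr_def trace_scaleR trace_I)

lemma norm_mat_one: "norm (mat 1 :: complex^'n^'n) \<le> real CARD('n)" "1 \<le> norm (mat 1 :: complex^'n^'n)"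
proof -
  show "norm (mat 1 :: complex^'n^'n) \<le> real CARD('n)"
  proof -
    have "norm (mat 1 :: complex^'n^'n) \<le> rtr (mat 1 :: complex^'n^'n)" by (rule psd_norm_le_rtr(1)) simp
    also have "\<dots> = real CARD('n)" by (simp add: rtr_def trace_I)
    finally show ?thesis .
  qed
  have "norm ((mat 1 :: complex^'n^'n) $ i $ i) \<le> norm (mat 1 :: complex^'n^'n)" for i
    by (meson Finite_Cartesian_Product.norm_nth_le order_trans)
  then show "1 \<le> norm (mat 1 :: complex^'n^'n)" by (simp add: mat_def)
qed

lemma norm_mat_le: "norm (mat c :: complex^'n^'n) \<le> real CARD('n) * cmod c"
proof -
  have "norm (mat c :: complex^'n^'n) = cmod c * norm (mat 1 :: complex^'n^'n)"
    using norm_mat_mult[of c "mat 1 :: complex^'n^'n"] by simp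
  also have "\<dots> \<le> cmod c * real CARD('n)" by (intro mult_left_mono norm_mat_one) simp
  finally show ?thesis by (simp add: mult.commute)
qed

lemma posdef_rtr_pos:
  fixes P :: "complex^'n^'n"
  assumes "posdef_mat P"
  shows "0 < rtr P"
proof -
  have "P \<noteq> 0"
  proof
    assume "P = 0"
    moreover have "(axis undefined 1 :: complex^'n) \<noteq> 0" by (simp add: axis_eq_0_iff)
    ultimately show False using assms unfolding posdef_iff
      by (metis cip_zero(2) less_irrefl matrix_vector_mult_0 zero_complex.simps(1))
  qed
  then show ?thesis using psd_norm_le_rtr(1)[OF posdef_imp_psd[OF assms]] by (meson less_le_trans zero_less_norm_iff)
qed

context unsplittable_pencil
begin

lemma wt_upper:
  assumes "psd P" "psd Q"
  shows "wt P Q Z \<le> rtr P * rtr Q * (norm Z)\<^sup>2"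
proof -
  have "wt P Q Z \<le> wt (rtr P *\<^sub>R mat 1) (rtr Q *\<^sub>R mat 1) Z"
    using assms psd_norm_le_rtr(2) rtr_nonneg by (intro wt_mono psd_scaleR) auto
  then show ?thesis by (simp add: wt_scaleR_left wt_scaleR_middle wt_one ac_simps)
qed

text \<open>Quantitative uniqueness. The term of the gap with the factor \<open>Re u\<^sub>1\<close> gives the first bound. For the second, a small
  gap means that \<open>B\<close> and \<open>B'\<close> almost intertwine
  the pencil, hence are almost a common scalar \<open>l\<close>; then \<open>F\<close> is almost
  \<open>l (W\<^sub>1 + W\<^sub>2\<^sup>*) W\<^sub>2\<^sup>-\<^sup>*\<close>, and \<open>Re tr (W\<^sub>1 + W\<^sub>2\<^sup>*)\<close> is the sum of the traces of the real parts.\<close>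

lemma dyson_stability:
  fixes K :: real
  assumes K: "1 \<le> K"
  obtains C where "0 < C" and "\<And>u1 u2 W1 W2. \<lbrakk>dyson u1 W1; dyson u2 W2; 0 \<le> Re u1; 0 \<le> Re u2;
      norm W1 \<le> K; norm W2 \<le> K; norm (mat u1 + \<eta> W1) \<le> K; norm (mat u2 + \<eta> W2) \<le> K\<rbrakk>
    \<Longrightarrow> Re u1 * norm (W1 - W2) \<le> C * rtr W1 * cmod (u1 - u2) \<and>
      (rtr W1 + rtr W2)\<^sup>2 * norm (W1 - W2) \<le> C * cmod (u1 - u2)"
proof -
  obtain c where c: "0 < c" and comp: "\<And>W V X. \<lbrakk>W ** V = mat 1; norm W \<le> K; norm V \<le> K; psd X;
     W ** \<eta> X ** adjoint_mat W \<preceq> X\<rbrakk> \<Longrightarrow> (c * rtr X) *\<^sub>R mat 1 \<preceq> X"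
    using real_part_comparable[of K] by blast
  obtain C1 where C1: "0 < C1" and inter: "\<And>B B'. \<exists>l. norm (B - mat l) \<le> C1 * (\<Sum>i=1..r. norm (A i ** B - B' ** A i))
    \<and> norm (B' - mat l) \<le> C1 * (\<Sum>i=1..r. norm (A i ** B - B' ** A i))"
    using intertwining_quantitative by blast
  define n where "n = real CARD('n)"
  \<comment> \<open>in units of \<open>q = sqrt (\<parallel>B\<parallel> \<parallel>F\<parallel>)\<close>, \<open>c2\<close> bounds the distance of \<open>B\<close> and \<open>B'\<close> from a common scalar;
    \<open>c3\<close> turns this into a bound for \<open>(x1 + x2) \<parallel>B\<parallel>\<close>, and \<open>c4\<close> into one for \<open>(x1 + x2)\<^sup>2 \<parallel>B\<parallel>\<close> in terms of \<open>\<parallel>F\<parallel>\<close>\<close>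
  define c2 where "c2 = C1 * (K * sqrt (2 * real r) / c)"
  define c3 where "c3 = n\<^sup>2 * K + 2 * n * K * c2 + 2 * n\<^sup>2 * K ^ 3 * c2"
  define c4 where "c4 = 4 * c3\<^sup>2 + 4 * n\<^sup>2 * K\<^sup>2"
  define CA where "CA = 2 * K ^ 4 * n / c\<^sup>2"
  define CB where "CB = c4 * K\<^sup>2 * n / c"
  have n1: "1 \<le> n" unfolding n_def by (simp add: Suc_leI)
  have c2: "0 \<le> c2" using C1 K c by (simp add: c2_def)
  have c3: "0 \<le> c3" using n1 K c2 by (simp add: c3_def)
  have CA: "0 < CA" and CB: "0 \<le> CB" using n1 K c by (auto simp: CA_def CB_def c4_def)
  show ?thesis
  proof (rule that[of "CA + CB"])
    show "0 < CA + CB" using CA CB by simp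
    fix u1 u2 W1 W2
    assume D1: "dyson u1 W1" and D2: "dyson u2 W2" and u: "0 \<le> Re u1" "0 \<le> Re u2"
      and W: "norm W1 \<le> K" "norm W2 \<le> K" and V: "norm (mat u1 + \<eta> W1) \<le> K" "norm (mat u2 + \<eta> W2) \<le> K"
    define X1 where "X1 = rp W1"
    define X2 where "X2 = rp W2"
    define V1 where "V1 = mat u1 + \<eta> W1"
    define V2 where "V2 = mat u2 + \<eta> W2"
    define Y1 where "Y1 = Re u1 *\<^sub>R mat 1 + \<eta> X1"
    define Y2 where "Y2 = Re u2 *\<^sub>R mat 1 + \<eta> X2"
    define x1 where "x1 = rtr X1"
    define x2 where "x2 = rtr X2"
    define \<delta> where "\<delta> = cmod (u1 - u2)"
    define Z where "Z = W1 - W2"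
    note R1 = dyson_re[OF D1, folded V1_def X1_def, folded Y1_def]
    note R2 = dyson_re[OF D2, folded V2_def X2_def, folded Y2_def]
    have ps: "psd X1" "psd X2" "psd Y1" using posdef_imp_psd R1(3) R2(3) dyson_psd[OF D1 u(1)]
      by (auto simp: Y1_def X1_def)
    have x: "0 < x1" "0 < x2" using posdef_rtr_pos R1(3) R2(3) by (auto simp: x1_def x2_def)
    have rtrW: "rtr W1 = x1" "rtr W2 = x2" by (simp_all add: x1_def x2_def X1_def X2_def rtr_rp)
    have xle: "x1 \<le> n * K" "x2 \<le> n * K"
      using rtr_le_norm[of W1] rtr_le_norm[of W2] mult_left_mono[OF W(1), of n]
        mult_left_mono[OF W(2), of n] n1 x unfolding rtrW n_def by linarith+
    have lower: "(c * x1) *\<^sub>R mat 1 \<preceq> X1" "(c * x2) *\<^sub>R mat 1 \<preceq> X2"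
    proof -
      \<comment> \<open>a solution satisfies \<open>X = W (d + \<eta>(X)) W\<^sup>*\<close> with \<open>d \<ge> 0\<close>\<close>
      have le: "W ** \<eta> X ** adjoint_mat W \<preceq> X"
        if "W ** (a *\<^sub>R mat 1 + \<eta> X) ** adjoint_mat W = X" "0 \<le> a" for W X a
      proof -
        have "X - W ** \<eta> X ** adjoint_mat W = a *\<^sub>R (W ** adjoint_mat W)"
          by (subst that(1)[symmetric]) (simp add: matrix_ring_simps)
        then show ?thesis using that(2) by (simp add: loewner_def psd_scaleR psd_gram)
      qed
      show "(c * x1) *\<^sub>R mat 1 \<preceq> X1" unfolding x1_def
        using R1(1) W V ps u R1(4)[unfolded Y1_def] by (intro comp[of W1 V1] le[of W1 "Re u1"]) (auto simp: V1_def)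
      show "(c * x2) *\<^sub>R mat 1 \<preceq> X2" unfolding x2_def
        using R2(1) W V ps u R2(4)[unfolded Y2_def] by (intro comp[of W2 V2] le[of W2 "Re u2"]) (auto simp: V2_def)
    qed
    obtain Q where Q: "X2 ** Q = mat 1" "Q ** X2 = mat 1" using posdef_inverse[OF R2(3)] .
    have adjQ: "adjoint_mat Q = Q"
      by (rule hermitian_inverse[OF _ Q(1)]) (simp add: X2_def)
    have psdQ: "psd Q" using psd_conj[OF ps(2), of Q] Q by (simp add: adjQ)
    have normQ: "norm Q \<le> n / (c * x2)"
    proof -
      have "Q \<preceq> (1 / (c * x2)) *\<^sub>R mat 1"
        using c x by (intro loewner_inverse[OF lower(2) _ _ Q(1) ps(2)])
          (auto simp: matrix_scaleR_left matrix_scaleR_right psd_scaleR hermitian_mat_def adjoint_scaleR adjQ)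
      then have "rtr Q \<le> rtr ((1 / (c * x2)) *\<^sub>R mat 1 :: complex^'n^'n)" by (rule rtr_mono)
      also have "\<dots> = n / (c * x2)" by (simp add: rtr_scaleR_one n_def)
      finally have "rtr Q \<le> n / (c * x2)" .
      then show ?thesis using psd_norm_le_rtr(1)[OF psdQ] by simp
    qed
    have rtrY1: "rtr Y1 \<le> K\<^sup>2 * x1"
    proof -
      have "rtr Y1 = wt (mat 1) X1 V1" by (simp add: rtr_def wt_def R1(6))
      also have "\<dots> \<le> wt (mat 1) (x1 *\<^sub>R mat 1) V1"
        using ps psd_norm_le_rtr(2) by (intro wt_mono) (auto simp: loewner_def x1_def)
      also have "\<dots> = x1 * (norm V1)\<^sup>2" by (simp add: wt_scaleR_middle wt_one)
      also have "\<dots> \<le> x1 * K\<^sup>2" using V x by (intro mult_left_mono power_mono) (auto simp: V1_def)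
      finally show ?thesis by (simp add: mult.commute)
    qed
    have Nup: "wt Y1 X2 M \<le> K\<^sup>2 * x1 * x2 * (norm M)\<^sup>2" for M
    proof -
      have "wt Y1 X2 M \<le> rtr Y1 * rtr X2 * (norm M)\<^sup>2" by (rule wt_upper[OF ps(3,2)])
      also have "\<dots> \<le> K\<^sup>2 * x1 * x2 * (norm M)\<^sup>2"
        using rtrY1 x by (intro mult_right_mono) (auto simp: x2_def)
      finally show ?thesis .
    qed
    define E where "E = mat (u2 - u1) ** W1 ** W2"
    define B where "B = Z ** Q"
    define F where "F = E ** Q"
    obtain B' where B': "B ** X2 = Z" "\<eta> (B ** X2) = B' ** Y2" "F = B + W1 ** B' ** adjoint_mat V2"
      using dyson_coordinates[OF D1 D2, folded X2_def, folded Y2_def V2_def, OF Q, of Z]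
      unfolding Z_def dyson_difference[OF D1 D2] E_def[symmetric] F_def B_def by metis
    define q where "q = sqrt (norm B * norm F)"
    have q0: "0 \<le> q" and q2: "q\<^sup>2 = norm B * norm F" by (auto simp: q_def)
    have normZ: "norm Z \<le> norm B * x2"
    proof -
      have "norm Z \<le> norm B * norm X2" using norm_matrix_mult_le[of B X2] by (simp add: B'(1))
      also have "\<dots> \<le> norm B * x2"
        using psd_norm_le_rtr(1)[OF ps(2)] by (intro mult_left_mono) (auto simp: x2_def)
      finally show ?thesis .
    qed
    have normE: "norm E \<le> \<delta> * K\<^sup>2"
    proof -
      have "norm E \<le> norm (mat (u2 - u1) ** W1) * norm W2" unfolding E_def by (rule norm_matrix_mult_le)
      also have "\<dots> = \<delta> * (norm W1 * norm W2)"
        by (simp add: norm_mat_mult \<delta>_def norm_minus_commute)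
      also have "\<dots> \<le> \<delta> * (K * K)" using W K by (intro mult_left_mono mult_mono) (auto simp: \<delta>_def)
      finally show ?thesis by (simp add: power2_eq_square)
    qed
    have normF: "norm F * x2 \<le> K\<^sup>2 * n / c * \<delta>"
    proof -
      have "norm F \<le> norm E * norm Q" unfolding F_def by (rule norm_matrix_mult_le)
      also have "\<dots> \<le> (\<delta> * K\<^sup>2) * (n / (c * x2))" using normE normQ \<delta>_def by (intro mult_mono) auto
      finally show ?thesis using x c by (simp add: field_simps)
    qed
    define gap where "gap = Re u1 * wt (mat 1) X2 B + Re u2 * wt X1 (mat 1) B' + (\<Sum>i=1..r. wt X1 X2 (A i ** B - B' ** A i))"
    have gap: "gap \<le> 2 * (K\<^sup>2 * x1 * x2 * q\<^sup>2)"
    proof -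
      have "gap = wt Y1 X2 B - wt Y1 X2 (F - B)"
        using dyson_gap[OF D1 D2, folded X1_def X2_def, folded Y1_def Y2_def V2_def, OF B'(2)] B'(3)
        by (simp add: gap_def)
      also have "\<dots> \<le> 2 * sqrt (wt Y1 X2 B * wt Y1 X2 F)" by (rule wt_cauchy_schwarz[OF ps(3,2)])
      also have "\<dots> \<le> 2 * sqrt ((K\<^sup>2 * x1 * x2 * (norm B)\<^sup>2) * (K\<^sup>2 * x1 * x2 * (norm F)\<^sup>2))"
        using x by (intro mult_left_mono real_sqrt_le_mono mult_mono Nup wt_nonneg ps) auto
      also have "(K\<^sup>2 * x1 * x2 * (norm B)\<^sup>2) * (K\<^sup>2 * x1 * x2 * (norm F)\<^sup>2) = (K\<^sup>2 * x1 * x2 * (norm B * norm F))\<^sup>2"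
        by (simp add: power2_eq_square ac_simps)
      also have "sqrt \<dots> = K\<^sup>2 * x1 * x2 * (norm B * norm F)" using x by (simp add: real_sqrt_abs abs_mult)
      finally show ?thesis by (simp add: q2)
    qed
    have nn: "0 \<le> Re u1 * wt (mat 1) X2 B" "0 \<le> Re u2 * wt X1 (mat 1) B'"
      "\<And>i. 0 \<le> wt X1 X2 (A i ** B - B' ** A i)"
      using u ps by (auto intro!: mult_nonneg_nonneg wt_nonneg)
    have nns: "0 \<le> (\<Sum>i=1..r. wt X1 X2 (A i ** B - B' ** A i))" by (intro sum_nonneg nn)
    have partA: "Re u1 * norm Z \<le> CA * x1 * \<delta>"
    proof (cases "B = 0")
      case True
      then show ?thesis using normZ CA x by (simp add: \<delta>_def)
    next
      case False
      have "Re u1 * (1 * (c * x2) * (norm B)\<^sup>2) \<le> Re u1 * wt (mat 1) X2 B"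
        using u c x lower ps by (intro mult_left_mono wt_lower) (auto simp: loewner_def)
      also have "\<dots> \<le> 2 * (K\<^sup>2 * x1 * x2 * q\<^sup>2)" using gap nn nns unfolding gap_def by linarith
      finally have "(x2 * norm B) * (Re u1 * (c * norm B)) \<le> (x2 * norm B) * (2 * K\<^sup>2 * x1 * norm F)"
        unfolding q2 by (simp add: power2_eq_square ac_simps)
      then have "Re u1 * (c * norm B) \<le> 2 * K\<^sup>2 * x1 * norm F" using False x by simp
      then have "Re u1 * norm B \<le> 2 * K\<^sup>2 * x1 * norm F / c" using c by (simp add: field_simps)
      then have "Re u1 * norm B * x2 \<le> 2 * K\<^sup>2 * x1 * norm F / c * x2" using x by (intro mult_right_mono) auto
      also have "\<dots> = 2 * K\<^sup>2 * x1 / c * (norm F * x2)" by simp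
      also have "\<dots> \<le> 2 * K\<^sup>2 * x1 / c * (K\<^sup>2 * n / c * \<delta>)" using x c by (intro mult_left_mono normF) auto
      also have "\<dots> = CA * x1 * \<delta>" using c by (simp add: CA_def field_simps power2_eq_square power4_eq_xxxx)
      finally have "Re u1 * norm B * x2 \<le> CA * x1 * \<delta>" .
      moreover have "Re u1 * norm Z \<le> Re u1 * (norm B * x2)" using u by (intro mult_left_mono normZ)
      ultimately show ?thesis by (simp add: mult.assoc)
    qed
    define s where "s = x1 + x2"
    define T where "T = (\<Sum>i=1..r. norm (A i ** B - B' ** A i))"
    have T: "T \<le> K * sqrt (2 * real r) / c * q"
    proof (rule power2_le_imp_le)
      have "T\<^sup>2 \<le> (\<Sum>i=1..r. (1::real)\<^sup>2) * (\<Sum>i=1..r. (norm (A i ** B - B' ** A i))\<^sup>2)"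
        unfolding T_def using Cauchy_Schwarz_ineq_sum[of "\<lambda>_. 1" "\<lambda>i. norm (A i ** B - B' ** A i)" "{1..r}"] by simp
      also have "\<dots> = r * (\<Sum>i=1..r. (norm (A i ** B - B' ** A i))\<^sup>2)" by simp
      finally have T2: "T\<^sup>2 \<le> r * (\<Sum>i=1..r. (norm (A i ** B - B' ** A i))\<^sup>2)" .
      have "(c * x1) * (c * x2) * (\<Sum>i=1..r. (norm (A i ** B - B' ** A i))\<^sup>2) \<le> (\<Sum>i=1..r. wt X1 X2 (A i ** B - B' ** A i))"
        unfolding sum_distrib_left using lower c x ps by (intro sum_mono wt_lower) auto
      also have "\<dots> \<le> 2 * (K\<^sup>2 * x1 * x2 * q\<^sup>2)" using gap nn nns unfolding gap_def by linarith
      finally have "(x1 * x2) * (c\<^sup>2 * (\<Sum>i=1..r. (norm (A i ** B - B' ** A i))\<^sup>2)) \<le> (x1 * x2) * (2 * K\<^sup>2 * q\<^sup>2)"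
        by (simp add: power2_eq_square ac_simps)
      then have "c\<^sup>2 * (\<Sum>i=1..r. (norm (A i ** B - B' ** A i))\<^sup>2) \<le> 2 * K\<^sup>2 * q\<^sup>2"
        using x by (simp add: mult_le_cancel_left_pos)
      then have "(\<Sum>i=1..r. (norm (A i ** B - B' ** A i))\<^sup>2) \<le> 2 * K\<^sup>2 * q\<^sup>2 / c\<^sup>2"
        using c by (simp add: field_simps)
      then have "r * (\<Sum>i=1..r. (norm (A i ** B - B' ** A i))\<^sup>2) \<le> r * (2 * K\<^sup>2 * q\<^sup>2 / c\<^sup>2)"
        by (intro mult_left_mono) auto
      also have "\<dots> = (K * sqrt (2 * real r) / c * q)\<^sup>2"
        by (simp add: power_mult_distrib power_divide)
      finally show "T\<^sup>2 \<le> (K * sqrt (2 * real r) / c * q)\<^sup>2" using T2 by linarith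
    qed (use K c q0 in simp)
    obtain l where "norm (B - mat l) \<le> C1 * T" "norm (B' - mat l) \<le> C1 * T"
      using inter[of B B'] unfolding T_def by blast
    moreover have "C1 * T \<le> c2 * q"
      using mult_left_mono[OF T, of C1] C1 by (simp add: c2_def mult.assoc)
    ultimately have l: "norm (B - mat l) \<le> c2 * q" "norm (B' - mat l) \<le> c2 * q" by linarith+
    have adjVW: "adjoint_mat V2 ** adjoint_mat W2 = mat 1" by (metis R2(1) adjoint_mult adjoint_one)
    have "mat l ** (W1 + adjoint_mat W2) = (F - (B - mat l) - W1 ** (B' - mat l) ** adjoint_mat V2) ** adjoint_mat W2"
    proof -
      have e: "W1 ** M ** adjoint_mat V2 ** adjoint_mat W2 = W1 ** M" for M
        using adjVW by (simp flip: matrix_mul_assoc)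
      show ?thesis
        by (simp add: B'(3) matrix_ring_simps e mat_scalar_commute[of l W1])
    qed
    then have "cmod l * norm (W1 + adjoint_mat W2)
       = norm ((F - (B - mat l) - W1 ** (B' - mat l) ** adjoint_mat V2) ** adjoint_mat W2)"
      by (metis norm_mat_mult)
    also have "\<dots> \<le> norm (F - (B - mat l) - W1 ** (B' - mat l) ** adjoint_mat V2) * norm (adjoint_mat W2)"
      by (rule norm_matrix_mult_le)
    also have "\<dots> \<le> (norm F + 2 * K\<^sup>2 * c2 * q) * K"
    proof (rule mult_mono)
      have "norm (W1 ** (B' - mat l) ** adjoint_mat V2) \<le> norm (W1 ** (B' - mat l)) * norm (adjoint_mat V2)"
        by (rule norm_matrix_mult_le)
      also have "\<dots> \<le> (norm W1 * norm (B' - mat l)) * norm V2"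
        using norm_matrix_mult_le[of W1 "B' - mat l"] by (intro mult_mono) auto
      also have "\<dots> \<le> (K * (c2 * q)) * K"
        using W V l K c2 q0 by (intro mult_mono mult_nonneg_nonneg) (auto simp: V2_def)
      finally have 1: "norm (W1 ** (B' - mat l) ** adjoint_mat V2) \<le> K\<^sup>2 * c2 * q"
        by (simp add: power2_eq_square ac_simps)
      have "1 * (c2 * q) \<le> K\<^sup>2 * (c2 * q)" using K c2 q0 by (intro mult_right_mono) auto
      then have 2: "norm (B - mat l) \<le> K\<^sup>2 * c2 * q" using l(1) by (simp add: mult.assoc)
      have "norm (F - (B - mat l) - W1 ** (B' - mat l) ** adjoint_mat V2)
          \<le> norm F + norm (B - mat l) + norm (W1 ** (B' - mat l) ** adjoint_mat V2)"
        using norm_triangle_ineq4[of "F - (B - mat l)" "W1 ** (B' - mat l) ** adjoint_mat V2"]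
          norm_triangle_ineq4[of F "B - mat l"] by linarith
      then show "norm (F - (B - mat l) - W1 ** (B' - mat l) ** adjoint_mat V2) \<le> norm F + 2 * K\<^sup>2 * c2 * q"
        using 1 2 by simp
    qed (use W K c2 q0 in auto)
    finally have lW: "cmod l * norm (W1 + adjoint_mat W2) \<le> (norm F + 2 * K\<^sup>2 * c2 * q) * K" .
    have "s \<le> n * norm (W1 + adjoint_mat W2)"
    proof -
      have "rtr (W1 + adjoint_mat W2) = s"
        by (simp add: s_def rtrW[symmetric] rtr_def trace_add) (simp add: trace_def)
      then show ?thesis using rtr_le_norm[of "W1 + adjoint_mat W2"] by (simp add: n_def)
    qed
    then have "cmod l * s \<le> cmod l * (n * norm (W1 + adjoint_mat W2))" by (intro mult_left_mono) auto
    also have "\<dots> = n * (cmod l * norm (W1 + adjoint_mat W2))" by simp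
    also have "\<dots> \<le> n * ((norm F + 2 * K\<^sup>2 * c2 * q) * K)" using lW n1 by (intro mult_left_mono) auto
    finally have ls: "cmod l * s \<le> n * K * norm F + 2 * n * K ^ 3 * c2 * q"
      by (simp add: algebra_simps power2_eq_square power3_eq_cube)
    have s: "0 < s" "s \<le> 2 * n * K" using x xle by (auto simp: s_def)
    have "norm B \<le> c2 * q + n * cmod l"
      using norm_triangle_ineq[of "B - mat l" "mat l"] l(1) norm_mat_le[of l, where 'n = 'n] by (simp add: n_def)
    then have "norm B * s \<le> (c2 * q + n * cmod l) * s" using s by (intro mult_right_mono) auto
    also have "\<dots> = (c2 * q) * s + n * (cmod l * s)" by (simp add: algebra_simps)
    also have "\<dots> \<le> (c2 * q) * (2 * n * K) + n * (n * K * norm F + 2 * n * K ^ 3 * c2 * q)"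
      using s ls n1 c2 q0 by (intro add_mono mult_left_mono) auto
    also have "\<dots> = (n\<^sup>2 * K) * norm F + (2 * n * K * c2 + 2 * n\<^sup>2 * K ^ 3 * c2) * q"
      by (simp add: algebra_simps power2_eq_square)
    also have "\<dots> \<le> c3 * norm F + c3 * q"
      using n1 K c2 q0 by (intro add_mono mult_right_mono) (auto simp: c3_def)
    finally have Bs: "norm B * s \<le> c3 * (norm F + q)" by (simp add: algebra_simps)
    have Bs2: "norm B * s\<^sup>2 \<le> c4 * norm F"
    proof (cases "norm F \<le> norm B")
      case True
      show ?thesis
      proof (cases "B = 0")
        case True
        then show ?thesis by (simp add: c4_def)
      next
        case False
        have "(norm F)\<^sup>2 \<le> norm B * norm F"
          unfolding power2_eq_square using \<open>norm F \<le> norm B\<close> by (intro mult_right_mono) auto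
        then have "(norm F)\<^sup>2 \<le> q\<^sup>2" by (simp add: q2)
        then have "norm F \<le> q" using q0 by (rule power2_le_imp_le)
        then have "c3 * (norm F + q) \<le> c3 * (2 * q)" using c3 by (intro mult_left_mono) auto
        then have "norm B * s \<le> c3 * (2 * q)" using Bs by linarith
        then have "(norm B * s)\<^sup>2 \<le> (c3 * (2 * q))\<^sup>2" using s by (intro power_mono) auto
        also have "(c3 * (2 * q))\<^sup>2 = norm B * (4 * c3\<^sup>2 * norm F)" by (simp add: power_mult_distrib q2)
        finally have "norm B * (norm B * s\<^sup>2) \<le> norm B * (4 * c3\<^sup>2 * norm F)"
          by (simp add: power2_eq_square ac_simps)
        then have "norm B * s\<^sup>2 \<le> 4 * c3\<^sup>2 * norm F" using False by simp
        also have "\<dots> \<le> c4 * norm F" by (intro mult_right_mono) (auto simp: c4_def)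
        finally show ?thesis .
      qed
    next
      case False
      then have "norm B * s\<^sup>2 \<le> norm F * (2 * n * K)\<^sup>2" using s by (intro mult_mono power_mono) auto
      also have "\<dots> = (4 * n\<^sup>2 * K\<^sup>2) * norm F" by (simp add: power_mult_distrib)
      also have "\<dots> \<le> c4 * norm F" by (intro mult_right_mono) (auto simp: c4_def)
      finally show ?thesis .
    qed
    have partB: "s\<^sup>2 * norm Z \<le> CB * \<delta>"
    proof -
      have "s\<^sup>2 * norm Z \<le> s\<^sup>2 * (norm B * x2)" by (intro mult_left_mono normZ) simp
      also have "\<dots> = (norm B * s\<^sup>2) * x2" by simp
      also have "\<dots> \<le> (c4 * norm F) * x2" using x by (intro mult_right_mono Bs2) auto
      also have "\<dots> = c4 * (norm F * x2)" by simp
      also have "\<dots> \<le> c4 * (K\<^sup>2 * n / c * \<delta>)" by (intro mult_left_mono normF) (simp add: c4_def)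
      finally show ?thesis by (simp add: CB_def)
    qed
    have "CA * x1 * \<delta> \<le> (CA + CB) * x1 * \<delta>" "CB * \<delta> \<le> (CA + CB) * \<delta>"
      using x CA CB by (auto simp: \<delta>_def intro!: mult_right_mono)
    then show "Re u1 * norm (W1 - W2) \<le> (CA + CB) * rtr W1 * cmod (u1 - u2) \<and>
      (rtr W1 + rtr W2)\<^sup>2 * norm (W1 - W2) \<le> (CA + CB) * cmod (u1 - u2)"
      using partA partB unfolding rtrW Z_def[symmetric] \<delta>_def[symmetric] s_def[symmetric] by linarith
  qed
qed

end

section \<open>Boundary regularity of a family of solutions\<close>

context hermitian_pencil
begin

lemma norm_inverse_le: "norm (mat u + \<eta> W) \<le> real CARD('n) * cmod u + pencil_size * norm W"
  using norm_triangle_ineq[of "mat u" "\<eta> W"] norm_mat_le[of u, where 'n = 'n] norm_\<eta>_le[of W] by linarith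

lemma dyson_adjoint:
  assumes "dyson u W"
  shows "dyson (cnj u) (adjoint_mat W)"
proof -
  have "adjoint_mat (W ** (mat u + \<eta> W)) = mat 1" "adjoint_mat ((mat u + \<eta> W) ** W) = mat 1"
    using assms by (simp_all add: dyson_def)
  moreover have "rp (adjoint_mat W) = rp W" by (simp add: rp_def add.commute)
  ultimately show ?thesis
    using assms by (simp add: dyson_def adjoint_mult adjoint_add adjoint_mat_scalar \<eta>_adjoint)
qed

end

locale dyson_family = unsplittable_pencil r A for r and A :: "nat \<Rightarrow> complex^'n^'n" +
  fixes W :: "complex \<Rightarrow> complex^'n^'n"
  assumes sol: "0 < Re u \<Longrightarrow> dyson u (W u)"
begin

text \<open>The adjoint solves the equation at the conjugate parameter, and solutions are unique.\<close>

lemma W_hermitian: "0 < t \<Longrightarrow> adjoint_mat (W (complex_of_real t)) = W (complex_of_real t)"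
  using dyson_adjoint[OF sol, of "complex_of_real t"] sol[of "complex_of_real t"]
  by (intro dyson_unique[of "complex_of_real t"]) auto

lemma W_stability:
  fixes k M :: real
  obtains C where "0 < C" and "\<And>u v. \<lbrakk>0 < Re u; 0 < Re v; norm (W u) \<le> k; norm (W v) \<le> k; cmod u \<le> M; cmod v \<le> M\<rbrakk>
    \<Longrightarrow> Re u * norm (W u - W v) \<le> C * rtr (W u) * cmod (u - v) \<and>
      (rtr (W u) + rtr (W v))\<^sup>2 * norm (W u - W v) \<le> C * cmod (u - v)"
proof -
  define K where "K = 1 + \<bar>k\<bar> + real CARD('n) * \<bar>M\<bar> + pencil_size * \<bar>k\<bar>"
  have K1: "1 \<le> K" using pencil_size_nonneg by (simp add: K_def)
  have bounds: "norm (W v) \<le> K" "norm (mat v + \<eta> (W v)) \<le> K" if v: "norm (W v) \<le> k" "cmod v \<le> M" for v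
  proof -
    have "0 \<le> real CARD('n) * \<bar>M\<bar>" "0 \<le> pencil_size * \<bar>k\<bar>" using pencil_size_nonneg by auto
    then show "norm (W v) \<le> K" using v(1) unfolding K_def by linarith
    have "real CARD('n) * cmod v \<le> real CARD('n) * \<bar>M\<bar>" "pencil_size * norm (W v) \<le> pencil_size * \<bar>k\<bar>"
      using v pencil_size_nonneg by (intro mult_left_mono; simp)+
    then show "norm (mat v + \<eta> (W v)) \<le> K" using norm_inverse_le[of v "W v"] unfolding K_def by linarith
  qed
  show ?thesis
    using dyson_stability[OF K1] that sol bounds by (metis less_imp_le)
qed

text \<open>The a priori bound on \<open>|u| \<parallel>W(u)\<parallel>\<close> makes the stability constant uniform near a given \<open>u\<close>.\<close>

lemma W_continuous: "continuous_on {u. 0 < Re u} W"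
  unfolding continuous_on_iff
proof (intro ballI allI impI)
  fix u e assume "u \<in> {u. 0 < Re u}" and e: "(e::real) > 0"
  then have u: "0 < Re u" by simp
  then have u0: "cmod u > 0" by (auto simp: zero_less_norm_iff)
  define k where "k = 8 * real CARD('n) / cmod u"
  obtain C where C: "0 < C" and stab: "\<And>u' v. \<lbrakk>0 < Re u'; 0 < Re v; norm (W u') \<le> k; norm (W v) \<le> k;
      cmod u' \<le> 2 * cmod u; cmod v \<le> 2 * cmod u\<rbrakk>
    \<Longrightarrow> Re u' * norm (W u' - W v) \<le> C * rtr (W u') * cmod (u' - v)"
    using W_stability[of k "2 * cmod u"] by metis
  have bound: "norm (W v) \<le> k" if v: "0 < Re v" "cmod v \<ge> cmod u / 2" for v
  proof -
    have "cmod u / 2 * norm (W v) \<le> cmod v * norm (W v)" using v by (intro mult_right_mono) auto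
    also have "\<dots> \<le> 4 * real CARD('n)" using v by (intro dyson_bound sol) auto
    finally show ?thesis using u0 by (simp add: k_def field_simps)
  qed
  define M where "M = C * \<bar>rtr (W u)\<bar> / Re u + 1"
  have M: "M > 0" using C u by (simp add: M_def add_nonneg_pos)
  show "\<exists>d>0. \<forall>v\<in>{u. 0 < Re u}. dist v u < d \<longrightarrow> dist (W v) (W u) < e"
  proof (intro exI[of _ "min (cmod u / 2) (e / M)"] conjI ballI impI)
    show "0 < min (cmod u / 2) (e / M)" using u0 e M by simp
    fix v assume v: "v \<in> {u. 0 < Re u}" "dist v u < min (cmod u / 2) (e / M)"
    have "cmod u \<le> cmod v + cmod (v - u)" "cmod v \<le> cmod u + cmod (v - u)"
      by (metis norm_triangle_sub norm_minus_commute, metis norm_triangle_sub)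
    then have bv: "cmod v \<ge> cmod u / 2" "cmod v \<le> 2 * cmod u"
      using v(2) by (simp_all add: dist_norm)
    have "Re u * norm (W u - W v) \<le> C * rtr (W u) * cmod (u - v)"
      using stab[of u v] bound[of u] bound[OF _ bv(1)] bv(2) u v u0 by simp
    also have "\<dots> \<le> C * \<bar>rtr (W u)\<bar> * cmod (u - v)"
      using C by (intro mult_right_mono mult_left_mono) auto
    finally have "norm (W u - W v) \<le> (M - 1) * cmod (u - v)"
      using u by (simp add: M_def field_simps)
    also have "\<dots> \<le> M * cmod (u - v)" by (intro mult_right_mono) auto
    also have "\<dots> < M * (e / M)"
      using v(2) M by (intro mult_strict_left_mono) (auto simp: dist_norm norm_minus_commute)
    finally show "dist (W v) (W u) < e" using M by (simp add: dist_norm norm_minus_commute)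
  qed
qed

text \<open>Near the origin boundedness spreads from the real axis: as long as \<open>W\<close> stays within distance
  \<open>1\<close> of its value at a small real point, stability keeps it within distance \<open>1/2\<close>.\<close>

lemma W_bounded_near_zero:
  obtains K \<rho> where "0 < \<rho>" and "\<And>u. \<lbrakk>0 < Re u; cmod u < \<rho>\<rbrakk> \<Longrightarrow> norm (W u) \<le> K"
proof -
  obtain K0 where K0: "\<And>t V. \<lbrakk>0 < t; t \<le> 1; dyson (complex_of_real t) V; adjoint_mat V = V\<rbrakk> \<Longrightarrow> norm V \<le> K0"
    using hermitian_solution_bounded by blast
  have real_bound: "norm (W (complex_of_real t)) \<le> K0" if "0 < t" "t \<le> 1" for t
    using that by (intro K0[of t] sol W_hermitian) auto
  have K00: "0 \<le> K0" using order_trans[OF norm_ge_zero real_bound[of 1]] by simp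
  define K where "K = 1 + real CARD('n) * 2 + pencil_size * (K0 + 1)"
  have K1: "1 \<le> K" using K00 pencil_size_nonneg by (simp add: K_def)
  obtain C where C: "0 < C" and stab: "\<And>u v. \<lbrakk>0 < Re u; 0 < Re v; norm (W u) \<le> K0 + 1; norm (W v) \<le> K0 + 1;
      cmod u \<le> 2; cmod v \<le> 2\<rbrakk> \<Longrightarrow> (rtr (W u) + rtr (W v))\<^sup>2 * norm (W u - W v) \<le> C * cmod (u - v)"
    using W_stability[of "K0 + 1" 2] by metis
  \<comment> \<open>small enough for stability to keep \<open>W\<close> within \<open>1/2\<close> of its value at \<open>\<epsilon>\<close>\<close>
  define \<delta> where "\<delta> = min 1 (1 / (2 * C * K\<^sup>2))"
  have \<delta>: "0 < \<delta>" "\<delta> \<le> 1" "C * K\<^sup>2 * \<delta> \<le> 1/2"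
  proof -
    have "C * K\<^sup>2 * \<delta> \<le> C * K\<^sup>2 * (1 / (2 * C * K\<^sup>2))"
      using C by (intro mult_left_mono) (auto simp: \<delta>_def)
    then show "C * K\<^sup>2 * \<delta> \<le> 1/2" using C K1 by simp
  qed (use C K1 in \<open>auto simp: \<delta>_def\<close>)
  define \<epsilon> where "\<epsilon> = complex_of_real (\<delta> / 2)"
  have \<epsilon>: "0 < Re \<epsilon>" "cmod \<epsilon> = \<delta> / 2" "norm (W \<epsilon>) \<le> K0" "dyson \<epsilon> (W \<epsilon>)"
    using \<delta> real_bound[of "\<delta> / 2"] sol[of \<epsilon>] by (auto simp: \<epsilon>_def)
  have xe: "1 / K \<le> rtr (W \<epsilon>)"
  proof -
    have "W \<epsilon> ** (mat \<epsilon> + \<eta> (W \<epsilon>)) = mat 1" using \<epsilon>(4) by (simp add: dyson_def)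
    then have "1 \<le> norm (W \<epsilon>) * norm (mat \<epsilon> + \<eta> (W \<epsilon>))"
      using norm_matrix_mult_le[of "W \<epsilon>" "mat \<epsilon> + \<eta> (W \<epsilon>)"] norm_mat_one(2)[where 'n = 'n] by simp
    also have "\<dots> \<le> norm (W \<epsilon>) * K"
    proof (rule mult_left_mono)
      have "real CARD('n) * cmod \<epsilon> \<le> real CARD('n) * 2" "pencil_size * norm (W \<epsilon>) \<le> pencil_size * (K0 + 1)"
        using \<epsilon> \<delta> pencil_size_nonneg by (intro mult_left_mono; simp)+
      then show "norm (mat \<epsilon> + \<eta> (W \<epsilon>)) \<le> K" using norm_inverse_le[of \<epsilon> "W \<epsilon>"] unfolding K_def by linarith
    qed simp
    finally have "1 / K \<le> norm (W \<epsilon>)" using K1 by (simp add: field_simps)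
    moreover have "rp (W \<epsilon>) = W \<epsilon>"
      using W_hermitian[of "\<delta> / 2"] \<delta> by (simp add: rp_def \<epsilon>_def scaleR_2[symmetric])
    then have "norm (W \<epsilon>) \<le> rtr (W \<epsilon>)"
      using psd_norm_le_rtr(1)[OF dyson_psd(1)[OF \<epsilon>(4)]] \<epsilon>(1) by simp
    ultimately show ?thesis by simp
  qed
  have close: "norm (W \<epsilon> - W v) \<le> 1/2" if v: "0 < Re v" "cmod v \<le> 2" "norm (W v) \<le> K0 + 1" "cmod (\<epsilon> - v) \<le> \<delta>" for v
  proof -
    have "(rtr (W \<epsilon>) + rtr (W v))\<^sup>2 * norm (W \<epsilon> - W v) \<le> C * cmod (\<epsilon> - v)"
      using stab[of \<epsilon> v] v \<epsilon> \<delta> by simp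
    moreover have "(1 / K)\<^sup>2 \<le> (rtr (W \<epsilon>) + rtr (W v))\<^sup>2"
    proof (rule power_mono)
      have "0 \<le> rtr (W v)" using rtr_nonneg[OF dyson_psd(1)[OF sol[OF v(1)]]] v(1) by (simp add: rtr_rp)
      then show "1 / K \<le> rtr (W \<epsilon>) + rtr (W v)" using xe by simp
    qed (use K1 in simp)
    then have "(1 / K)\<^sup>2 * norm (W \<epsilon> - W v) \<le> (rtr (W \<epsilon>) + rtr (W v))\<^sup>2 * norm (W \<epsilon> - W v)"
      by (intro mult_right_mono) auto
    ultimately have "(1 / K)\<^sup>2 * norm (W \<epsilon> - W v) \<le> C * cmod (\<epsilon> - v)" by simp
    also have "\<dots> \<le> C * \<delta>" using v C by (intro mult_left_mono) auto
    finally have "norm (W \<epsilon> - W v) \<le> C * K\<^sup>2 * \<delta>" using K1 by (simp add: field_simps)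
    then show ?thesis using \<delta>(3) by simp
  qed
  show ?thesis
  proof (rule that[of "\<delta> / 2" "K0 + 1"])
    show "0 < \<delta> / 2" using \<delta> by simp
    fix u assume u: "0 < Re u" "cmod u < \<delta> / 2"
    define \<gamma> where "\<gamma> s = \<epsilon> + complex_of_real s * (u - \<epsilon>)" for s
    have \<gamma>: "0 < Re (\<gamma> s)" "cmod (\<epsilon> - \<gamma> s) \<le> \<delta>" "cmod (\<gamma> s) \<le> 2" if s: "s \<in> {0..1}" for s
    proof -
      have "Re (\<gamma> s) = (1 - s) * Re \<epsilon> + s * Re u" by (simp add: \<gamma>_def algebra_simps)
      moreover have "0 < (1 - s) * Re \<epsilon> + s * Re u"
        using s u(1) \<epsilon>(1) by (cases "s = 0") (auto intro!: add_nonneg_pos mult_nonneg_nonneg mult_pos_pos)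
      ultimately show "0 < Re (\<gamma> s)" by simp
      have "cmod (\<epsilon> - \<gamma> s) = \<bar>s\<bar> * cmod (u - \<epsilon>)" by (simp add: \<gamma>_def norm_mult)
      also have "\<dots> \<le> 1 * cmod (u - \<epsilon>)" using s by (intro mult_right_mono) auto
      also have "\<dots> \<le> cmod u + cmod \<epsilon>" using norm_triangle_ineq4[of u \<epsilon>] by simp
      finally show 1: "cmod (\<epsilon> - \<gamma> s) \<le> \<delta>" using u \<epsilon> by simp
      have "cmod (\<gamma> s) \<le> cmod \<epsilon> + cmod (\<epsilon> - \<gamma> s)" by (metis norm_triangle_sub norm_minus_commute)
      then show "cmod (\<gamma> s) \<le> 2" using 1 \<epsilon> \<delta> by simp
    qed
    define f where "f s = norm (W \<epsilon> - W (\<gamma> s))" for s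
    have "continuous_on {0..1} \<gamma>" unfolding \<gamma>_def by (intro continuous_intros)
    then have "continuous_on {0..1} (\<lambda>s. W (\<gamma> s))"
      by (rule continuous_on_compose2[OF W_continuous]) (use \<gamma> in auto)
    then have cf: "continuous_on {0..1} f" unfolding f_def by (intro continuous_intros)
    have "f 1 < 1"
    proof (rule ccontr)
      assume "\<not> f 1 < 1"
      moreover have "f 0 = 0" by (simp add: f_def \<gamma>_def)
      ultimately obtain s where s: "0 \<le> s" "s \<le> 1" "f s = 1"
        using IVT'[of f 0 1 1] cf by auto
      have "norm (W (\<gamma> s)) \<le> norm (W \<epsilon>) + norm (W \<epsilon> - W (\<gamma> s))"
        by (metis norm_triangle_sub norm_minus_commute)
      then have "norm (W (\<gamma> s)) \<le> K0 + 1" using s(3) \<epsilon>(3) by (simp add: f_def)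
      then have "f s \<le> 1/2" unfolding f_def using \<gamma>[of s] s by (intro close) auto
      then show False using s(3) by simp
    qed
    then have "norm (W \<epsilon> - W u) < 1" by (simp add: f_def \<gamma>_def)
    moreover have "norm (W u) \<le> norm (W \<epsilon>) + norm (W \<epsilon> - W u)"
      by (metis norm_triangle_sub norm_minus_commute)
    ultimately show "norm (W u) \<le> K0 + 1" using \<epsilon>(3) by simp
  qed
qed

lemma W_bounded:
  obtains K where "\<And>u. 0 < Re u \<Longrightarrow> norm (W u) \<le> K"
proof -
  obtain K \<rho> where \<rho>: "0 < \<rho>" and K: "\<And>u. \<lbrakk>0 < Re u; cmod u < \<rho>\<rbrakk> \<Longrightarrow> norm (W u) \<le> K"
    using W_bounded_near_zero by blast
  have "norm (W u) \<le> max K (4 * real CARD('n) / \<rho>)" if u: "0 < Re u" for u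
  proof (cases "cmod u < \<rho>")
    case True
    then show ?thesis using K[OF u] by simp
  next
    case False
    then have "\<rho> * norm (W u) \<le> cmod u * norm (W u)" by (intro mult_right_mono) auto
    also have "\<dots> \<le> 4 * real CARD('n)" using u by (intro dyson_bound sol) auto
    finally have "norm (W u) \<le> 4 * real CARD('n) / \<rho>" using \<rho> by (simp add: field_simps)
    then show ?thesis by simp
  qed
  then show ?thesis by (rule that)
qed

text \<open>The two stability estimates multiply to \<open>\<parallel>W(u) - W(v)\<parallel>\<^sup>3 (Re u)\<^sup>2 \<le> C |u - v|\<^sup>3\<close>, in which the trace of
  the real part has cancelled.  Moving both points into the half-plane by \<open>|u - v|\<close> turns this into a Hoelder
  bound of exponent \<open>1/3\<close> up to the boundary.\<close>

lemma W_holder: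
  obtains C where "0 \<le> C" and "\<And>u v. \<lbrakk>0 < Re u; 0 < Re v; cmod u \<le> M; cmod v \<le> M\<rbrakk>
    \<Longrightarrow> norm (W u - W v) ^ 3 \<le> C * cmod (u - v)"
proof -
  obtain k where k: "\<And>u. 0 < Re u \<Longrightarrow> norm (W u) \<le> k" using W_bounded by blast
  obtain C where C: "0 < C" and stab: "\<And>u v. \<lbrakk>0 < Re u; 0 < Re v; norm (W u) \<le> k; norm (W v) \<le> k;
      cmod u \<le> 3 * \<bar>M\<bar>; cmod v \<le> 3 * \<bar>M\<bar>\<rbrakk>
    \<Longrightarrow> Re u * norm (W u - W v) \<le> C * rtr (W u) * cmod (u - v) \<and>
      (rtr (W u) + rtr (W v))\<^sup>2 * norm (W u - W v) \<le> C * cmod (u - v)"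
    using W_stability[of k "3 * \<bar>M\<bar>"] by metis
  have cubic: "norm (W u - W v) ^ 3 \<le> C ^ 3 * h"
    if u: "0 < Re u" "0 < Re v" "cmod u \<le> 3 * \<bar>M\<bar>" "cmod v \<le> 3 * \<bar>M\<bar>" and h: "cmod (u - v) \<le> h" "h \<le> Re u" "0 < h"
    for u v h
  proof -
    define z where "z = norm (W u - W v)"
    define x where "x = rtr (W u)"
    define y where "y = rtr (W v)"
    define d where "d = cmod (u - v)"
    have xy: "0 \<le> x" "0 \<le> y"
      using rtr_nonneg[OF dyson_psd(1)[OF sol]] u by (auto simp: x_def y_def rtr_rp less_imp_le)
    have st: "Re u * z \<le> C * x * d" "(x + y)\<^sup>2 * z \<le> C * d"
      using stab[of u v] k[OF u(1)] k[OF u(2)] u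
      by (simp_all add: z_def x_def y_def d_def)
    have z: "0 \<le> z" and d: "0 \<le> d" by (auto simp: z_def d_def)
    have "(h * z)\<^sup>2 \<le> (C * x * d)\<^sup>2"
    proof (rule power_mono)
      show "h * z \<le> C * x * d" using mult_right_mono[OF h(2) z] st(1) by linarith
    qed (use h z in auto)
    then have "(h * z)\<^sup>2 * z \<le> (C * x * d)\<^sup>2 * z" by (intro mult_right_mono z)
    also have "\<dots> = (C * d)\<^sup>2 * (x\<^sup>2 * z)" by (simp add: power_mult_distrib)
    also have "\<dots> \<le> (C * d)\<^sup>2 * ((x + y)\<^sup>2 * z)"
      using xy z by (intro mult_left_mono mult_right_mono power_mono) auto
    also have "\<dots> \<le> (C * d)\<^sup>2 * (C * d)" by (intro mult_left_mono st) simp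
    also have "\<dots> = C ^ 3 * d ^ 3" by (simp add: power2_eq_square power3_eq_cube)
    also have "\<dots> \<le> C ^ 3 * h ^ 3" using C h d by (intro mult_left_mono power_mono) (auto simp: d_def)
    finally have "h\<^sup>2 * z ^ 3 \<le> h\<^sup>2 * (C ^ 3 * h)"
      by (simp add: power2_eq_square power3_eq_cube ac_simps)
    then show ?thesis using h(3) by (simp add: z_def)
  qed
  show ?thesis
  proof (rule that[of "27 * C ^ 3"])
    show "0 \<le> 27 * C ^ 3" using C by simp
    fix u v assume u: "0 < Re u" "0 < Re v" "cmod u \<le> M" "cmod v \<le> M"
    show "norm (W u - W v) ^ 3 \<le> 27 * C ^ 3 * cmod (u - v)"
    proof (cases "u = v")
      case False
      define h where "h = cmod (u - v)"
      have h: "0 < h" "h \<le> 2 * M" using False norm_triangle_ineq4[of u v] u by (auto simp: h_def)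
      define u' where "u' = u + complex_of_real h"
      define v' where "v' = v + complex_of_real h"
      have M: "\<bar>M\<bar> = M" using h by simp
      have b: "0 < Re u'" "0 < Re v'" "h \<le> Re u'" "h \<le> Re v'" "cmod u' \<le> 3 * \<bar>M\<bar>" "cmod v' \<le> 3 * \<bar>M\<bar>"
        "cmod u \<le> 3 * \<bar>M\<bar>" "cmod v \<le> 3 * \<bar>M\<bar>"
        using u h norm_triangle_ineq[of u "complex_of_real h"] norm_triangle_ineq[of v "complex_of_real h"]
        unfolding M by (auto simp: u'_def v'_def)
      have d: "cmod (u' - u) \<le> h" "cmod (v' - v) \<le> h" "cmod (u' - v') \<le> h"
        using h(1) by (auto simp: u'_def v'_def h_def)
      define a where "a = norm (W u' - W u)"
      define b' where "b' = norm (W u' - W v')"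
      define c where "c = norm (W v' - W v)"
      have abc: "a ^ 3 \<le> C ^ 3 * h" "b' ^ 3 \<le> C ^ 3 * h" "c ^ 3 \<le> C ^ 3 * h"
        unfolding a_def b'_def c_def using b d u h by (auto intro!: cubic)
      have "norm (W u - W v) \<le> a + b' + c"
        unfolding a_def b'_def c_def
        using norm_triangle_ineq[of "W u - W u'" "W u' - W v'"] norm_triangle_ineq[of "W u - W u' + (W u' - W v')" "W v' - W v"]
        by (simp add: norm_minus_commute)
      also have "\<dots> \<le> 3 * max a (max b' c)" by simp
      finally have "norm (W u - W v) ^ 3 \<le> (3 * max a (max b' c)) ^ 3" by (intro power_mono) auto
      also have "\<dots> = 27 * max a (max b' c) ^ 3" by (simp add: power_mult_distrib)
      also have "\<dots> \<le> 27 * (C ^ 3 * h)" using abc by (auto simp: max_def)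
      finally show ?thesis by (simp add: h_def)
    qed simp
  qed
qed

lemma W_uniformly_continuous: "uniformly_continuous_on {u. 0 < Re u \<and> cmod u \<le> M} W"
  unfolding uniformly_continuous_on_def
proof (intro allI impI)
  fix e :: real assume e: "e > 0"
  obtain C where C: "0 \<le> C" and hol: "\<And>u v. \<lbrakk>0 < Re u; 0 < Re v; cmod u \<le> M; cmod v \<le> M\<rbrakk>
    \<Longrightarrow> norm (W u - W v) ^ 3 \<le> C * cmod (u - v)"
    using W_holder by blast
  show "\<exists>d>0. \<forall>u\<in>{u. 0 < Re u \<and> cmod u \<le> M}. \<forall>v\<in>{u. 0 < Re u \<and> cmod u \<le> M}. dist v u < d \<longrightarrow> dist (W v) (W u) < e"
  proof (intro exI[of _ "e ^ 3 / (C + 1)"] conjI ballI impI)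
    show "0 < e ^ 3 / (C + 1)" using e C by simp
    fix u v assume uv: "u \<in> {u. 0 < Re u \<and> cmod u \<le> M}" "v \<in> {u. 0 < Re u \<and> cmod u \<le> M}"
      and d: "dist v u < e ^ 3 / (C + 1)"
    have "norm (W v - W u) ^ 3 \<le> C * cmod (v - u)" using uv by (intro hol) auto
    also have "\<dots> \<le> (C + 1) * cmod (v - u)" by (intro mult_right_mono) auto
    also have "\<dots> < e ^ 3" using d C by (simp add: dist_norm field_simps)
    finally show "dist (W v) (W u) < e"
      using e power_less_imp_less_base[of "norm (W v - W u)" 3 e] by (simp add: dist_norm)
  qed
qed

end

section \<open>Squares and norms in C*-algebras\<close>

lemma scaleC_one [simp]: "scaleC 1 x = (x :: 'a::cstar_algebra)"
  using scaleC_of_real[of 1 x] by simp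

lemma scaleC_zero_left [simp]: "scaleC 0 x = (0 :: 'a::cstar_algebra)"
  using scaleC_of_real[of 0 x] by simp

lemma scaleC_zero_right [simp]: "scaleC c 0 = (0 :: 'a::cstar_algebra)"
  using scaleC_add_right[of c 0 0] by simp

lemma scaleC_minus_one: "scaleC (- 1) x = - (x :: 'a::cstar_algebra)"
  using scaleC_of_real[of "-1" x] by simp

lemma scaleC_minus_right: "scaleC c (- x) = - scaleC c (x :: 'a::cstar_algebra)"
  by (metis mult.commute scaleC_minus_one scaleC_scaleC)

lemma scaleC_minus_left: "scaleC (- c) x = - scaleC c (x :: 'a::cstar_algebra)"
  by (metis mult_minus1 scaleC_minus_one scaleC_scaleC)

lemma scaleC_diff_right: "scaleC c (x - y) = scaleC c x - scaleC c (y :: 'a::cstar_algebra)"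
  using scaleC_add_right[of c x "- y"] by (simp add: scaleC_minus_right)

lemma scaleC_sum_left: "scaleC (\<Sum>i\<in>I. f i) x = (\<Sum>i\<in>I. scaleC (f i) (x :: 'a::cstar_algebra))"
  by (induction I rule: infinite_finite_induct) (auto simp: scaleC_add_left)

lemma star_zero [simp]: "star 0 = (0 :: 'a::cstar_algebra)"
  using star_add[of 0 0] by simp

lemma star_minus: "star (- x) = - star (x :: 'a::cstar_algebra)"
  using star_add[of x "- x"] by (simp add: eq_neg_iff_add_eq_0 add.commute)

lemma star_diff: "star (x - y) = star x - star (y :: 'a::cstar_algebra)"
  using star_add[of x "- y"] by (simp add: star_minus)

lemma star_scaleR: "star (k *\<^sub>R x) = k *\<^sub>R star (x :: 'a::cstar_algebra)"
  by (metis complex_cnj_complex_of_real scaleC_of_real star_scaleC)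

lemma star_one [simp]: "star 1 = (1 :: 'a::cstar_algebra)"
  by (metis mult.left_neutral mult.right_neutral star_mult star_star)

lemma star_sum: "star (\<Sum>i\<in>I. f i) = (\<Sum>i\<in>I. star (f i :: 'a::cstar_algebra))"
  by (induction I rule: infinite_finite_induct) (auto simp: star_add)

lemma norm_star [simp]: "norm (star x) = norm (x :: 'a::cstar_algebra)"
proof -
  have le: "norm y \<le> norm (star y)" for y :: 'a
  proof (cases "y = 0")
    case False
    have "norm y * norm y \<le> norm (star y) * norm y"
      using norm_mult_ineq[of "star y" y] norm_star_mult_self[of y] by (simp add: power2_eq_square)
    then show ?thesis using False by simp
  qed simp
  show ?thesis using le[of x] le[of "star x"] by (simp add: star_star)
qed

lemma norm_scaleC: "norm (scaleC c x) = cmod c * norm (x :: 'a::cstar_algebra)"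
proof -
  have "star (scaleC c x) * scaleC c x = scaleC (cnj c * c) (star x * x)"
    by (simp add: star_scaleC mult_scaleC_left mult_scaleC_right scaleC_scaleC mult.commute)
  also have "cnj c * c = complex_of_real ((cmod c)\<^sup>2)" by (metis complex_norm_square mult.commute)
  finally have "(norm (scaleC c x))\<^sup>2 = (cmod c * norm x)\<^sup>2"
    by (metis abs_of_nonneg norm_scaleR norm_star_mult_self power_mult_distrib scaleC_of_real zero_le_power2)
  then show ?thesis by simp
qed

lemma bounded_linear_star: "bounded_linear (star :: 'a::cstar_algebra \<Rightarrow> 'a)"
  by (rule bounded_linear_intro[of _ 1]) (auto simp: star_add star_scaleR)

lemmas continuous_on_star = bounded_linear.continuous_on[OF bounded_linear_star]

text \<open>The square root as a fixed point: \<open>w = 1 - v\<close> solves \<open>w\<^sup>2 = 1 - h\<close> as soon as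
  \<open>v = (h + v\<^sup>2)/2\<close>, and this map is a contraction of the ball of radius \<open>1 - \<surd>(1 - \<parallel>h\<parallel>)\<close>.\<close>

lemma sqrt_one_minus:
  fixes h :: "'a::cstar_algebra"
  assumes h: "star h = h" "norm h < 1"
  obtains w where "star w = w" and "w * w = 1 - h" and "\<And>y. y * h = h * y \<Longrightarrow> y * w = w * y"
proof -
  define \<rho> where "\<rho> = 1 - sqrt (1 - norm h)"
  have \<rho>: "0 \<le> \<rho>" "\<rho> < 1" and fix\<rho>: "(norm h + \<rho> * \<rho>) / 2 = \<rho>"
  proof -
    define q where "q = sqrt (1 - norm h)"
    have q: "norm h = 1 - q * q" using h(2) by (simp add: q_def)
    have q1: "0 < q" "q \<le> 1" using h(2) by (auto simp: q_def)
    then show "0 \<le> \<rho>" "\<rho> < 1" by (simp_all add: \<rho>_def flip: q_def)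
    show "(norm h + \<rho> * \<rho>) / 2 = \<rho>" unfolding q by (simp add: \<rho>_def field_simps flip: q_def)
  qed
  define S where "S = {v. star v = v} \<inter> cball 0 \<rho> \<inter> (\<Inter>y\<in>{y. y * h = h * y}. {v. y * v = v * y})"
  define f where "f v = (1/2) *\<^sub>R (h + v * v)" for v
  have "closed S"
    unfolding S_def by (intro closed_Int closed_INT closed_Collect_eq closed_cball ballI continuous_intros continuous_on_star)
  then have "complete S" by (simp add: complete_eq_closed)
  moreover have "0 \<in> S" using \<rho> by (simp add: S_def)
  then have "S \<noteq> {}" by blast
  moreover have "f ` S \<subseteq> S"
  proof (clarify)
    fix v assume v: "v \<in> S"
    then have nv: "norm v \<le> \<rho>" and sv: "star v = v" and cv: "\<And>y. y * h = h * y \<Longrightarrow> y * v = v * y"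
      by (auto simp: S_def)
    have "norm (f v) \<le> (norm h + norm v * norm v) / 2"
      using norm_triangle_ineq[of h "v * v"] norm_mult_ineq[of v v] by (simp add: f_def)
    also have "\<dots> \<le> (norm h + \<rho> * \<rho>) / 2" using nv \<rho> by (intro divide_right_mono add_left_mono mult_mono) auto
    finally have "norm (f v) \<le> \<rho>" by (simp add: fix\<rho>)
    moreover have "star (f v) = f v" by (simp add: f_def star_scaleR star_add star_mult sv h)
    moreover have "y * f v = f v * y" if y: "y * h = h * y" for y
    proof -
      have "y * (v * v) = (v * v) * y" by (metis cv[OF y] mult.assoc)
      then show ?thesis by (simp add: f_def y distrib_left distrib_right)
    qed
    ultimately show "f v \<in> S" by (simp add: S_def)
  qed
  moreover have "\<forall>u\<in>S. \<forall>v\<in>S. dist (f u) (f v) \<le> \<rho> * dist u v"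
  proof (intro ballI)
    fix u v assume "u \<in> S" "v \<in> S"
    then have n: "norm u \<le> \<rho>" "norm v \<le> \<rho>" by (auto simp: S_def)
    have "f u - f v = (1/2) *\<^sub>R (u * (u - v) + (u - v) * v)"
      by (simp add: f_def algebra_simps flip: scaleR_diff_right)
    then have "norm (f u - f v) = (1/2) * norm (u * (u - v) + (u - v) * v)" by simp
    also have "\<dots> \<le> (1/2) * (norm u * norm (u - v) + norm (u - v) * norm v)"
      by (intro mult_left_mono norm_triangle_le add_mono norm_mult_ineq) auto
    also have "\<dots> \<le> (1/2) * (\<rho> * norm (u - v) + norm (u - v) * \<rho>)"
      using n by (intro mult_left_mono add_mono mult_right_mono) auto
    finally show "dist (f u) (f v) \<le> \<rho> * dist u v" by (simp add: dist_norm)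
  qed
  ultimately obtain v where v: "v \<in> S" "f v = v"
    using Banach_fix[of S \<rho> f] \<rho> by (metis image_subset_iff)
  have "2 *\<^sub>R v = 2 *\<^sub>R f v" using v(2) by simp
  then have vv: "v + v = h + v * v" by (simp add: f_def scaleR_2)
  show ?thesis
  proof (rule that[of "1 - v"])
    show "star (1 - v) = 1 - v" using v(1) by (simp add: star_diff S_def)
    have "(1 - v) * (1 - v) = 1 - (v + v) + v * v" by (simp add: algebra_simps)
    then show "(1 - v) * (1 - v) = 1 - h" by (simp add: vv)
    fix y assume "y * h = h * y"
    then show "y * (1 - v) = (1 - v) * y" using v(1) by (simp add: S_def algebra_simps)
  qed
qed

text \<open>The element \<open>h + i v\<close> is a multiple of a unitary, so its norm is known, and it bounds both parts.\<close>

lemma unitary_parts: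
  fixes h v :: "'a::cstar_algebra"
  assumes "star h = h" "star v = v" "h * v = v * h" and sum: "h * h + v * v = m *\<^sub>R 1" and "0 \<le> m"
  shows "(norm h)\<^sup>2 \<le> m" "(norm v)\<^sup>2 \<le> m"
proof -
  define u where "u = h + scaleC \<i> v"
  have su: "star u = h - scaleC \<i> v"
    by (simp add: u_def star_add star_scaleC assms scaleC_minus_left)
  have "star u * u = h * h + v * v"
    unfolding su by (simp add: u_def algebra_simps mult_scaleC_left mult_scaleC_right scaleC_scaleC assms(3) scaleC_minus_one scaleC_diff_right scaleC_add_right)
  then have u2: "(norm u)\<^sup>2 = m" using assms(5) by (simp add: norm_star_mult_self[symmetric] sum)
  have "2 * norm h = norm (u + star u)" unfolding su by (simp add: u_def flip: scaleR_2)
  also have "\<dots> \<le> 2 * norm u" using norm_triangle_ineq[of u "star u"] by simp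
  finally have "(norm h)\<^sup>2 \<le> (norm u)\<^sup>2" by (intro power_mono) auto
  then show "(norm h)\<^sup>2 \<le> m" by (simp add: u2)
  have "u - star u = 2 *\<^sub>R scaleC \<i> v" unfolding su by (simp add: u_def scaleR_2)
  then have "2 * norm v = norm (u - star u)" by (simp add: norm_scaleC)
  also have "\<dots> \<le> 2 * norm u" using norm_triangle_ineq4[of u "star u"] by simp
  finally have "(norm v)\<^sup>2 \<le> (norm u)\<^sup>2" by (intro power_mono) auto
  then show "(norm v)\<^sup>2 \<le> m" by (simp add: u2)
qed

text \<open>Positivity expressed by the norm alone.  In this form sums are immediate, and positive elements
  have square roots up to an arbitrarily small shift.\<close>

definition cpos :: "'a::cstar_algebra \<Rightarrow> bool" where
  "cpos g \<longleftrightarrow> star g = g \<and> (\<exists>t\<ge>0. norm (t *\<^sub>R 1 - g) \<le> t)"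

lemma cpos_zero: "cpos 0"
  unfolding cpos_def by (auto intro: exI[of _ 0])

lemma cpos_add:
  assumes "cpos g" "cpos h"
  shows "cpos (g + h)"
proof -
  obtain s t where "0 \<le> s" "norm (s *\<^sub>R 1 - g) \<le> s" "0 \<le> t" "norm (t *\<^sub>R 1 - h) \<le> t"
    using assms by (auto simp: cpos_def)
  moreover have "(s + t) *\<^sub>R 1 - (g + h) = (s *\<^sub>R 1 - g) + (t *\<^sub>R 1 - h)" by (simp add: algebra_simps)
  ultimately have "norm ((s + t) *\<^sub>R 1 - (g + h)) \<le> s + t" "0 \<le> s + t"
    by (metis add_mono norm_triangle_le, simp)
  then show ?thesis using assms by (auto simp: cpos_def star_add)
qed

lemma cpos_sum: "(\<And>i. i \<in> I \<Longrightarrow> cpos (f i)) \<Longrightarrow> cpos (\<Sum>i\<in>I. f i)"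
  by (induction I rule: infinite_finite_induct) (auto intro: cpos_add cpos_zero)

lemma cpos_square:
  fixes h :: "'a::cstar_algebra"
  assumes h: "star h = h"
  shows "cpos (h * h)"
proof -
  \<comment> \<open>with \<open>k = h/m\<close> of norm below \<open>1\<close> and \<open>1 - k\<^sup>2 = w\<^sup>2\<close>, the element \<open>k + i w\<close> is unitary, so \<open>\<parallel>1 - k\<^sup>2\<parallel> \<le> 1\<close>\<close>
  define m where "m = norm h + 1"
  have m: "m > 0" by (simp add: m_def add_nonneg_pos)
  define k where "k = (1 / m) *\<^sub>R h"
  have k: "star k = k" "norm k < 1" using h m by (auto simp: k_def star_scaleR m_def)
  have "norm (k * k) \<le> norm k * norm k" by (rule norm_mult_ineq)
  also have "\<dots> < 1 * 1" using k(2) by (intro mult_strict_mono') auto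
  finally have "norm (k * k) < 1" by simp
  then obtain w where w: "star w = w" "w * w = 1 - k * k" "k * w = w * k"
    using sqrt_one_minus[of "k * k"] k(1) by (metis mult.assoc star_mult)
  have "(norm w)\<^sup>2 \<le> 1" using unitary_parts(2)[of k w 1] k w by simp
  moreover have "norm (w * w) = (norm w)\<^sup>2" by (metis norm_star_mult_self w(1))
  ultimately have "norm (1 - k * k) \<le> 1" using w by simp
  then have "m\<^sup>2 * norm (1 - k * k) \<le> m\<^sup>2 * 1" by (intro mult_left_mono) auto
  moreover have "m\<^sup>2 *\<^sub>R 1 - h * h = m\<^sup>2 *\<^sub>R (1 - k * k)"
    using m by (simp add: k_def scaleR_diff_right power2_eq_square)
  ultimately have "norm (m\<^sup>2 *\<^sub>R 1 - h * h) \<le> m\<^sup>2" by simp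
  then show ?thesis using h by (auto simp: cpos_def star_mult intro!: exI[of _ "m\<^sup>2"])
qed

lemma cpos_sqrt:
  fixes g :: "'a::cstar_algebra"
  assumes "cpos g" "0 < e"
  obtains v where "star v = v" and "v * v = g + e *\<^sub>R 1" and "\<And>y. y * g = g * y \<Longrightarrow> y * v = v * y"
proof -
  obtain t where t: "0 \<le> t" "norm (t *\<^sub>R 1 - g) \<le> t" and sg: "star g = g"
    using assms by (auto simp: cpos_def)
  define k where "k = (1 / (t + e)) *\<^sub>R (t *\<^sub>R 1 - g)"
  have te: "0 < t + e" using t assms by simp
  have "star k = k" by (simp add: k_def star_scaleR star_diff sg)
  moreover have "norm k < 1" using t te assms by (simp add: k_def)
  ultimately obtain w where w: "star w = w" "w * w = 1 - k" "\<And>y. y * k = k * y \<Longrightarrow> y * w = w * y"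
    using sqrt_one_minus by blast
  show ?thesis
  proof (rule that[of "sqrt (t + e) *\<^sub>R w"])
    show "star (sqrt (t + e) *\<^sub>R w) = sqrt (t + e) *\<^sub>R w" by (simp add: star_scaleR w)
    show "sqrt (t + e) *\<^sub>R w * sqrt (t + e) *\<^sub>R w = g + e *\<^sub>R 1"
    proof -
      have "(t + e) *\<^sub>R k = t *\<^sub>R 1 - g" using te by (simp add: k_def)
      then have "(t + e) *\<^sub>R (1 - k) = g + e *\<^sub>R 1" by (simp add: scaleR_diff_right scaleR_add_left)
      then show ?thesis using te by (simp add: w)
    qed
    fix y assume "y * g = g * y"
    then have "y * k = k * y" by (simp add: k_def algebra_simps)
    then show "y * sqrt (t + e) *\<^sub>R w = sqrt (t + e) *\<^sub>R w * y" by (simp add: w(3))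
  qed
qed

text \<open>With \<open>M\<close> the norm of the sum, \<open>M - h\<^sub>j\<^sup>2\<close> is a sum of positive elements. Up to a shift by \<open>e\<close> it
  is \<open>v\<^sup>2\<close> with \<open>v\<close> commuting with \<open>h\<^sub>j\<close>, so that \<open>h\<^sub>j\<^sup>2 + v\<^sup>2 = M + e\<close>.\<close>

lemma norm_le_sum_squares:
  fixes h :: "'i \<Rightarrow> 'a::cstar_algebra"
  assumes "finite I" "\<And>i. i \<in> I \<Longrightarrow> star (h i) = h i" "j \<in> I"
  shows "(norm (h j))\<^sup>2 \<le> norm (\<Sum>i\<in>I. h i * h i)"
proof (rule field_le_epsilon)
  fix e :: real assume e: "0 < e"
  define q where "q = (\<Sum>i\<in>I. h i * h i)"
  have sq: "star q = q" using assms(2) by (simp add: q_def star_sum star_mult)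
  have "cpos (norm q *\<^sub>R 1 - q)"
    unfolding cpos_def by (intro conjI exI[of _ "norm q"]) (auto simp: star_diff star_scaleR sq)
  moreover have "cpos (\<Sum>i\<in>I - {j}. h i * h i)" using assms(2) by (intro cpos_sum cpos_square) auto
  ultimately have "cpos ((norm q *\<^sub>R 1 - q) + (\<Sum>i\<in>I - {j}. h i * h i))" by (rule cpos_add)
  also have "(norm q *\<^sub>R 1 - q) + (\<Sum>i\<in>I - {j}. h i * h i) = norm q *\<^sub>R 1 - h j * h j"
    unfolding q_def using assms(1,3) by (simp add: sum.remove[of I j])
  finally have "cpos (norm q *\<^sub>R 1 - h j * h j)" .
  then obtain v where v: "star v = v" "v * v = norm q *\<^sub>R 1 - h j * h j + e *\<^sub>R 1"
    "h j * (norm q *\<^sub>R 1 - h j * h j) = (norm q *\<^sub>R 1 - h j * h j) * h j \<Longrightarrow> h j * v = v * h j"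
    using cpos_sqrt[OF _ e] by blast
  have "h j * v = v * h j" by (rule v(3)) (simp add: algebra_simps)
  then have "(norm (h j))\<^sup>2 \<le> norm q + e"
    using v e assms by (intro unitary_parts(1)[of "h j" v]) (auto simp: scaleR_add_left)
  then show "(norm (h j))\<^sup>2 \<le> norm (\<Sum>i\<in>I. h i * h i) + e" by (simp add: q_def)
qed

lemma self_adjoint_parts:
  fixes a :: "'a::cstar_algebra"
  obtains x y where "star x = x" "star y = y" "a = x + scaleC \<i> y" "norm x \<le> norm a" "norm y \<le> norm a"
proof -
  define x where "x = (1/2) *\<^sub>R (a + star a)"
  define y where "y = scaleC (- \<i> / 2) (a - star a)"
  have "star x = x" by (simp add: x_def star_scaleR star_add star_star add.commute)
  moreover have "star y = y"
    by (simp add: y_def star_scaleC star_diff star_star scaleC_diff_right scaleC_minus_left)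
  moreover have "a = x + scaleC \<i> y"
  proof -
    have "scaleC \<i> y = (1/2) *\<^sub>R (a - star a)"
      using scaleC_of_real[of "1/2" "a - star a"] by (simp add: y_def scaleC_scaleC)
    moreover have "x + (1/2) *\<^sub>R (a - star a) = (1/2) *\<^sub>R (a + a)"
      unfolding x_def by (simp only: flip: scaleR_add_right) simp
    ultimately show ?thesis by (simp flip: scaleR_2)
  qed
  moreover have "norm x \<le> norm a" using norm_triangle_ineq[of a "star a"] by (simp add: x_def)
  moreover have "norm y \<le> norm a" using norm_triangle_ineq4[of a "star a"] by (simp add: y_def norm_scaleC)
  ultimately show ?thesis by (rule that)
qed

text \<open>If \<open>a = x + i y\<close> then \<open>a\<^sup>* a + a a\<^sup>* = 2 (x\<^sup>2 + y\<^sup>2)\<close>, a sum of squares of self-adjoint elements.\<close>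

lemma norm_le_sum_star_mult:
  fixes a :: "'i \<Rightarrow> 'a::cstar_algebra"
  assumes "finite I" "j \<in> I"
  shows "(norm (a j))\<^sup>2 \<le> 2 * norm (\<Sum>i\<in>I. star (a i) * a i + a i * star (a i))"
proof -
  have "\<exists>x y. star x = x \<and> star y = y \<and> a i = x + scaleC \<i> y" for i
    using self_adjoint_parts[of "a i"] by metis
  then obtain x y where sx: "\<And>i. star (x i) = x i" and sy: "\<And>i. star (y i) = y i"
    and axy: "\<And>i. a i = x i + scaleC \<i> (y i)"
    by metis
  have sa: "star (a i) = x i - scaleC \<i> (y i)" for i
    by (simp add: axy star_add star_scaleC sx sy scaleC_minus_left)
  have each: "star (a i) * a i + a i * star (a i) = 2 *\<^sub>R (x i * x i + y i * y i)" for i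
    unfolding sa by (subst (1 2) axy)
      (simp add: algebra_simps mult_scaleC_left mult_scaleC_right scaleC_scaleC scaleC_minus_one scaleR_2 scaleC_diff_right scaleC_add_right)
  define h where "h p = (if snd p then x (fst p) else y (fst p))" for p
  define J where "J = I \<times> (UNIV :: bool set)"
  have "(\<Sum>p\<in>J. h p * h p) = (\<Sum>i\<in>I. \<Sum>b\<in>UNIV. h (i, b) * h (i, b))"
    unfolding J_def by (simp add: sum.cartesian_product)
  also have "\<dots> = (\<Sum>i\<in>I. x i * x i + y i * y i)"
    by (simp add: UNIV_bool h_def add.commute)
  finally have J: "(\<Sum>p\<in>J. h p * h p) = (\<Sum>i\<in>I. x i * x i + y i * y i)" .
  have sh: "star (h p) = h p" for p by (simp add: h_def sx sy)
  define s where "s = norm (\<Sum>i\<in>I. x i * x i + y i * y i)"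
  have "(norm (h (j, b)))\<^sup>2 \<le> s" for b
    unfolding s_def J[symmetric] using assms by (intro norm_le_sum_squares sh) (auto simp: J_def)
  from this[of True] this[of False] have xy: "(norm (x j))\<^sup>2 \<le> s" "(norm (y j))\<^sup>2 \<le> s" by (simp_all add: h_def)
  have "norm (a j) \<le> norm (x j) + norm (y j)"
    using norm_triangle_ineq[of "x j" "scaleC \<i> (y j)"] by (simp add: axy norm_scaleC)
  then have "(norm (a j))\<^sup>2 \<le> (norm (x j) + norm (y j))\<^sup>2" by (intro power_mono) auto
  also have "\<dots> \<le> 2 * (norm (x j))\<^sup>2 + 2 * (norm (y j))\<^sup>2"
    using zero_le_power2[of "norm (x j) - norm (y j)"] by (simp add: power2_eq_square algebra_simps)
  also have "\<dots> \<le> 4 * s" using xy by simp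
  also have "4 * s = 2 * norm (\<Sum>i\<in>I. star (a i) * a i + a i * star (a i))"
    by (simp add: each s_def flip: scaleR_sum_right)
  finally show ?thesis .
qed

context cstar_prob_space
begin

lemma state_zero [simp]: "\<phi> 0 = 0"
  using state_add[of 0 0] by simp

lemma state_minus: "\<phi> (- x) = - \<phi> x"
  using state_add[of x "- x"] by (simp add: eq_neg_iff_add_eq_0 add.commute)

lemma state_diff: "\<phi> (x - y) = \<phi> x - \<phi> y"
  using state_add[of x "- y"] by (simp add: state_minus)

lemma state_scaleR: "\<phi> (k *\<^sub>R x) = k * \<phi> x"
  using state_scaleC[of "complex_of_real k" x] by (simp add: scaleC_of_real)

lemma state_sum: "\<phi> (\<Sum>i\<in>I. f i) = (\<Sum>i\<in>I. \<phi> (f i))"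
  by (induction I rule: infinite_finite_induct) (auto simp: state_add)

text \<open>For self-adjoint \<open>h\<close> of norm below \<open>1\<close> the element \<open>1 - h\<close> is a square, so positivity gives
  \<open>\<phi>(h) \<le> 1\<close>.\<close>

lemma state_self_adjoint:
  assumes "star h = h"
  shows "\<phi> h \<in> \<real>" "cmod (\<phi> h) \<le> norm h"
proof -
  have unit: "\<phi> k \<in> \<real> \<and> Re (\<phi> k) \<le> 1" if k: "star k = k" "norm k < 1" for k
  proof -
    obtain w where w: "star w = w" "w * w = 1 - k" using sqrt_one_minus[OF k] .
    have "\<phi> (star w * w) \<in> \<real>\<^sub>\<ge>\<^sub>0" by (rule state_pos)
    then have "1 - \<phi> k \<in> \<real>\<^sub>\<ge>\<^sub>0" by (simp add: w state_diff state_one)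
    then show ?thesis by (auto simp: complex_nonneg_Reals_iff complex_is_Real_iff)
  qed
  have scaled: "\<phi> h \<in> \<real> \<and> \<bar>Re (\<phi> h)\<bar> \<le> norm h + e" if e: "e > 0" for e :: real
  proof -
    define m where "m = norm h + e"
    have m: "m > 0" using e by (simp add: m_def add_nonneg_pos)
    define k where "k = (1 / m) *\<^sub>R h"
    have "star k = k" "norm k < 1" using assms m e by (auto simp: k_def star_scaleR m_def)
    then have "\<phi> k \<in> \<real>" "Re (\<phi> k) \<le> 1" "Re (\<phi> (- k)) \<le> 1"
      using unit[of k] unit[of "- k"] by (auto simp: star_minus)
    moreover have "\<phi> h = m * \<phi> k" using m by (simp add: k_def state_scaleR)
    ultimately have "\<phi> h \<in> \<real>" "\<bar>Re (\<phi> k)\<bar> \<le> 1" "Re (\<phi> h) = m * Re (\<phi> k)"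
      by (auto simp: state_minus abs_le_iff)
    moreover have "\<bar>m * Re (\<phi> k)\<bar> \<le> m" using m \<open>\<bar>Re (\<phi> k)\<bar> \<le> 1\<close> by (simp add: abs_mult)
    ultimately show ?thesis by (simp add: m_def)
  qed
  show real: "\<phi> h \<in> \<real>" using scaled[of 1] by simp
  have "\<bar>Re (\<phi> h)\<bar> \<le> norm h" by (rule field_le_epsilon) (use scaled in blast)
  then show "cmod (\<phi> h) \<le> norm h" using real by (simp add: in_Reals_norm)
qed

lemma state_star: "\<phi> (star a) = cnj (\<phi> a)"
proof -
  obtain x y where xy: "star x = x" "star y = y" "a = x + scaleC \<i> y" by (rule self_adjoint_parts)
  have "cnj (\<phi> x) = \<phi> x" "cnj (\<phi> y) = \<phi> y"
    using state_self_adjoint(1)[of x] state_self_adjoint(1)[of y] xy by (simp_all add: Reals_cnj_iff)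
  then show ?thesis by (simp add: xy star_add star_scaleC state_add state_scaleC)
qed

lemma norm_state_le: "cmod (\<phi> a) \<le> 2 * norm a"
proof -
  obtain x y where xy: "star x = x" "star y = y" "a = x + scaleC \<i> y" "norm x \<le> norm a" "norm y \<le> norm a"
    by (rule self_adjoint_parts)
  have "cmod (\<phi> a) \<le> cmod (\<phi> x) + cmod (\<phi> y)"
    using norm_triangle_ineq[of "\<phi> x" "\<i> * \<phi> y"] by (simp add: xy(3) state_add state_scaleC norm_mult)
  also have "\<dots> \<le> norm x + norm y" by (intro add_mono state_self_adjoint xy)
  finally show ?thesis using xy by simp
qed

lemma bounded_linear_state: "bounded_linear \<phi>"
proof (rule bounded_linear_intro[of _ 2])
  show "\<phi> (k *\<^sub>R x) = k *\<^sub>R \<phi> x" for k x by (simp add: state_scaleR scaleR_conv_of_real[where 'a = complex])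
  show "norm (\<phi> x) \<le> norm x * 2" for x using norm_state_le[of x] by (simp add: mult.commute)
qed (rule state_add)

end

section \<open>Resolvents of self-adjoint matrices over a C*-algebra\<close>

text \<open>The involution, the complex scalar multiplication and the scalar matrices of \<open>M\<^sub>n(\<complex>) \<otimes> \<A>\<close>.\<close>

definition mstar :: "'a::cstar_algebra^'n^'n \<Rightarrow> 'a^'n^'n" where
  "mstar X = (\<chi> i j. star (X $ j $ i))"

definition mscale :: "complex \<Rightarrow> 'a::cstar_algebra^'n^'n \<Rightarrow> 'a^'n^'n" where
  "mscale c X = (\<chi> i j. scaleC c (X $ i $ j))"

definition zmat :: "complex \<Rightarrow> 'a::cstar_algebra^'n^'n" where
  "zmat z = mat (scaleC z 1)"

lemma mat_tensor_one: "mat z \<otimes>\<^sub>M 1 = zmat z"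
  by (simp add: mat_tensor_def zmat_def mat_def vec_eq_iff)

lemma zmat_mult: "zmat z ** X = mscale z X"
proof -
  have "(\<Sum>k\<in>UNIV. (if i = k then scaleC z 1 else 0) * X $ k $ j) = scaleC z (X $ i $ j)" for i j
    by (subst sum.remove[of _ i]) (auto simp: mult_scaleC_left)
  then show ?thesis by (simp add: zmat_def mat_def mscale_def matrix_matrix_mult_def vec_eq_iff)
qed

lemma mult_zmat: "X ** zmat z = mscale z X"
proof -
  have "(\<Sum>k\<in>UNIV. X $ i $ k * (if k = j then scaleC z 1 else 0)) = scaleC z (X $ i $ j)" for i j
    by (subst sum.remove[of _ j]) (auto simp: mult_scaleC_right)
  then show ?thesis by (simp add: zmat_def mat_def mscale_def matrix_matrix_mult_def vec_eq_iff)
qed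

lemma zmat_diff: "zmat z - zmat w = zmat (z - w)"
  by (simp add: zmat_def mat_def vec_eq_iff) (metis add_diff_cancel_right' diff_add_cancel scaleC_add_left)

lemma zmat_one: "zmat 1 = mat 1"
  by (simp add: zmat_def)

lemma mscale_mult_left: "mscale c X ** Y = mscale c (X ** Y)"
  by (metis matrix_mul_assoc zmat_mult)

lemma mscale_mscale: "mscale c (mscale d X) = mscale (c * d) X"
  by (simp add: mscale_def vec_eq_iff scaleC_scaleC)

lemma mscale_one [simp]: "mscale 1 X = X"
  by (simp add: mscale_def vec_eq_iff)

lemma norm_mscale: "norm (mscale c X) = cmod c * norm X"
proof -
  have "(norm (mscale c X))\<^sup>2 = (cmod c * norm X)\<^sup>2"
    by (simp add: power2_norm_vec mscale_def norm_scaleC power_mult_distrib sum_distrib_left)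
  then show ?thesis by simp
qed

lemma mstar_mult: "mstar (X ** Y) = mstar Y ** mstar X"
  by (simp add: mstar_def matrix_matrix_mult_def vec_eq_iff star_sum star_mult)

lemma mstar_one [simp]: "mstar (mat 1) = mat 1"
  by (simp add: mstar_def mat_def vec_eq_iff)

lemma mstar_diff: "mstar (X - Y) = mstar X - mstar Y"
  by (simp add: mstar_def vec_eq_iff star_diff)

lemma mstar_zmat: "mstar (zmat z) = zmat (cnj z)"
  by (simp add: mstar_def zmat_def mat_def vec_eq_iff star_scaleC)

lemma norm_mstar [simp]: "norm (mstar X) = norm X"
proof -
  have "(norm (mstar X))\<^sup>2 = (norm X)\<^sup>2"
    by (simp add: power2_norm_vec mstar_def) (rule sum.swap)
  then show ?thesis by simp
qed

lemma norm_entry_le: "norm (X $ i $ j) \<le> norm (X :: 'a::real_normed_vector^'m^'n)"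
  by (meson Finite_Cartesian_Product.norm_nth_le order_trans)

lemma norm_mat_one_alg: "norm (mat 1 :: 'a::real_normed_algebra_1^'n^'n) \<le> real CARD('n)"
proof (rule power2_le_imp_le)
  have "(norm (mat 1 :: 'a^'n^'n))\<^sup>2 = real CARD('n)"
    by (simp add: power2_norm_vec mat_def if_distrib if_distribR cong: if_cong)
  also have "\<dots> \<le> (real CARD('n))\<^sup>2"
  proof -
    have "real CARD('n) * 1 \<le> real CARD('n) * real CARD('n)"
      by (intro mult_left_mono) (auto simp: Suc_leI)
    then show ?thesis by (simp add: power2_eq_square)
  qed
  finally show "(norm (mat 1 :: 'a^'n^'n))\<^sup>2 \<le> (real CARD('n))\<^sup>2" .
qed simp

text \<open>The inverse of \<open>T - E\<close> is the fixed point of the contraction \<open>Y \<mapsto> R + R E Y\<close>; the mirrored equation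
  gives an inverse on the other side.\<close>

lemma invertible_perturb:
  fixes T E :: "'a::cstar_algebra^'n^'n"
  assumes R: "T ** R = mat 1" "R ** T = mat 1" and small: "norm E * norm R < 1"
  shows "invertible (T - E)"
proof -
  have "\<exists>!Y. R + R ** E ** Y = Y"
  proof (rule banach_fix_type[of "norm E * norm R"])
    show "\<forall>x. \<forall>y. dist (R + R ** E ** x) (R + R ** E ** y) \<le> norm E * norm R * dist x y"
    proof (intro allI)
      fix x y :: "'a^'n^'n"
      have "norm (R ** E ** (x - y)) \<le> norm (R ** E) * norm (x - y)" by (rule norm_matrix_mult_le)
      also have "\<dots> \<le> (norm R * norm E) * norm (x - y)" by (intro mult_right_mono norm_matrix_mult_le) simp
      finally show "dist (R + R ** E ** x) (R + R ** E ** y) \<le> norm E * norm R * dist x y"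
        by (simp add: dist_norm matrix_diff_ldistrib mult.commute)
    qed
  qed (use small in auto)
  then obtain Y where Y: "R + R ** E ** Y = Y" by auto
  have "\<exists>!Z. R + Z ** E ** R = Z"
  proof (rule banach_fix_type[of "norm E * norm R"])
    show "\<forall>x. \<forall>y. dist (R + x ** E ** R) (R + y ** E ** R) \<le> norm E * norm R * dist x y"
    proof (intro allI)
      fix x y :: "'a^'n^'n"
      have "norm ((x - y) ** E ** R) \<le> norm ((x - y) ** E) * norm R" by (rule norm_matrix_mult_le)
      also have "\<dots> \<le> (norm (x - y) * norm E) * norm R" by (intro mult_right_mono norm_matrix_mult_le) simp
      finally show "dist (R + x ** E ** R) (R + y ** E ** R) \<le> norm E * norm R * dist x y"
        by (simp add: dist_norm matrix_diff_rdistrib ac_simps)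
    qed
  qed (use small in auto)
  then obtain Z where Z: "R + Z ** E ** R = Z" by auto
  have "T ** Y = T ** (R + R ** E ** Y)" using Y by simp
  also have "\<dots> = mat 1 + E ** Y" by (simp add: matrix_add_ldistrib matrix_mul_assoc R)
  finally have 1: "(T - E) ** Y = mat 1" by (simp add: matrix_diff_rdistrib)
  have "Z ** T = (R + Z ** E ** R) ** T" using Z by simp
  also have "\<dots> = R ** T + Z ** E ** (R ** T)" by (simp only: matrix_add_rdistrib matrix_mul_assoc)
  also have "\<dots> = mat 1 + Z ** E" by (simp add: R)
  finally have 2: "Z ** (T - E) = mat 1" by (simp add: matrix_diff_ldistrib)
  have "Z = Z ** ((T - E) ** Y)" by (simp add: 1)
  also have "\<dots> = Y" by (simp add: matrix_mul_assoc 2)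
  finally show ?thesis unfolding invertible_def using 1 2 by blast
qed

definition resolvent :: "'a::cstar_algebra^'n^'n \<Rightarrow> complex \<Rightarrow> 'a^'n^'n" where
  "resolvent S z = matrix_inv (zmat z - S)"

lemma resolvent_inverse:
  assumes "invertible (zmat z - S)"
  shows "(zmat z - S) ** resolvent S z = mat 1" "resolvent S z ** (zmat z - S) = mat 1"
  using assms someI_ex[of "\<lambda>A'. (zmat z - S) ** A' = mat 1 \<and> A' ** (zmat z - S) = mat 1"]
  unfolding resolvent_def matrix_inv_def invertible_def by auto

text \<open>Both \<open>R\<^sup>* R\<close> and \<open>R R\<^sup>*\<close> are multiples of \<open>R - R\<^sup>*\<close>, so they are linear in \<open>R\<close>. The trace of their sum is the
  sum over the entries \<open>a\<close> of \<open>R\<close> of \<open>a\<^sup>* a + a a\<^sup>*\<close>, whose norm controls the square of the norm of each entry.\<close>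

lemma resolvent_bound:
  fixes S :: "'a::cstar_algebra^'n^'n"
  assumes S: "mstar S = S" and z: "0 < Im z" and R: "(zmat z - S) ** R = mat 1" "R ** (zmat z - S) = mat 1"
  shows "mscale (cnj z - z) (mstar R ** R) = R - mstar R" "norm R \<le> 4 * real CARD('n) ^ 3 / Im z"
proof -
  define T where "T = mstar R"
  have T: "T ** (zmat (cnj z) - S) = mat 1" "(zmat (cnj z) - S) ** T = mat 1"
    using arg_cong[OF R(1), of mstar] arg_cong[OF R(2), of mstar]
    by (simp_all add: T_def mstar_mult mstar_diff mstar_zmat S)
  have d: "(zmat (cnj z) - S) - (zmat z - S) = zmat (cnj z - z)"
    by (simp flip: zmat_diff)
  have "T ** ((zmat (cnj z) - S) - (zmat z - S)) ** R = (T ** (zmat (cnj z) - S)) ** R - T ** ((zmat z - S) ** R)"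
    by (simp only: matrix_diff_ldistrib matrix_diff_rdistrib matrix_mul_assoc)
  also have "\<dots> = R - T" by (simp add: T R)
  finally have TR: "mscale (cnj z - z) (T ** R) = R - T"
    unfolding d by (simp add: mult_zmat mscale_mult_left)
  have "R ** ((zmat (cnj z) - S) - (zmat z - S)) ** T = R ** ((zmat (cnj z) - S) ** T) - (R ** (zmat z - S)) ** T"
    by (simp only: matrix_diff_ldistrib matrix_diff_rdistrib matrix_mul_assoc)
  also have "\<dots> = R - T" by (simp add: T R)
  finally have RT: "mscale (cnj z - z) (R ** T) = R - T"
    unfolding d by (simp add: mult_zmat mscale_mult_left)
  show "mscale (cnj z - z) (mstar R ** R) = R - mstar R" using TR by (simp add: T_def)
  define n where "n = real CARD('n)"
  have cz: "cnj z - z = - (2 * \<i> * complex_of_real (Im z))" by (simp add: complex_eq_iff)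
  then have ncz: "cmod (cnj z - z) = 2 * Im z" using z by (simp add: norm_mult)
  have trb: "norm (\<Sum>i\<in>UNIV. M $ i $ i) \<le> n * norm R / Im z" if M: "mscale (cnj z - z) M = R - T" for M
  proof -
    have each: "norm (M $ i $ i) \<le> norm R / Im z" for i
    proof -
      have "2 * Im z * norm M = norm (R - T)" using norm_mscale[of "cnj z - z" M] by (simp add: M ncz)
      also have "\<dots> \<le> 2 * norm R" using norm_triangle_ineq4[of R T] by (simp add: T_def)
      finally have "norm M \<le> norm R / Im z" using z by (simp add: field_simps)
      then show ?thesis using norm_entry_le[of M i i] by simp
    qed
    have "norm (\<Sum>i\<in>UNIV. M $ i $ i) \<le> (\<Sum>i\<in>(UNIV::'n set). norm R / Im z)"
      by (intro order_trans[OF norm_sum] sum_mono each)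
    then show ?thesis by (simp add: n_def)
  qed
  define a where "a p = R $ fst p $ snd p" for p :: "'n \<times> 'n"
  have "(\<Sum>p\<in>UNIV. star (a p) * a p + a p * star (a p))
      = (\<Sum>k\<in>UNIV. \<Sum>j\<in>UNIV. star (R $ k $ j) * R $ k $ j) + (\<Sum>k\<in>UNIV. \<Sum>j\<in>UNIV. R $ k $ j * star (R $ k $ j))"
    by (simp add: a_def sum.distrib UNIV_Times_UNIV[symmetric] sum.cartesian_product case_prod_unfold del: UNIV_Times_UNIV)
  also have "(\<Sum>k\<in>UNIV. \<Sum>j\<in>UNIV. star (R $ k $ j) * R $ k $ j) = (\<Sum>j\<in>UNIV. (T ** R) $ j $ j)"
    by (subst sum.swap) (simp add: T_def mstar_def matrix_matrix_mult_def)
  also have "(\<Sum>k\<in>UNIV. \<Sum>j\<in>UNIV. R $ k $ j * star (R $ k $ j)) = (\<Sum>k\<in>UNIV. (R ** T) $ k $ k)"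
    by (simp add: T_def mstar_def matrix_matrix_mult_def)
  finally have "norm (\<Sum>p\<in>UNIV. star (a p) * a p + a p * star (a p)) \<le> n * norm R / Im z + n * norm R / Im z"
    using norm_triangle_mono[OF trb[OF TR] trb[OF RT]] by simp
  then have entry: "(norm (a p))\<^sup>2 \<le> 4 * n * norm R / Im z" for p
    using norm_le_sum_star_mult[of UNIV p a] by simp
  have "(norm R)\<^sup>2 = (\<Sum>i\<in>UNIV. \<Sum>j\<in>UNIV. (norm (a (i, j)))\<^sup>2)" by (simp add: power2_norm_vec a_def)
  also have "\<dots> \<le> (\<Sum>i\<in>(UNIV::'n set). \<Sum>j\<in>(UNIV::'n set). 4 * n * norm R / Im z)" by (intro sum_mono entry)
  also have "\<dots> = norm R * (4 * n ^ 3 / Im z)" by (simp add: n_def power3_eq_cube)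
  finally have le: "norm R * norm R \<le> norm R * (4 * n ^ 3 / Im z)" by (simp add: power2_eq_square)
  show "norm R \<le> 4 * real CARD('n) ^ 3 / Im z"
  proof (cases "R = 0")
    case False
    then show ?thesis using mult_left_le_imp_le[OF le] by (simp add: n_def)
  qed (use z in simp)
qed

text \<open>The resolvent exists for large imaginary part. By the bound on its norm, invertibility at \<open>z\<close> extends
  to a disc of radius proportional to \<open>Im z\<close>, so one can descend vertically in steps that shrink the
  imaginary part by a fixed factor \<open>q < 1\<close>.\<close>

lemma resolvent_exists:
  fixes S :: "'a::cstar_algebra^'n^'n"
  assumes S: "mstar S = S" and z: "0 < Im z"
  shows "invertible (zmat z - S)"
proof -
  define n where "n = real CARD('n)"
  have n1: "1 \<le> n" by (simp add: n_def Suc_leI)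
  define q where "q = 1 - 1 / (8 * n ^ 4)"
  have n4: "1 \<le> n ^ 4" using n1 by simp
  have "1 / (8 * n ^ 4) \<le> 1 / 8" using n4 by (intro divide_left_mono) auto
  moreover have "0 < 1 / (8 * n ^ 4)" using n1 by simp
  ultimately have q: "0 < q" "q < 1" unfolding q_def by linarith+
  define Y where "Y = n * norm S + 1"
  have Y: "1 \<le> Y" using n1 by (simp add: Y_def)
  have large: "invertible (zmat z - S)" if "Y \<le> Im z" for z
  proof (rule invertible_perturb)
    have zz: "n * norm S < cmod z" "z \<noteq> 0" using that Y abs_Im_le_cmod[of z] by (auto simp: Y_def)
    then show "zmat z ** zmat (1 / z) = (mat 1 :: 'a^'n^'n)" "zmat (1 / z) ** zmat z = (mat 1 :: 'a^'n^'n)"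
      by (simp_all add: zmat_mult mult_zmat mscale_mscale flip: zmat_one)
         (simp_all add: zmat_def mscale_def mat_def vec_eq_iff scaleC_scaleC)
    have "norm (zmat (1 / z) :: 'a^'n^'n) = norm (mat 1 :: 'a^'n^'n) / cmod z"
      using zmat_mult[of "1 / z" "mat 1 :: 'a^'n^'n"] norm_mscale[of "1 / z" "mat 1 :: 'a^'n^'n"] by (simp add: norm_divide)
    also have "\<dots> \<le> n / cmod z" unfolding n_def by (intro divide_right_mono norm_mat_one_alg) simp
    finally have "norm S * norm (zmat (1 / z) :: 'a^'n^'n) \<le> norm S * (n / cmod z)" by (intro mult_left_mono) auto
    also have "\<dots> < 1" using zz by (simp add: field_simps)
    finally show "norm S * norm (zmat (1 / z) :: 'a^'n^'n) < 1" .
  qed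
  have down: "invertible (zmat w - S)" if inv: "invertible (zmat z - S)" and z: "0 < Im z" and w: "cmod (z - w) \<le> Im z / (8 * n ^ 4)" for z w
  proof -
    note R = resolvent_inverse[OF inv]
    define R where "R = resolvent S z"
    have "norm (zmat (z - w) :: 'a^'n^'n) = cmod (z - w) * norm (mat 1 :: 'a^'n^'n)"
      using zmat_mult[of "z - w" "mat 1 :: 'a^'n^'n"] norm_mscale[of "z - w" "mat 1 :: 'a^'n^'n"] by simp
    also have "\<dots> \<le> Im z / (8 * n ^ 4) * n" using w z unfolding n_def by (intro mult_mono norm_mat_one_alg) auto
    finally have "norm (zmat (z - w) :: 'a^'n^'n) * norm R \<le> (Im z / (8 * n ^ 4) * n) * (4 * n ^ 3 / Im z)"
      using resolvent_bound(2)[OF S z R] z n1 unfolding R_def n_def by (intro mult_mono) auto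
    also have "\<dots> = 1/2" using z n1 by (simp add: field_simps power4_eq_xxxx power3_eq_cube)
    finally have "norm (zmat (z - w) :: 'a^'n^'n) * norm R < 1" by simp
    then have "invertible ((zmat z - S) - zmat (z - w))"
      using R by (intro invertible_perturb[of _ R]) (auto simp: R_def)
    then show ?thesis by (simp flip: zmat_diff)
  qed
  have steps: "invertible (zmat z - S)" if "Y * q ^ k \<le> Im z" for k z
    using that
  proof (induction k arbitrary: z)
    case 0
    then show ?case by (intro large) simp
  next
    case (Suc k)
    have pos: "0 < Im z" using Suc.prems Y q mult_pos_pos[of Y "q ^ Suc k"] zero_less_power[of q "Suc k"] by linarith
    define w where "w = Complex (Re z) (Im z / q)"
    have "Y * q ^ k \<le> Im w" using Suc.prems q by (simp add: w_def field_simps)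
    then have inv: "invertible (zmat w - S)" by (rule Suc.IH)
    have "w - z = Complex 0 (Im z / q - Im z)" by (simp add: w_def complex_eq_iff)
    then have "cmod (w - z) = \<bar>Im z / q - Im z\<bar>" by (simp add: complex_norm)
    also have "\<dots> = Im z / q - Im z" using pos q by (intro abs_of_nonneg) (simp add: field_simps)
    also have "\<dots> = Im w * (1 - q)" using q by (simp add: w_def field_simps)
    also have "\<dots> = Im w / (8 * n ^ 4)" by (simp add: q_def)
    finally show ?case using down[OF inv] pos q by (simp add: w_def)
  qed
  have "(\<lambda>k. Y * q ^ k) \<longlonglongrightarrow> Y * 0" by (intro tendsto_intros LIMSEQ_power_zero) (use q in auto)
  then have "\<forall>\<^sub>F k in sequentially. Y * q ^ k < Im z" using z by (intro order_tendstoD) auto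
  then obtain k where "Y * q ^ k < Im z" by (auto simp: eventually_sequentially)
  then show ?thesis using steps[of k z] by simp
qed

lemma resolvent_identity:
  assumes "invertible (zmat z - S)" "invertible (zmat w - S)"
  shows "resolvent S z - resolvent S w = mscale (w - z) (resolvent S z ** resolvent S w)"
proof -
  define R where "R = resolvent S z"
  define T where "T = resolvent S w"
  note R = resolvent_inverse[OF assms(1), folded R_def] and T = resolvent_inverse[OF assms(2), folded T_def]
  have "R ** ((zmat w - S) - (zmat z - S)) ** T = R ** ((zmat w - S) ** T) - (R ** (zmat z - S)) ** T"
    by (simp only: matrix_diff_ldistrib matrix_diff_rdistrib matrix_mul_assoc)
  also have "\<dots> = R - T" by (simp add: R T)
  also have "(zmat w - S) - (zmat z - S) = zmat (w - z)" by (simp flip: zmat_diff)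
  finally show ?thesis by (simp add: mult_zmat mscale_mult_left R_def T_def)
qed

lemma resolvent_continuous:
  fixes S :: "'a::cstar_algebra^'n^'n"
  assumes S: "mstar S = S" and w: "0 < Im w"
  shows "(resolvent S \<longlongrightarrow> resolvent S w) (at w)"
proof -
  define c where "c = 4 * real CARD('n) ^ 3"
  have b: "norm (resolvent S z) \<le> c / Im z" if "0 < Im z" for z
    using resolvent_bound(2)[OF S that resolvent_inverse[OF resolvent_exists[OF S that]]] by (simp add: c_def)
  have open_half: "\<forall>\<^sub>F z in at w. Im w / 2 < Im z"
    using tendsto_Im[OF tendsto_ident_at, of w UNIV] w by (intro order_tendstoD) auto
  have "\<forall>\<^sub>F z in at w. norm (resolvent S z - resolvent S w) \<le> cmod (w - z) * (c / (Im w / 2) * (c / Im w))"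
    using open_half
  proof eventually_elim
    case (elim z)
    then have z: "0 < Im z" using w by simp
    have "norm (resolvent S z - resolvent S w) = cmod (w - z) * norm (resolvent S z ** resolvent S w)"
      by (simp add: resolvent_identity resolvent_exists[OF S] z w norm_mscale)
    also have "\<dots> \<le> cmod (w - z) * (norm (resolvent S z) * norm (resolvent S w))"
      by (intro mult_left_mono norm_matrix_mult_le) simp
    also have "\<dots> \<le> cmod (w - z) * ((c / (Im w / 2)) * (c / Im w))"
    proof (intro mult_left_mono mult_mono)
      show "norm (resolvent S z) \<le> c / (Im w / 2)"
        using b[OF z] elim w by (intro order_trans[OF b[OF z]] divide_left_mono) (auto simp: c_def)
    qed (use b[OF w] w in \<open>auto simp: c_def\<close>)
    finally show ?case .
  qed
  moreover have "((\<lambda>z. cmod (w - z) * (c / (Im w / 2) * (c / Im w))) \<longlongrightarrow> cmod (w - w) * (c / (Im w / 2) * (c / Im w))) (at w)"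
    by (intro tendsto_intros)
  then have "((\<lambda>z. cmod (w - z) * (c / (Im w / 2) * (c / Im w))) \<longlongrightarrow> 0) (at w)" by simp
  ultimately have "((\<lambda>z. resolvent S z - resolvent S w) \<longlongrightarrow> 0) (at w)"
    by (rule Lim_null_comparison)
  then show ?thesis by (rule LIM_zero_cancel)
qed

section \<open>The matrix Cauchy transform\<close>

context cstar_prob_space
begin

lemma mat_expectation_diff: "mat_expectation \<phi> (X - Y) = mat_expectation \<phi> X - mat_expectation \<phi> Y"
  by (simp add: mat_expectation_def vec_eq_iff state_diff)

lemma mat_expectation_add: "mat_expectation \<phi> (X + Y) = mat_expectation \<phi> X + mat_expectation \<phi> Y"
  by (simp add: mat_expectation_def vec_eq_iff state_add)

lemma mat_expectation_mscale: "mat_expectation \<phi> (mscale c X) = mat c ** mat_expectation \<phi> X"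
proof -
  have "(\<Sum>k\<in>UNIV. (if i = k then c else 0) * \<phi> (X $ k $ j)) = c * \<phi> (X $ i $ j)" for i j
    by (subst sum.remove[of _ i]) auto
  then show ?thesis by (simp add: mat_expectation_def mscale_def vec_eq_iff state_scaleC matrix_matrix_mult_def mat_def)
qed

lemma adjoint_mat_expectation: "adjoint_mat (mat_expectation \<phi> X) = mat_expectation \<phi> (mstar X)"
  by (simp add: mat_expectation_def mstar_def vec_eq_iff state_star)

text \<open>The form at \<open>v\<close> is the sum of the numbers \<open>\<phi>(y\<^sub>k\<^sup>* y\<^sub>k)\<close>, where \<open>y = X v\<close>.\<close>

lemma mat_expectation_gram_psd:
  fixes X :: "'a^'n^'n"
  shows "psd (mat_expectation \<phi> (mstar X ** X))"
  unfolding psd_def hermitian_mat_def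
proof (intro conjI allI)
  show "adjoint_mat (mat_expectation \<phi> (mstar X ** X)) = mat_expectation \<phi> (mstar X ** X)"
    by (simp add: adjoint_mat_expectation mstar_mult) (simp add: mstar_def vec_eq_iff star_star)
  fix v :: "complex^'n"
  define y where "y k = (\<Sum>j\<in>UNIV. scaleC (v $ j) (X $ k $ j))" for k
  have "cip v (mat_expectation \<phi> (mstar X ** X) *v v)
      = (\<Sum>i\<in>UNIV. \<Sum>j\<in>UNIV. \<Sum>k\<in>UNIV. \<phi> (star (scaleC (v $ i) (X $ k $ i)) * scaleC (v $ j) (X $ k $ j)))"
    by (simp add: cip_def matrix_vector_mult_def mat_expectation_def matrix_matrix_mult_def mstar_def
        state_sum sum_distrib_left sum_distrib_right star_scaleC mult_scaleC_left mult_scaleC_right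
        state_scaleC ac_simps)
  also have "\<dots> = (\<Sum>k\<in>UNIV. \<Sum>i\<in>UNIV. \<Sum>j\<in>UNIV. \<phi> (star (scaleC (v $ i) (X $ k $ i)) * scaleC (v $ j) (X $ k $ j)))"
    by (subst (2) sum.swap, subst sum.swap) simp
  also have "\<dots> = (\<Sum>k\<in>UNIV. \<phi> (star (y k) * y k))"
    by (simp add: y_def star_sum sum_product state_sum)
  finally have "qform (mat_expectation \<phi> (mstar X ** X)) v = (\<Sum>k\<in>UNIV. Re (\<phi> (star (y k) * y k)))" by simp
  also have "0 \<le> \<dots>"
    by (intro sum_nonneg) (use state_pos complex_nonneg_Reals_iff in blast)
  finally show "0 \<le> qform (mat_expectation \<phi> (mstar X ** X)) v" .
qed

lemma matrix_cauchy_resolvent: "matrix_cauchy \<phi> S z = mat_expectation \<phi> (resolvent S z)"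
  by (simp add: matrix_cauchy_def resolvent_def mat_tensor_one)

lemma matrix_cauchy_holomorphic:
  assumes S: "mstar S = S"
  shows "(\<lambda>z. matrix_cauchy \<phi> S z $ i $ j) holomorphic_on {z. 0 < Im z}"
proof (rule holomorphic_onI)
  fix w assume "w \<in> {z. 0 < Im z}"
  then have w: "0 < Im w" by simp
  define D where "D = \<phi> (- ((resolvent S w ** resolvent S w) $ i $ j))"
  have ev: "\<forall>\<^sub>F z in at w. 0 < Im z"
    using tendsto_Im[OF tendsto_ident_at, of w UNIV] w by (intro order_tendstoD) auto
  have "\<forall>\<^sub>F z in at w. z \<noteq> w" by (simp add: eventually_at_filter)
  with ev have eq: "\<forall>\<^sub>F z in at w. \<phi> (- ((resolvent S z ** resolvent S w) $ i $ j))
      = (matrix_cauchy \<phi> S z $ i $ j - matrix_cauchy \<phi> S w $ i $ j) / (z - w)"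
  proof eventually_elim
    case (elim z)
    have "matrix_cauchy \<phi> S z $ i $ j - matrix_cauchy \<phi> S w $ i $ j
        = \<phi> ((resolvent S z - resolvent S w) $ i $ j)"
      by (simp add: matrix_cauchy_resolvent mat_expectation_def state_diff)
    also have "\<dots> = (w - z) * \<phi> ((resolvent S z ** resolvent S w) $ i $ j)"
      using elim w by (simp add: resolvent_identity resolvent_exists[OF S] mscale_def state_scaleC)
    finally show ?case using elim(2) by (simp add: state_minus field_simps)
  qed
  have "((\<lambda>z. \<phi> (- ((resolvent S z ** resolvent S w) $ i $ j))) \<longlongrightarrow> D) (at w)"
    unfolding D_def
    by (intro bounded_linear.tendsto[OF bounded_linear_state] tendsto_intros resolvent_continuous[OF S w])
  then have "((\<lambda>z. (matrix_cauchy \<phi> S z $ i $ j - matrix_cauchy \<phi> S w $ i $ j) / (z - w)) \<longlongrightarrow> D) (at w)"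
    using eq by (rule Lim_transform_eventually)
  then have "((\<lambda>z. matrix_cauchy \<phi> S z $ i $ j) has_field_derivative D) (at w)"
    by (simp add: has_field_derivative_iff)
  then show "(\<lambda>z. matrix_cauchy \<phi> S z $ i $ j) field_differentiable at w within {z. 0 < Im z}"
    using field_differentiable_at_within field_differentiable_def by blast
qed

text \<open>The real part of \<open>W(u)\<close> is \<open>Re u\<close> times the expectation of \<open>R\<^sup>* R\<close>.\<close>

lemma W_transform_psd:
  assumes S: "mstar S = S" and u: "0 < Re u"
  shows "psd ((1/2) *\<^sub>R (W_transform \<phi> S u + adjoint_mat (W_transform \<phi> S u)))"
proof -
  define z where "z = \<i> * u"
  have z: "0 < Im z" using u by (simp add: z_def)
  define R where "R = resolvent S z"
  note R = resolvent_inverse[OF resolvent_exists[OF S z], folded R_def]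
  define G where "G = mat_expectation \<phi> R"
  define P where "P = mat_expectation \<phi> (mstar R ** R)"
  have "G - adjoint_mat G = mat (cnj z - z) ** P"
    using resolvent_bound(1)[OF S z R]
    by (simp add: G_def P_def adjoint_mat_expectation flip: mat_expectation_diff mat_expectation_mscale)
  moreover have "cnj z - z = - (2 * \<i> * complex_of_real (Re u))" by (simp add: z_def complex_eq_iff)
  ultimately have GP: "G $ i $ j - cnj (G $ j $ i) = - (2 * \<i> * complex_of_real (Re u)) * P $ i $ j" for i j
    by (metis (no_types) adjoint_mat_nth mat_mult_nth vector_minus_component)
  have W: "W_transform \<phi> S u $ i $ j = \<i> * G $ i $ j" for i j
    by (simp add: W_transform_def matrix_cauchy_resolvent G_def R_def z_def mat_mult_nth)
  have "(1/2) *\<^sub>R (W_transform \<phi> S u + adjoint_mat (W_transform \<phi> S u)) = Re u *\<^sub>R P"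
  proof -
    have "(1/2) *\<^sub>R (\<i> * G $ i $ j + cnj (\<i> * G $ j $ i)) = Re u *\<^sub>R P $ i $ j" for i j
    proof -
      have "\<i> * G $ i $ j + cnj (\<i> * G $ j $ i) = \<i> * (G $ i $ j - cnj (G $ j $ i))"
        by (simp add: algebra_simps)
      also have "\<dots> = 2 * complex_of_real (Re u) * P $ i $ j" unfolding GP by (simp add: algebra_simps)
      finally show ?thesis by (simp add: scaleR_conv_of_real[where 'a = complex])
    qed
    then show ?thesis by (simp add: vec_eq_iff W)
  qed
  then show ?thesis using u mat_expectation_gram_psd[of R] by (simp add: P_def psd_scaleR)
qed

end

section \<open>Chebyshev polynomials and the semicircle law\<close>

text \<open>Chebyshev polynomials of the second kind for the interval \<open>[-2, 2]\<close>:
  \<open>cheb (2 cos \<theta>) k = sin ((k + 1) \<theta>) / sin \<theta>\<close>.\<close>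

fun cheb :: "'a::ring_1 \<Rightarrow> nat \<Rightarrow> 'a" where
  "cheb x 0 = 1"
| "cheb x (Suc 0) = x"
| "cheb x (Suc (Suc k)) = x * cheb x (Suc k) - cheb x k"

lemma cheb_step: "x * cheb x (Suc k) = cheb x (Suc (Suc k)) + cheb x k"
  by simp

lemma unital_subalgebra_gen_diff:
  "a \<in> unital_subalgebra_gen x \<Longrightarrow> b \<in> unital_subalgebra_gen x \<Longrightarrow> a - b \<in> unital_subalgebra_gen x"
  using unital_subalgebra_gen.add[of a x "scaleC (- 1) b"] unital_subalgebra_gen.scaleC[of b x "- 1"]
  by (simp add: scaleC_minus_one)

lemma cheb_mem: "cheb x k \<in> unital_subalgebra_gen x"
  by (induction x k rule: cheb.induct)
    (auto intro: unital_subalgebra_gen.intros unital_subalgebra_gen_diff)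

lemma cheb_cos: "sin \<theta> * cheb (- 2 * cos \<theta>) k = (- 1) ^ k * sin (real (Suc k) * \<theta>)" for \<theta> :: real
proof (induction k rule: induct_nat_012)
  case (ge2 k)
  have s3: "sin (real (Suc (Suc (Suc k))) * \<theta>) + sin (real (Suc k) * \<theta>) = 2 * cos \<theta> * sin (real (Suc (Suc k)) * \<theta>)"
    using sin_add[of "real (Suc (Suc k)) * \<theta>" \<theta>] sin_diff[of "real (Suc (Suc k)) * \<theta>" \<theta>]
    by (simp add: algebra_simps)
  have "sin \<theta> * cheb (- 2 * cos \<theta>) (Suc (Suc k))
      = - 2 * cos \<theta> * (sin \<theta> * cheb (- 2 * cos \<theta>) (Suc k)) - sin \<theta> * cheb (- 2 * cos \<theta>) k"
    by (simp add: algebra_simps)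
  moreover have "\<dots> = - 2 * cos \<theta> * ((- 1) ^ Suc k * sin (real (Suc (Suc k)) * \<theta>)) - (- 1) ^ k * sin (real (Suc k) * \<theta>)"
    by (simp only: ge2)
  ultimately have "sin \<theta> * cheb (- 2 * cos \<theta>) (Suc (Suc k))
      = (- 1) ^ k * (2 * cos \<theta> * sin (real (Suc (Suc k)) * \<theta>) - sin (real (Suc k) * \<theta>))"
    by (simp only:) (simp add: algebra_simps)
  also have "\<dots> = (- 1) ^ Suc (Suc k) * sin (real (Suc (Suc (Suc k))) * \<theta>)"
    using s3 by simp
  finally show ?case .
qed (simp_all add: sin_double)

lemma continuous_on_cheb [continuous_intros]: "continuous_on S (\<lambda>t :: real. cheb t k)"
  by (induction k rule: induct_nat_012) (auto intro!: continuous_intros)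

text \<open>The substitution \<open>t = - 2 cos \<theta>\<close> turns the density and the polynomial into sines.\<close>

lemma cheb_semicircle_integral:
  assumes "0 < k"
  shows "integral {-2..2} (\<lambda>t :: real. cheb t k * (sqrt (4 - t\<^sup>2) / (2 * pi))) = 0"
proof -
  define f where "f t = cheb t k * (sqrt (4 - t\<^sup>2) / (2 * pi))" for t :: real
  define F where "F \<theta> = (- 1) ^ k / pi * (sin (real k * \<theta>) / real k - sin (real (k + 2) * \<theta>) / real (k + 2))" for \<theta>
  have cf: "continuous_on {-2..2} f" unfolding f_def by (intro continuous_intros) auto
  have "((\<lambda>\<theta>. (2 * sin \<theta>) *\<^sub>R f (- 2 * cos \<theta>)) has_integral integral {- 2 * cos 0..- 2 * cos pi} f) {0..pi}"
  proof (rule has_integral_substitution[OF _ _ _ cf])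
    show "((\<lambda>x. - 2 * cos x) has_real_derivative 2 * sin x) (at x within {0..pi})" for x
      by (auto intro!: derivative_eq_intros)
    show "(\<lambda>x. - 2 * cos x) ` {0..pi} \<subseteq> {- 2..2}"
    proof (rule image_subsetI)
      show "- 2 * cos x \<in> {- 2..2}" for x :: real
      proof -
        have "- 1 \<le> cos x" "cos x \<le> 1" by simp_all
        then show ?thesis unfolding atLeastAtMost_iff by linarith
      qed
    qed
  qed simp_all
  moreover have eq: "(2 * sin \<theta>) *\<^sub>R f (- 2 * cos \<theta>) = (- 1) ^ k / pi * (cos (real k * \<theta>) - cos (real (k + 2) * \<theta>))"
    if "\<theta> \<in> {0..pi}" for \<theta>
  proof -
    have "4 - (- 2 * cos \<theta>)\<^sup>2 = (2 * sin \<theta>)\<^sup>2"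
      using sin_squared_eq[of \<theta>] by (simp add: power_mult_distrib)
    then have "sqrt (4 - (- 2 * cos \<theta>)\<^sup>2) = 2 * sin \<theta>"
      using that sin_ge_zero[of \<theta>] by (simp add: real_sqrt_unique)
    then have "(2 * sin \<theta>) *\<^sub>R f (- 2 * cos \<theta>) = 2 / pi * (sin \<theta> * cheb (- 2 * cos \<theta>) k) * sin \<theta>"
      by (simp add: f_def)
    also have "\<dots> = (- 1) ^ k / pi * (2 * (sin (real (Suc k) * \<theta>) * sin \<theta>))"
      unfolding cheb_cos by simp
    also have "2 * (sin (real (Suc k) * \<theta>) * sin \<theta>) = cos (real k * \<theta>) - cos (real (k + 2) * \<theta>)"
      using cos_diff[of "real (Suc k) * \<theta>" \<theta>] cos_add[of "real (Suc k) * \<theta>" \<theta>] by (simp add: algebra_simps)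
    finally show ?thesis .
  qed
  moreover have "((\<lambda>\<theta>. (- 1) ^ k / pi * (cos (real k * \<theta>) - cos (real (k + 2) * \<theta>))) has_integral (F pi - F 0)) {0..pi}"
  proof (rule fundamental_theorem_of_calculus)
    fix x
    have sinD: "((\<lambda>\<theta>. sin (a * \<theta>) / a) has_real_derivative cos (a * x)) (at x within {0..pi})" if "a \<noteq> 0" for a :: real
      using that by (auto intro!: derivative_eq_intros)
    have "(F has_real_derivative (- 1) ^ k / pi * (cos (real k * x) - cos (real (k + 2) * x))) (at x within {0..pi})"
      unfolding F_def using assms by (intro DERIV_cmult DERIV_diff sinD) auto
    then show "(F has_vector_derivative (- 1) ^ k / pi * (cos (real k * x) - cos (real (k + 2) * x))) (at x within {0..pi})"
      by (simp add: has_real_derivative_iff_has_vector_derivative)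
  qed simp
  moreover have "F pi = 0" "F 0 = 0"
  proof -
    have "sin (real (k + 2) * pi) = 0" "sin (real k * pi) = 0" by (rule sin_npi)+
    then show "F pi = 0" by (simp add: F_def)
  qed (simp add: F_def)
  ultimately have "integral {- 2 * cos 0..- 2 * cos pi} f = 0"
    by (metis (no_types, lifting) diff_self has_integral_eq has_integral_unique)
  then have "integral {-2..2} f = 0" by simp
  then show ?thesis unfolding f_def .
qed

context cstar_prob_space
begin

lemma semicircular_cheb:
  assumes "semicircular \<phi> x" "0 < k"
  shows "\<phi> (cheb x k) = 0"
proof -
  define \<sigma> where "\<sigma> t = sqrt (4 - t\<^sup>2) / (2 * pi)" for t :: real
  have c\<sigma>: "continuous_on {-2..2} \<sigma>" unfolding \<sigma>_def by (intro continuous_intros) auto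
  have int: "(\<lambda>t. t ^ m * (cheb t k * \<sigma> t)) integrable_on {-2..2}" for m k
    by (intro integrable_continuous_interval continuous_intros c\<sigma>)
  have mom: "\<phi> (x ^ m) = complex_of_real (integral {-2..2} (\<lambda>t. t ^ m * \<sigma> t))" for m
    using assms(1) by (simp add: semicircular_def \<sigma>_def)
  \<comment> \<open>the power in front lets the recursion of \<open>cheb\<close> act on moments\<close>
  have "\<phi> (x ^ m * cheb x k) = complex_of_real (integral {-2..2} (\<lambda>t. t ^ m * (cheb t k * \<sigma> t)))" for m
  proof (induction k arbitrary: m rule: induct_nat_012)
    case 0
    then show ?case by (simp add: mom)
  next
    case 1
    have "x ^ m * x = x ^ Suc m" by (rule power_Suc2[symmetric])
    moreover have "(\<lambda>t. t ^ Suc m * \<sigma> t) = (\<lambda>t. t ^ m * (t * \<sigma> t))" by (simp add: fun_eq_iff)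
    ultimately show ?case using mom[of "Suc m"] by (simp only: cheb.simps)
  next
    case (ge2 k)
    have "x ^ m * cheb x (Suc (Suc k)) = x ^ Suc m * cheb x (Suc k) - x ^ m * cheb x k"
      by (simp add: right_diff_distrib power_Suc2 mult.assoc del: power_Suc)
    then have "\<phi> (x ^ m * cheb x (Suc (Suc k))) = \<phi> (x ^ Suc m * cheb x (Suc k)) - \<phi> (x ^ m * cheb x k)"
      by (simp only: state_diff)
    also have "\<dots> = complex_of_real (integral {-2..2} (\<lambda>t. t ^ Suc m * (cheb t (Suc k) * \<sigma> t))
        - integral {-2..2} (\<lambda>t. t ^ m * (cheb t k * \<sigma> t)))"
      by (simp only: ge2 of_real_diff)
    also have "integral {-2..2} (\<lambda>t. t ^ Suc m * (cheb t (Suc k) * \<sigma> t)) - integral {-2..2} (\<lambda>t. t ^ m * (cheb t k * \<sigma> t))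
        = integral {-2..2} (\<lambda>t. t ^ Suc m * (cheb t (Suc k) * \<sigma> t) - t ^ m * (cheb t k * \<sigma> t))"
      by (rule integral_diff[symmetric]; rule int)
    also have "(\<lambda>t. t ^ Suc m * (cheb t (Suc k) * \<sigma> t) - t ^ m * (cheb t k * \<sigma> t))
        = (\<lambda>t. t ^ m * (cheb t (Suc (Suc k)) * \<sigma> t))"
      by (simp add: fun_eq_iff algebra_simps)
    finally show ?case .
  qed
  from this[of 0] show ?thesis
    using cheb_semicircle_integral[OF assms(2)] by (simp add: \<sigma>_def)
qed

end

section \<open>Words and free products of Chebyshev polynomials\<close>

text \<open>A word is cut into maximal runs of one letter; the run of length \<open>k\<close> of the letter \<open>i\<close> stands for
  \<open>cheb (s i) k\<close>.  In this basis multiplication by \<open>s i\<close> acts as on the full Fock space: it adds the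
  letter \<open>i\<close> in front, and removes it if it is already there.\<close>

fun runs :: "nat list \<Rightarrow> (nat \<times> nat) list" where
  "runs [] = []"
| "runs (i # w) = (case runs w of [] \<Rightarrow> [(i, 1)]
     | (j, k) # L \<Rightarrow> if i = j then (i, Suc k) # L else (i, 1) # (j, k) # L)"

definition fock :: "(nat \<Rightarrow> 'a::ring_1) \<Rightarrow> nat list \<Rightarrow> 'a" where
  "fock s w = prod_list (map (\<lambda>(i, k). cheb (s i) k) (runs w))"

lemma runs_Cons: "\<exists>k L. runs (i # w) = (i, Suc k) # L"
  by (auto split: list.splits prod.splits)

lemma runs_mem: "(j, k) \<in> set (runs w) \<Longrightarrow> j \<in> set w \<and> 0 < k"
  by (induction w arbitrary: j k) (fastforce split: list.splits prod.splits if_splits)+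

lemma runs_alternate: "Suc j < length (runs w) \<Longrightarrow> fst (runs w ! j) \<noteq> fst (runs w ! Suc j)"
proof (induction w arbitrary: j)
  case (Cons i w)
  show ?case
  proof (cases "runs w")
    case Nil
    then show ?thesis using Cons.prems by simp
  next
    case (Cons p L)
    then show ?thesis
      using Cons.IH[of j] Cons.IH[of "j - 1"] Cons.prems
      by (cases p; cases j) (auto split: if_splits)
  qed
qed simp

lemma fock_Nil [simp]: "fock s [] = 1"
  by (simp add: fock_def)

lemma fock_step:
  "s i * fock s w = fock s (i # w) + (case w of [] \<Rightarrow> 0 | j # v \<Rightarrow> if i = j then fock s v else 0)"
proof (cases w)
  case Nil
  then show ?thesis by (simp add: fock_def)
next
  case (Cons j v)
  obtain k L where w: "runs w = (j, Suc k) # L" using runs_Cons Cons by blast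
  show ?thesis
  proof (cases "i = j")
    case False
    then show ?thesis using w Cons by (simp add: fock_def del: runs.simps(2)) (simp add: w[unfolded Cons] )
  next
    case True
    have v: "fock s v = cheb (s j) k * prod_list (map (\<lambda>(i, k). cheb (s i) k) L)"
    proof (cases "runs v")
      case Nil
      then show ?thesis using w unfolding Cons by (simp add: fock_def)
    next
      case (Cons p L')
      obtain a b where p: "p = (a, b)" by (cases p)
      show ?thesis using w Cons unfolding \<open>w = j # v\<close> p by (cases "j = a") (auto simp: fock_def Cons p)
    qed
    have "fock s (i # w) = cheb (s j) (Suc (Suc k)) * prod_list (map (\<lambda>(i, k). cheb (s i) k) L)"
      using True w by (simp add: fock_def del: cheb.simps(3))
    moreover have "s i * fock s w = (s j * cheb (s j) (Suc k)) * prod_list (map (\<lambda>(i, k). cheb (s i) k) L)"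
      using True w by (simp add: fock_def mult.assoc)
    ultimately show ?thesis
      unfolding cheb_step using True v Cons by (simp add: distrib_right del: cheb.simps(3))
  qed
qed

lemma norm_fock_le:
  fixes s :: "nat \<Rightarrow> 'a::real_normed_algebra_1"
  assumes b: "\<And>i. i \<in> I \<Longrightarrow> norm (s i) + 1 \<le> b" "1 \<le> b" and w: "set w \<subseteq> I"
  shows "norm (fock s w) \<le> b ^ length w"
  using w
proof (induction w rule: length_induct)
  case (1 w)
  show ?case
  proof (cases w)
    case (Cons i v)
    have v: "norm (fock s v) \<le> b ^ length v" using 1 Cons by simp
    define rest where "rest = (case v of [] \<Rightarrow> 0 | j # u \<Rightarrow> if i = j then fock s u else 0)"
    have "norm rest \<le> b ^ length v"
    proof (cases v)
      case (Cons j u)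
      have "norm (fock s u) \<le> b ^ length u" using 1 \<open>w = i # v\<close> Cons by simp
      also have "\<dots> \<le> b ^ length v" using b(2) Cons by (intro power_increasing) auto
      finally show ?thesis using Cons b(2) by (simp add: rest_def)
    qed (simp add: rest_def)
    moreover have "norm (s i * fock s v) \<le> (b - 1) * b ^ length v"
      using b(1)[of i] 1 Cons v b(2) by (intro order_trans[OF norm_mult_ineq] mult_mono) auto
    moreover have "fock s w = s i * fock s v - rest"
      using fock_step[of s i v] Cons by (simp add: rest_def)
    ultimately have "norm (fock s w) \<le> (b - 1) * b ^ length v + b ^ length v"
      using norm_triangle_ineq4[of "s i * fock s v" rest] by simp
    also have "\<dots> = b ^ length w" using Cons by (simp add: algebra_simps)
    finally show ?thesis .
  qed simp
qed

section \<open>The Dyson equation of a matrix semicircle\<close>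

lemma tensor_mult: "(M \<otimes>\<^sub>M a) ** (N \<otimes>\<^sub>M b) = (M ** N) \<otimes>\<^sub>M (a * b)"
  by (simp add: mat_tensor_def matrix_matrix_mult_def vec_eq_iff mult_scaleC_left mult_scaleC_right
      scaleC_scaleC scaleC_sum_left mult.commute)

lemma norm_tensor: "norm (M \<otimes>\<^sub>M a) = norm M * norm a"
proof -
  have "(norm (M \<otimes>\<^sub>M a))\<^sup>2 = (norm M * norm a)\<^sup>2"
    by (simp add: power2_norm_vec mat_tensor_def norm_scaleC power_mult_distrib sum_distrib_right)
  then show ?thesis by simp
qed

lemma tensor_add_right: "M \<otimes>\<^sub>M (a + b) = M \<otimes>\<^sub>M a + M \<otimes>\<^sub>M b"
  by (simp add: mat_tensor_def vec_eq_iff scaleC_add_right)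

lemma tensor_add_left: "(M + N) \<otimes>\<^sub>M a = M \<otimes>\<^sub>M a + N \<otimes>\<^sub>M a"
  by (simp add: mat_tensor_def vec_eq_iff scaleC_add_left)

lemma tensor_sum_left: "(\<Sum>i\<in>I. f i) \<otimes>\<^sub>M a = (\<Sum>i\<in>I. f i \<otimes>\<^sub>M a)"
  by (simp add: mat_tensor_def vec_eq_iff scaleC_sum_left)

lemma tensor_zero_right [simp]: "M \<otimes>\<^sub>M 0 = 0"
  by (simp add: mat_tensor_def vec_eq_iff)

lemma tensor_one: "mat 1 \<otimes>\<^sub>M 1 = mat 1"
  by (simp add: mat_tensor_one zmat_one)

lemma mscale_tensor: "mscale z (M \<otimes>\<^sub>M a) = (mat z ** M) \<otimes>\<^sub>M a"
  by (simp add: mscale_def mat_tensor_def vec_eq_iff scaleC_scaleC mat_mult_nth)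

definition words :: "nat \<Rightarrow> nat \<Rightarrow> nat list set" where
  "words r m = {w. set w \<subseteq> {1..r} \<and> length w = m}"

lemma card_words: "card (words r m) = r ^ m"
  unfolding words_def using card_lists_length_eq[of "{1..r}" m] by simp

lemma sum_words_Suc: "sum f (words r (Suc m)) = (\<Sum>i=1..r. \<Sum>w\<in>words r m. f (i # w))"
proof -
  have "words r (Suc m) = (\<lambda>(i, w). i # w) ` ({1..r} \<times> words r m)"
    by (auto simp: words_def length_Suc_conv image_iff)
  moreover have "inj_on (\<lambda>(i, w). i # w) ({1..r} \<times> words r m)"
    by (auto simp: inj_on_def)
  ultimately have "sum f (words r (Suc m)) = (\<Sum>(i, w)\<in>{1..r} \<times> words r m. f (i # w))"
    by (simp add: sum.reindex case_prod_unfold)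
  then show ?thesis by (simp add: sum.cartesian_product)
qed

locale matrix_semicircle_setup = hermitian_pencil r A + cstar_prob_space \<phi>
  for r and A :: "nat \<Rightarrow> complex^'n^'n" and \<phi> :: "'a::cstar_algebra \<Rightarrow> complex" +
  fixes s :: "nat \<Rightarrow> 'a"
  assumes free: "freely_independent \<phi> s {1..r}"
    and semi: "i \<in> {1..r} \<Longrightarrow> semicircular \<phi> (s i)"
begin

text \<open>Consecutive runs have different letters and every run is centred, so this is an alternating product.\<close>

lemma state_fock:
  assumes "w \<noteq> []" "set w \<subseteq> {1..r}"
  shows "\<phi> (fock s w) = 0"
proof -
  define k where "k = length (runs w)"
  define idx where "idx j = fst (runs w ! j)" for j
  define a where "a j = cheb (s (idx j)) (snd (runs w ! j))" for j
  have "runs w \<noteq> []" using assms(1) runs_Cons by (cases w) (metis list.distinct(1))+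
  then have k: "0 < k" by (simp add: k_def)
  have mem: "idx j \<in> set w" "0 < snd (runs w ! j)" if "j < k" for j
    using runs_mem[of "fst (runs w ! j)" "snd (runs w ! j)" w] nth_mem[of j "runs w"] that
    by (auto simp: k_def idx_def)
  have c1: "\<forall>j<k. idx j \<in> {1..r} \<and> a j \<in> unital_subalgebra_gen (s (idx j)) \<and> \<phi> (a j) = 0"
  proof (intro allI impI)
    fix j assume j: "j < k"
    have "idx j \<in> {1..r}" using mem(1)[OF j] assms(2) by blast
    then show "idx j \<in> {1..r} \<and> a j \<in> unital_subalgebra_gen (s (idx j)) \<and> \<phi> (a j) = 0"
      using semicircular_cheb[OF semi mem(2)[OF j]] by (simp add: a_def cheb_mem)
  qed
  have c2: "\<forall>j. Suc j < k \<longrightarrow> idx j \<noteq> idx (Suc j)"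
    using runs_alternate[of _ w] by (simp add: k_def idx_def)
  have "map a [0..<k] = map (\<lambda>(i, k). cheb (s i) k) (runs w)"
    by (rule nth_equalityI) (auto simp: k_def a_def idx_def case_prod_unfold)
  then have "fock s w = prod_list (map a [0..<k])" by (simp add: fock_def)
  also have "\<phi> \<dots> = 0" using free k c1 c2 unfolding freely_independent_def by blast
  finally show ?thesis .
qed

abbreviation S :: "'a^'n^'n" where "S \<equiv> matrix_semicircle r A s"

lemma mstar_S: "mstar S = S"
proof -
  have "star (scaleC (A i $ k $ j) (s i)) = scaleC (A i $ j $ k) (s i)" if i: "i \<in> {1..r}" for i j k
  proof -
    have "cnj (A i $ k $ j) = A i $ j $ k" using pencil_adj[OF i] by (metis adjoint_mat_nth)
    moreover have "star (s i) = s i" using semi[OF i] by (simp add: semicircular_def)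
    ultimately show ?thesis by (simp add: star_scaleC)
  qed
  then show ?thesis
    by (simp add: matrix_semicircle_def mstar_def mat_tensor_def vec_eq_iff star_sum)
qed

text \<open>The resolvent is expanded over words: \<open>cword G w\<close> is the coefficient \<open>G A\<^sub>i G A\<^sub>j \<dots> G\<close> of the word \<open>w\<close>, and
  \<open>level G m\<close> collects the words of length \<open>m\<close>. In \<open>prelevel G m\<close>, which collects those of length
  \<open>m + 1\<close>, the leading factor \<open>G\<close> is left out.\<close>

fun cword :: "complex^'n^'n \<Rightarrow> nat list \<Rightarrow> complex^'n^'n" where
  "cword G [] = G"
| "cword G (i # w) = G ** A i ** cword G w"

definition level :: "complex^'n^'n \<Rightarrow> nat \<Rightarrow> 'a^'n^'n" where
  "level G m = (\<Sum>w\<in>words r m. cword G w \<otimes>\<^sub>M fock s w)"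

definition prelevel :: "complex^'n^'n \<Rightarrow> nat \<Rightarrow> 'a^'n^'n" where
  "prelevel G m = (\<Sum>i=1..r. \<Sum>w\<in>words r m. (A i ** cword G w) \<otimes>\<^sub>M fock s (i # w))"

lemma words_0: "words r 0 = {[]}"
  by (auto simp: words_def)

lemma level_0: "level G 0 = G \<otimes>\<^sub>M 1"
  by (simp add: level_def words_0)

lemma level_Suc: "level G (Suc m) = (G \<otimes>\<^sub>M 1) ** prelevel G m"
  by (simp add: level_def prelevel_def sum_words_Suc matrix_sum_right tensor_mult matrix_mul_assoc)

lemma S_level_0: "S ** level G 0 = prelevel G 0"
  unfolding level_0 matrix_semicircle_def prelevel_def words_0
  by (simp add: matrix_sum_left tensor_mult fock_def)

text \<open>Creation leads to the next level, annihilation to the previous one with the factor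
  \<open>\<Sum>\<^sub>i A\<^sub>i G A\<^sub>i = \<eta>(G)\<close>.\<close>

lemma S_level_Suc: "S ** level G (Suc m) = prelevel G (Suc m) + (\<eta> G \<otimes>\<^sub>M 1) ** level G m"
proof -
  have "S ** level G (Suc m) = (\<Sum>i=1..r. \<Sum>w\<in>words r (Suc m). (A i ** cword G w) \<otimes>\<^sub>M (s i * fock s w))"
    by (simp add: matrix_semicircle_def level_def matrix_sum_left matrix_sum_right tensor_mult)
      (rule sum.swap)
  also have "\<dots> = prelevel G (Suc m) + (\<Sum>i=1..r. \<Sum>w\<in>words r (Suc m).
      (A i ** cword G w) \<otimes>\<^sub>M (case w of [] \<Rightarrow> 0 | j # v \<Rightarrow> if i = j then fock s v else 0))"
    by (simp add: fock_step tensor_add_right sum.distrib prelevel_def)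
  also have "(\<Sum>i=1..r. \<Sum>w\<in>words r (Suc m).
      (A i ** cword G w) \<otimes>\<^sub>M (case w of [] \<Rightarrow> 0 | j # v \<Rightarrow> if i = j then fock s v else 0))
    = (\<Sum>i=1..r. \<Sum>v\<in>words r m. (A i ** G ** A i ** cword G v) \<otimes>\<^sub>M fock s v)"
  proof (rule sum.cong[OF refl])
    fix i assume i: "i \<in> {1..r}"
    have "(\<Sum>w\<in>words r (Suc m). (A i ** cword G w) \<otimes>\<^sub>M (case w of [] \<Rightarrow> 0 | j # v \<Rightarrow> if i = j then fock s v else 0))
      = (\<Sum>j=1..r. \<Sum>v\<in>words r m. if i = j then (A i ** G ** A j ** cword G v) \<otimes>\<^sub>M fock s v else 0)"
      unfolding sum_words_Suc by (intro sum.cong refl) (simp add: matrix_mul_assoc)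
    also have "\<dots> = (\<Sum>j=1..r. if i = j then \<Sum>v\<in>words r m. (A i ** G ** A j ** cword G v) \<otimes>\<^sub>M fock s v else 0)"
      by (intro sum.cong refl) auto
    also have "\<dots> = (\<Sum>v\<in>words r m. (A i ** G ** A i ** cword G v) \<otimes>\<^sub>M fock s v)"
      using i by simp
    finally show "(\<Sum>w\<in>words r (Suc m). (A i ** cword G w) \<otimes>\<^sub>M (case w of [] \<Rightarrow> 0 | j # v \<Rightarrow> if i = j then fock s v else 0))
      = (\<Sum>v\<in>words r m. (A i ** G ** A i ** cword G v) \<otimes>\<^sub>M fock s v)" .
  qed
  also have "\<dots> = (\<eta> G \<otimes>\<^sub>M 1) ** level G m"
    by (simp add: covariance_map_def level_def tensor_sum_left matrix_sum_left matrix_sum_right tensor_mult)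
      (rule sum.swap)
  finally show ?thesis .
qed

text \<open>By the Dyson equation \<open>z\<close> times a level is the sum of the creation part from below and the
  annihilation part from above, so only the terms at the two ends survive.\<close>

lemma level_telescope:
  assumes G: "mat z ** G = mat 1 + \<eta> G ** G"
  shows "(zmat z - S) ** (\<Sum>m\<le>M. level G m) = mat 1 + (\<eta> G \<otimes>\<^sub>M 1) ** level G M - prelevel G M"
proof (induction M)
  case 0
  have "zmat z ** level G 0 = mat 1 + (\<eta> G \<otimes>\<^sub>M 1) ** level G 0"
    by (simp add: level_0 zmat_mult mscale_tensor G tensor_add_left tensor_one tensor_mult)
  then show ?case by (simp add: matrix_diff_rdistrib S_level_0)
next
  case (Suc M)
  have "zmat z ** level G (Suc M) = ((mat z ** G) \<otimes>\<^sub>M 1) ** prelevel G M"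
    by (simp only: level_Suc zmat_mult flip: mscale_tensor mscale_mult_left)
  also have "\<dots> = prelevel G M + (\<eta> G \<otimes>\<^sub>M 1) ** level G (Suc M)"
    by (simp add: G tensor_add_left tensor_one matrix_add_rdistrib level_Suc matrix_mul_assoc tensor_mult)
  finally have "(zmat z - S) ** level G (Suc M) = prelevel G M + (\<eta> G \<otimes>\<^sub>M 1) ** level G (Suc M)
      - (prelevel G (Suc M) + (\<eta> G \<otimes>\<^sub>M 1) ** level G M)"
    by (simp add: matrix_diff_rdistrib S_level_Suc)
  then show ?case by (simp add: matrix_add_ldistrib Suc.IH)
qed

lemma expectation_level: "mat_expectation \<phi> (level G m) = (if m = 0 then G else 0)"
proof -
  have E: "mat_expectation \<phi> (M \<otimes>\<^sub>M a) $ i $ j = M $ i $ j * \<phi> a" for M :: "complex^'n^'n" and a i j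
    by (simp add: mat_expectation_def mat_tensor_def state_scaleC)
  show ?thesis
  proof (cases m)
    case 0
    then show ?thesis by (simp add: level_0 vec_eq_iff E state_one)
  next
    case (Suc k)
    have "mat_expectation \<phi> (level G m) $ i $ j = (\<Sum>w\<in>words r m. cword G w $ i $ j * \<phi> (fock s w))" for i j
      by (simp add: level_def mat_expectation_def mat_tensor_def state_sum state_scaleC)
    moreover have "\<phi> (fock s w) = 0" if "w \<in> words r m" for w
      using that Suc by (intro state_fock) (auto simp: words_def)
    ultimately show ?thesis using Suc by (simp add: vec_eq_iff)
  qed
qed

definition letter_bound :: real where
  "letter_bound = 1 + (\<Sum>i=1..r. norm (s i))"

definition coeff_bound :: real where
  "coeff_bound = 1 + (\<Sum>i=1..r. norm (A i))"

lemma coeff_le: "i \<in> {1..r} \<Longrightarrow> norm (A i) \<le> coeff_bound"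
  using member_le_sum[of i "{1..r}" "\<lambda>i. norm (A i)"] by (simp add: coeff_bound_def)

lemma fock_le: "set w \<subseteq> {1..r} \<Longrightarrow> norm (fock s w) \<le> letter_bound ^ length w"
proof (rule norm_fock_le[of "{1..r}"])
  show "norm (s i) + 1 \<le> letter_bound" if "i \<in> {1..r}" for i
    using member_le_sum[of i "{1..r}" "\<lambda>i. norm (s i)"] that by (simp add: letter_bound_def)
qed (simp_all add: letter_bound_def sum_nonneg)

lemma cword_le: "set w \<subseteq> {1..r} \<Longrightarrow> norm (cword G w) \<le> norm G * (norm G * coeff_bound) ^ length w"
proof (induction w)
  case (Cons i w)
  have "norm (cword G (i # w)) \<le> norm (G ** A i) * norm (cword G w)"
    using norm_matrix_mult_le[of "G ** A i" "cword G w"] by simp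
  also have "\<dots> \<le> (norm G * norm (A i)) * (norm G * (norm G * coeff_bound) ^ length w)"
    using Cons by (intro mult_mono norm_matrix_mult_le) auto
  also have "\<dots> \<le> (norm G * coeff_bound) * (norm G * (norm G * coeff_bound) ^ length w)"
    using Cons.prems coeff_le[of i] by (intro mult_right_mono mult_left_mono) (auto simp: coeff_bound_def sum_nonneg)
  finally show ?case by (simp add: ac_simps)
qed simp

lemma bounds_ge_1: "1 \<le> letter_bound" "1 \<le> coeff_bound"
  by (simp_all add: letter_bound_def coeff_bound_def sum_nonneg)

lemma norm_level_le: "norm (level G m) \<le> norm G * (real r * norm G * coeff_bound * letter_bound) ^ m"
proof -
  have each: "norm (cword G w \<otimes>\<^sub>M fock s w) \<le> norm G * (norm G * coeff_bound * letter_bound) ^ m" if "w \<in> words r m" for w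
  proof -
    have "norm (cword G w \<otimes>\<^sub>M fock s w) \<le> (norm G * (norm G * coeff_bound) ^ m) * letter_bound ^ m"
      unfolding norm_tensor using that cword_le[of w G] fock_le[of w] bounds_ge_1
      by (intro mult_mono) (auto simp: words_def)
    then show ?thesis by (simp add: power_mult_distrib mult.assoc)
  qed
  have "norm (level G m) \<le> (\<Sum>w\<in>words r m. norm G * (norm G * coeff_bound * letter_bound) ^ m)"
    unfolding level_def by (intro order_trans[OF norm_sum] sum_mono each)
  also have "\<dots> = norm G * (real r * norm G * coeff_bound * letter_bound) ^ m"
    by (simp add: card_words power_mult_distrib)
  finally show ?thesis .
qed

lemma norm_prelevel_le:
  "norm (prelevel G m) \<le> real r * coeff_bound * letter_bound * (norm G * (real r * norm G * coeff_bound * letter_bound) ^ m)"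
proof -
  have each: "norm ((A i ** cword G w) \<otimes>\<^sub>M fock s (i # w))
     \<le> coeff_bound * letter_bound * (norm G * (norm G * coeff_bound * letter_bound) ^ m)"
    if w: "w \<in> words r m" and i: "i \<in> {1..r}" for i w
  proof -
    have "norm ((A i ** cword G w) \<otimes>\<^sub>M fock s (i # w)) \<le> (coeff_bound * (norm G * (norm G * coeff_bound) ^ m)) * letter_bound ^ Suc m"
      unfolding norm_tensor
    proof (rule mult_mono)
      have "norm (A i ** cword G w) \<le> norm (A i) * norm (cword G w)" by (rule norm_matrix_mult_le)
      also have "\<dots> \<le> coeff_bound * (norm G * (norm G * coeff_bound) ^ m)"
        using w i cword_le[of w G] coeff_le[OF i] bounds_ge_1 by (intro mult_mono) (auto simp: words_def)
      finally show "norm (A i ** cword G w) \<le> coeff_bound * (norm G * (norm G * coeff_bound) ^ m)" .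
      show "norm (fock s (i # w)) \<le> letter_bound ^ Suc m"
        using w i fock_le[of "i # w"] by (auto simp: words_def)
    qed (use bounds_ge_1 in auto)
    then show ?thesis by (simp add: power_mult_distrib ac_simps)
  qed
  have "norm (prelevel G m) \<le> (\<Sum>i=1..r. \<Sum>w\<in>words r m. coeff_bound * letter_bound * (norm G * (norm G * coeff_bound * letter_bound) ^ m))"
    unfolding prelevel_def by (intro order_trans[OF norm_sum] sum_mono each)
  also have "\<dots> = real r * coeff_bound * letter_bound * (norm G * (real r * norm G * coeff_bound * letter_bound) ^ m)"
    by (simp add: card_words power_mult_distrib)
  finally show ?thesis .
qed

text \<open>A small solution \<open>G\<close> of the Dyson equation is the Cauchy transform: the sum of the levels is the
  resolvent, and only the empty word contributes to its expectation.\<close>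

lemma small_solution_is_cauchy:
  assumes G: "mat z ** G = mat 1 + \<eta> G ** G" and small: "real r * norm G * coeff_bound * letter_bound < 1"
    and z: "0 < Im z"
  shows "matrix_cauchy \<phi> S z = G"
proof -
  define q where "q = real r * norm G * coeff_bound * letter_bound"
  have q: "0 \<le> q" "q < 1" using small bounds_ge_1 by (simp_all add: q_def)
  define R where "R = resolvent S z"
  note R = resolvent_inverse[OF resolvent_exists[OF mstar_S z], folded R_def]
  define err where "err M = (\<eta> G \<otimes>\<^sub>M 1) ** level G M - prelevel G M" for M
  have pow: "(\<lambda>M. c * (norm G * q ^ M)) \<longlonglongrightarrow> 0" for c :: real
    using tendsto_mult_right_zero[OF tendsto_mult_right_zero[OF LIMSEQ_power_zero[of q]]] q by simp
  have "level G \<longlonglongrightarrow> 0"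
    using pow[of 1] norm_level_le[of G] by (intro Lim_null_comparison[of "level G" "\<lambda>M. 1 * (norm G * q ^ M)"]) (auto simp: q_def)
  moreover have "prelevel G \<longlonglongrightarrow> 0"
    by (rule Lim_null_comparison[OF _ pow[of "real r * coeff_bound * letter_bound"]])
      (use norm_prelevel_le[of G] in \<open>auto simp: q_def\<close>)
  ultimately have "err \<longlonglongrightarrow> (\<eta> G \<otimes>\<^sub>M 1) ** 0 - 0" unfolding err_def by (intro tendsto_intros)
  then have err: "err \<longlonglongrightarrow> 0" by simp
  have part: "(\<Sum>m\<le>M. level G m) = R + R ** err M" for M
  proof -
    have "(\<Sum>m\<le>M. level G m) = R ** ((zmat z - S) ** (\<Sum>m\<le>M. level G m))"
      by (simp add: matrix_mul_assoc R)
    also have "\<dots> = R ** (mat 1 + err M)"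
      unfolding level_telescope[OF G] by (simp add: err_def add_diff_eq)
    finally show ?thesis by (simp add: matrix_add_ldistrib)
  qed
  have EG: "mat_expectation \<phi> (R + R ** err M) = G" for M
  proof -
    have "mat_expectation \<phi> (\<Sum>m\<le>M. level G m) = (\<Sum>m\<le>M. mat_expectation \<phi> (level G m))"
      by (induction M) (simp_all add: mat_expectation_add)
    also have "\<dots> = G" by (simp add: expectation_level)
    finally show ?thesis by (simp add: part)
  qed
  have "matrix_cauchy \<phi> S z $ i $ j = G $ i $ j" for i j
  proof -
    have "(\<lambda>M. R + R ** err M) \<longlonglongrightarrow> R + R ** 0" by (intro tendsto_intros err)
    then have "(\<lambda>M. \<phi> ((R + R ** err M) $ i $ j)) \<longlonglongrightarrow> \<phi> (R $ i $ j)"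
      by (intro bounded_linear.tendsto[OF bounded_linear_state] tendsto_vec_nth) simp
    moreover have "\<phi> ((R + R ** err M) $ i $ j) = G $ i $ j" for M
      using EG[of M] by (simp add: mat_expectation_def vec_eq_iff)
    ultimately have "G $ i $ j = \<phi> (R $ i $ j)" by (simp add: LIMSEQ_const_iff)
    then show ?thesis by (simp add: matrix_cauchy_resolvent mat_expectation_def R_def)
  qed
  then show ?thesis by (simp add: vec_eq_iff)
qed

text \<open>The map \<open>G \<mapsto> z\<^sup>-\<^sup>1 (1 + \<eta>(G) G)\<close> is a contraction of the ball of radius \<open>\<rho>\<close> for large \<open>z\<close>.\<close>

lemma small_solution_exists:
  assumes "0 < \<rho>"
  obtains Z where "\<And>z. Z < cmod z \<Longrightarrow> \<exists>G. norm G \<le> \<rho> \<and> mat z ** G = mat 1 + \<eta> G ** G"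
proof -
  define n where "n = real CARD('n)"
  define Z where "Z = (n + pencil_size * \<rho>\<^sup>2) / \<rho> + 4 * pencil_size * \<rho> + 1"
  have n0: "0 \<le> n" by (simp add: n_def)
  show ?thesis
  proof (rule that[of Z])
    fix z assume zZ: "Z < cmod z"
    have "0 \<le> (n + pencil_size * \<rho>\<^sup>2) / \<rho>" "0 \<le> pencil_size * \<rho>"
      using assms n0 pencil_size_nonneg by auto
    then have z: "1 < cmod z" "(n + pencil_size * \<rho>\<^sup>2) / \<rho> \<le> cmod z" "4 * (pencil_size * \<rho>) \<le> cmod z"
      using zZ unfolding Z_def by linarith+
    then have cz: "0 < cmod z" by linarith
    define f where "f G = mat (1 / z) ** (mat 1 + \<eta> G ** G)" for G
    have nz: "norm (mat (1 / z) ** M) = norm M / cmod z" for M :: "complex^'n^'n"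
      by (simp add: norm_mat_mult norm_divide)
    have "\<exists>!G\<in>cball 0 \<rho>. f G = G"
    proof (rule Banach_fix[of _ "1/2"])
      show "f ` cball 0 \<rho> \<subseteq> cball 0 \<rho>"
      proof (clarsimp)
        fix G :: "complex^'n^'n" assume G: "norm G \<le> \<rho>"
        have "norm (\<eta> G ** G) \<le> norm (\<eta> G) * norm G" by (rule norm_matrix_mult_le)
        also have "\<dots> \<le> (pencil_size * norm G) * norm G" by (intro mult_right_mono norm_\<eta>_le) simp
        also have "\<dots> \<le> (pencil_size * \<rho>) * \<rho>" using G pencil_size_nonneg assms by (intro mult_mono) auto
        finally have "norm (mat 1 + \<eta> G ** G) \<le> n + pencil_size * \<rho>\<^sup>2"
          using norm_triangle_ineq[of "mat 1" "\<eta> G ** G"] norm_mat_one(1)[where 'n = 'n]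
          by (simp add: n_def power2_eq_square)
        moreover have "n + pencil_size * \<rho>\<^sup>2 \<le> \<rho> * cmod z" using z(2) assms by (simp add: field_simps)
        ultimately show "norm (f G) \<le> \<rho>"
          unfolding f_def nz using cz by (simp add: pos_divide_le_eq)
      qed
      fix G H :: "complex^'n^'n" assume "G \<in> cball 0 \<rho>" "H \<in> cball 0 \<rho>"
      then have GH: "norm G \<le> \<rho>" "norm H \<le> \<rho>" by auto
      have e: "\<eta> G ** G - \<eta> H ** H = \<eta> G ** (G - H) + \<eta> (G - H) ** H"
        by (simp add: \<eta>_diff matrix_ring_simps)
      have "norm (\<eta> G ** (G - H)) \<le> norm (\<eta> G) * norm (G - H)" by (rule norm_matrix_mult_le)
      also have "\<dots> \<le> (pencil_size * norm G) * norm (G - H)" by (intro mult_right_mono norm_\<eta>_le) simp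
      also have "\<dots> \<le> (pencil_size * \<rho>) * norm (G - H)"
        using GH pencil_size_nonneg by (intro mult_right_mono mult_left_mono) auto
      finally have 1: "norm (\<eta> G ** (G - H)) \<le> pencil_size * \<rho> * norm (G - H)" .
      have "norm (\<eta> (G - H) ** H) \<le> norm (\<eta> (G - H)) * norm H" by (rule norm_matrix_mult_le)
      also have "\<dots> \<le> (pencil_size * norm (G - H)) * norm H" by (intro mult_right_mono norm_\<eta>_le) simp
      also have "\<dots> \<le> (pencil_size * norm (G - H)) * \<rho>"
        using GH pencil_size_nonneg by (intro mult_left_mono) auto
      finally have 2: "norm (\<eta> (G - H) ** H) \<le> pencil_size * \<rho> * norm (G - H)" by (simp add: ac_simps)
      have "norm (\<eta> G ** G - \<eta> H ** H) \<le> 2 * (pencil_size * \<rho>) * norm (G - H)"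
        unfolding e using norm_triangle_ineq[of "\<eta> G ** (G - H)" "\<eta> (G - H) ** H"] 1 2 by simp
      moreover have "4 * (pencil_size * \<rho>) * norm (G - H) \<le> cmod z * norm (G - H)"
        using z(3) by (intro mult_right_mono) auto
      ultimately have "norm (\<eta> G ** G - \<eta> H ** H) \<le> (1/2) * norm (G - H) * cmod z" by (simp add: ac_simps)
      moreover have "f G - f H = mat (1 / z) ** (\<eta> G ** G - \<eta> H ** H)"
        by (simp add: f_def matrix_ring_simps)
      ultimately show "dist (f G) (f H) \<le> (1/2) * dist G H"
        using cz by (simp add: dist_norm nz pos_divide_le_eq)
    qed (use assms in \<open>auto simp: complete_eq_closed\<close>)
    then obtain G where G: "norm G \<le> \<rho>" "f G = G" by auto
    have "z \<noteq> 0" using z(1) by auto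
    then have "mat z ** f G = mat 1 + \<eta> G ** G"
      by (simp add: f_def matrix_mul_assoc mat_mult_mat)
    then show "\<exists>G. norm G \<le> \<rho> \<and> mat z ** G = mat 1 + \<eta> G ** G" using G by auto
  qed
qed

text \<open>Both sides are holomorphic in the upper half-plane and agree for large imaginary part.\<close>

lemma cauchy_dyson:
  assumes z: "0 < Im z"
  shows "mat z ** matrix_cauchy \<phi> S z = mat 1 + \<eta> (matrix_cauchy \<phi> S z) ** matrix_cauchy \<phi> S z"
proof -
  define G where "G z = matrix_cauchy \<phi> S z" for z
  \<comment> \<open>a bound on \<open>\<parallel>G\<parallel>\<close> for which the expansion over words converges geometrically\<close>
  define \<rho> where "\<rho> = 1 / (2 * (real r + 1) * coeff_bound * letter_bound)"
  have pos: "0 < coeff_bound * letter_bound" using bounds_ge_1 by (intro mult_pos_pos) auto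
  define P where "P = coeff_bound * letter_bound"
  have P: "0 < P" and \<rho>P: "\<rho> = 1 / (2 * (real r + 1) * P)" using pos by (simp_all add: P_def \<rho>_def mult.assoc)
  then have \<rho>: "0 < \<rho>" by simp
  obtain Z where Z: "\<And>z. Z < cmod z \<Longrightarrow> \<exists>G. norm G \<le> \<rho> \<and> mat z ** G = mat 1 + \<eta> G ** G"
    using small_solution_exists[OF \<rho>] by blast
  have large: "mat z ** G z = mat 1 + \<eta> (G z) ** G z" if "max Z 0 < Im z" for z
  proof -
    have "Z < cmod z" using that abs_Im_le_cmod[of z] by simp
    then obtain H where H: "norm H \<le> \<rho>" "mat z ** H = mat 1 + \<eta> H ** H" using Z by blast
    have "real r * norm H * coeff_bound * letter_bound = (real r * (coeff_bound * letter_bound)) * norm H" by simp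
    also have "\<dots> \<le> (real r * (coeff_bound * letter_bound)) * \<rho>" using H pos by (intro mult_left_mono) auto
    also have "\<dots> = real r / (2 * (real r + 1))" using P by (simp add: \<rho>P flip: P_def)
    also have "\<dots> < 1" by (simp add: field_simps)
    finally have "G z = H" unfolding G_def using that H by (intro small_solution_is_cauchy) auto
    then show ?thesis using H by simp
  qed
  have hol: "(\<lambda>z. G z $ k $ l) holomorphic_on {z. 0 < Im z}" for k l
    unfolding G_def by (rule matrix_cauchy_holomorphic[OF mstar_S])
  have "(mat z ** G z) $ i $ j = (mat 1 + \<eta> (G z) ** G z) $ i $ j" for i j
  proof (rule analytic_continuation_open[of "{z. max Z 0 < Im z}" "{z. 0 < Im z}"
        "\<lambda>z. (mat z ** G z) $ i $ j" "\<lambda>z. (mat 1 + \<eta> (G z) ** G z) $ i $ j"])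
    show "open {z. max Z 0 < Im z}" "open {z. 0 < Im z}" by (rule open_halfspace_Im_gt)+
    have "Complex 0 (max Z 0 + 1) \<in> {z. max Z 0 < Im z}" unfolding mem_Collect_eq complex.sel by linarith
    then show "{z. max Z 0 < Im z} \<noteq> {}" by blast
    show "connected {z. 0 < Im z}" by (intro convex_connected convex_halfspace_Im_gt)
    show "{z. max Z 0 < Im z} \<subseteq> {z. 0 < Im z}" by auto
    show "(\<lambda>z. (mat z ** G z) $ i $ j) holomorphic_on {z. 0 < Im z}"
      unfolding mat_mult_nth by (intro holomorphic_intros hol)
    show "(\<lambda>z. (mat 1 + \<eta> (G z) ** G z) $ i $ j) holomorphic_on {z. 0 < Im z}"
      by (simp add: covariance_map_def matrix_matrix_mult_def) (intro holomorphic_intros hol)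
    show "(mat z ** G z) $ i $ j = (mat 1 + \<eta> (G z) ** G z) $ i $ j" if "z \<in> {z. max Z 0 < Im z}" for z
      using large that by simp
  qed (use z in simp)
  then show ?thesis by (simp add: G_def vec_eq_iff)
qed

lemma W_transform_dyson:
  assumes u: "0 < Re u"
  shows "dyson u (W_transform \<phi> S u)"
proof -
  define G where "G = matrix_cauchy \<phi> S (\<i> * u)"
  define W where "W = W_transform \<phi> S u"
  have W: "W = mat \<i> ** G" by (simp add: W_def W_transform_def G_def)
  have \<eta>W: "\<eta> W = mat \<i> ** \<eta> G"
    unfolding W covariance_map_def matrix_sum_right
    by (intro sum.cong refl) (simp only: matrix_mul_assoc mat_scalar_commute[of \<i> "A _"])
  have eq: "mat (\<i> * u) ** G = mat 1 + \<eta> G ** G"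
    unfolding G_def using u by (intro cauchy_dyson) simp
  have "(mat u + \<eta> W) ** W = mat u ** mat \<i> ** G + mat \<i> ** \<eta> G ** mat \<i> ** G"
  proof -
    have "\<eta> W ** W = (mat \<i> ** \<eta> G) ** (mat \<i> ** G)" by (rule arg_cong2[OF \<eta>W W])
    moreover have "mat u ** W = mat u ** (mat \<i> ** G)" by (rule arg_cong[OF W])
    ultimately show ?thesis by (simp add: matrix_add_rdistrib matrix_mul_assoc)
  qed
  also have "mat u ** mat \<i> ** G = mat (\<i> * u) ** G" by (simp add: mat_mult_mat mult.commute)
  also have "mat \<i> ** \<eta> G ** mat \<i> ** G = mat \<i> ** mat \<i> ** \<eta> G ** G"
  proof -
    have "mat \<i> ** \<eta> G ** mat \<i> = mat \<i> ** (\<eta> G ** mat \<i>)" by (rule matrix_mul_assoc[symmetric])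
    also have "\<eta> G ** mat \<i> = mat \<i> ** \<eta> G" by (rule mat_scalar_commute[symmetric])
    finally show ?thesis by (simp add: matrix_mul_assoc)
  qed
  also have "\<dots> = - (\<eta> G ** G)"
    by (simp add: mat_mult_mat vec_eq_iff mat_mult_nth flip: matrix_mul_assoc)
  finally have "(mat u + \<eta> W) ** W = mat 1" unfolding eq by simp
  then have "W ** (mat u + \<eta> W) = mat 1" using matrix_left_right_inverse by blast
  moreover have "psd (rp W)" unfolding rp_def W_def by (rule W_transform_psd[OF mstar_S u])
  ultimately show ?thesis using u unfolding W_def by (intro dysonI)
qed

end

section \<open>Boundary values\<close>

lemma at_right_to_half_plane: "filterlim complex_of_real (at 0 within {u. 0 < Re u}) (at_right 0)"
  unfolding filterlim_at
proof
  show "\<forall>\<^sub>F x in at_right 0. complex_of_real x \<in> {u. 0 < Re u} \<and> complex_of_real x \<noteq> 0"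
    using eventually_at_right_less[of "0::real"] by eventually_elim auto
  have "((\<lambda>x. complex_of_real x) \<longlongrightarrow> complex_of_real 0) (at_right 0)" by (intro tendsto_intros)
  then show "(complex_of_real \<longlongrightarrow> 0) (at_right 0)" by simp
qed

lemma stolz_cone_limpt: "0 \<le> \<alpha> \<Longrightarrow> at (\<i> * complex_of_real t) within stolz_cone \<alpha> t \<noteq> bot"
proof -
  assume \<alpha>: "0 \<le> \<alpha>"
  have "\<i> * complex_of_real t islimpt stolz_cone \<alpha> t"
    unfolding islimpt_approachable
  proof (intro allI impI)
    fix e :: real assume "0 < e"
    then show "\<exists>x'\<in>stolz_cone \<alpha> t. x' \<noteq> \<i> * complex_of_real t \<and> dist x' (\<i> * complex_of_real t) < e"
      using \<alpha> by (intro bexI[of _ "\<i> * complex_of_real t + complex_of_real (e / 2)"])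
        (auto simp: stolz_cone_def dist_norm)
  qed
  then show ?thesis by (simp add: trivial_limit_within)
qed

context dyson_family
begin

lemma W_extension:
  obtains g where "continuous_on {t0 - 1<..<t0 + 1} g"
    and "\<And>t. \<bar>t - t0\<bar> < 1 \<Longrightarrow> (W \<longlongrightarrow> g t) (at (\<i> * complex_of_real t) within {u. 0 < Re u})"
proof -
  define M where "M = \<bar>t0\<bar> + 2"
  define H where "H = {u. 0 < Re u \<and> cmod u \<le> M}"
  obtain h where h: "uniformly_continuous_on (closure H) h" "\<And>u. u \<in> H \<Longrightarrow> W u = h u"
    using uniformly_continuous_on_extension_on_closure[OF W_uniformly_continuous[of M]] unfolding H_def by metis
  have ch: "continuous_on (closure H) h" using h(1) by (rule uniformly_continuous_imp_continuous)
  have near: "u \<in> H" if "\<bar>t - t0\<bar> < 1" "0 < Re u" "dist u (\<i> * complex_of_real t) < 1" for t u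
  proof -
    have "cmod u \<le> cmod (\<i> * complex_of_real t) + cmod (u - \<i> * complex_of_real t)" by (rule norm_triangle_sub)
    also have "\<dots> \<le> (\<bar>t0\<bar> + 1) + 1" using that by (intro add_mono) (auto simp: norm_mult dist_norm)
    finally show ?thesis using that by (simp add: H_def M_def)
  qed
  have axis: "\<i> * complex_of_real t \<in> closure H" if t: "\<bar>t - t0\<bar> < 1" for t
    unfolding closure_approachable
  proof (intro allI impI)
    fix e :: real assume e: "0 < e"
    define u where "u = \<i> * complex_of_real t + complex_of_real (min e 1 / 2)"
    have "dist u (\<i> * complex_of_real t) < 1" "dist u (\<i> * complex_of_real t) < e" "0 < Re u"
      using e by (auto simp: u_def dist_norm)
    then show "\<exists>u\<in>H. dist u (\<i> * complex_of_real t) < e" using near[OF t] by blast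
  qed
  show ?thesis
  proof (rule that[of "\<lambda>t. h (\<i> * complex_of_real t)"])
    show "continuous_on {t0 - 1<..<t0 + 1} (\<lambda>t. h (\<i> * complex_of_real t))"
      by (rule continuous_on_compose2[OF ch]) (auto intro!: continuous_intros axis)
    fix t assume t: "\<bar>t - t0\<bar> < 1"
    show "(W \<longlongrightarrow> h (\<i> * complex_of_real t)) (at (\<i> * complex_of_real t) within {u. 0 < Re u})"
      unfolding Lim_within
    proof (intro allI impI)
      fix e :: real assume "0 < e"
      then obtain d where d: "0 < d" "\<And>u. u \<in> closure H \<Longrightarrow> dist u (\<i> * complex_of_real t) < d \<Longrightarrow> dist (h u) (h (\<i> * complex_of_real t)) < e"
        using ch axis[OF t] unfolding continuous_on_iff by metis
      show "\<exists>d>0. \<forall>u\<in>{u. 0 < Re u}. 0 < dist u (\<i> * complex_of_real t) \<and> dist u (\<i> * complex_of_real t) < d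
          \<longrightarrow> dist (W u) (h (\<i> * complex_of_real t)) < e"
      proof (intro exI[of _ "min d 1"] conjI ballI impI)
        fix u assume u: "u \<in> {u. 0 < Re u}" "0 < dist u (\<i> * complex_of_real t) \<and> dist u (\<i> * complex_of_real t) < min d 1"
        then have "u \<in> H" using near[OF t] by simp
        then show "dist (W u) (h (\<i> * complex_of_real t)) < e"
          using d(2)[of u] u h(2) closure_subset[of H] by auto
      qed (use d in simp)
    qed
  qed
qed

lemma W_nonsingular:
  "\<exists>\<delta>>0. \<exists>\<alpha>>0.
    (\<forall>t. \<bar>t - t0\<bar> < \<delta> \<longrightarrow>
      bounded (W ` (stolz_cone \<alpha> t \<inter> {u. cmod (u - \<i> * of_real t) < \<delta>})) \<and>
      (\<exists>L. (W \<longlongrightarrow> L) (at (\<i> * of_real t) within stolz_cone \<alpha> t))) \<and>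
    continuous_on {t0 - \<delta><..<t0 + \<delta>} (stolz_limit W \<alpha>)"
proof -
  obtain g where g: "continuous_on {t0 - 1<..<t0 + 1} g"
    "\<And>t. \<bar>t - t0\<bar> < 1 \<Longrightarrow> (W \<longlongrightarrow> g t) (at (\<i> * complex_of_real t) within {u. 0 < Re u})"
    using W_extension by blast
  obtain K where K: "\<And>u. 0 < Re u \<Longrightarrow> norm (W u) \<le> K" using W_bounded by blast
  have lim: "(W \<longlongrightarrow> g t) (at (\<i> * complex_of_real t) within stolz_cone 1 t)" if "\<bar>t - t0\<bar> < 1" for t
    using g(2)[OF that] by (rule tendsto_within_subset) (auto simp: stolz_cone_def)
  have "stolz_limit W 1 t = g t" if "\<bar>t - t0\<bar> < 1" for t
    unfolding stolz_limit_def by (rule tendsto_Lim[OF stolz_cone_limpt lim[OF that]]) simp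
  then have "continuous_on {t0 - 1<..<t0 + 1} (stolz_limit W 1)"
    by (subst continuous_on_cong[OF refl, of _ _ g]) (auto simp: abs_less_iff g(1))
  moreover have "bounded (W ` (stolz_cone 1 t \<inter> {u. cmod (u - \<i> * of_real t) < 1}))" for t
    by (rule boundedI[of _ K]) (auto simp: stolz_cone_def intro: K)
  ultimately show ?thesis
    using lim by (intro exI[of _ "1 :: real"] conjI allI impI zero_less_one) blast+
qed

text \<open>The limit inherits the equation, which makes the semidefinite limit invertible.\<close>

lemma W_limit_at_zero:
  obtains C where "((\<lambda>\<epsilon>. W (complex_of_real \<epsilon>)) \<longlongrightarrow> C) (at_right 0)" and "dyson 0 C" and "posdef_mat C"
proof -
  obtain g where g: "\<And>t. \<bar>t - 0\<bar> < 1 \<Longrightarrow> (W \<longlongrightarrow> g t) (at (\<i> * complex_of_real t) within {u. 0 < Re u})"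
    using W_extension[of 0] by blast
  have "(W \<longlongrightarrow> g 0) (at 0 within {u. 0 < Re u})" using g[of 0] by simp
  then have lim: "((\<lambda>\<epsilon>. W (complex_of_real \<epsilon>)) \<longlongrightarrow> g 0) (at_right 0)"
    using at_right_to_half_plane by (rule filterlim_compose)
  define C where "C = g 0"
  define e where "e k = inverse (real (Suc k))" for k
  have e: "0 < e k" for k by (simp add: e_def)
  have e0: "filterlim e (at_right 0) sequentially"
    unfolding filterlim_at e_def using LIMSEQ_inverse_real_of_nat by auto
  have limk: "(\<lambda>k. W (complex_of_real (e k))) \<longlonglongrightarrow> C"
    unfolding C_def using lim e0 by (rule filterlim_compose)
  have herm: "rp (W (complex_of_real (e k))) = W (complex_of_real (e k))" for k
    using W_hermitian[OF e[of k]] by (simp add: rp_def scaleR_2[symmetric])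
  have psdC: "psd C"
  proof (rule psd_limit[OF _ limk])
    show "psd (W (complex_of_real (e k)))" for k
      using dyson_psd(1)[OF sol, of "complex_of_real (e k)"] e[of k] herm[of k] by simp
  qed
  have "e \<longlonglongrightarrow> 0" unfolding e_def by (rule LIMSEQ_inverse_real_of_nat)
  then have "(\<lambda>k. (e k *\<^sub>R mat 1 + \<eta> (W (complex_of_real (e k)))) ** W (complex_of_real (e k))) \<longlonglongrightarrow> (0 *\<^sub>R mat 1 + \<eta> C) ** C"
    by (intro tendsto_intros tendsto_\<eta> limk)
  moreover have "(e k *\<^sub>R mat 1 + \<eta> (W (complex_of_real (e k)))) ** W (complex_of_real (e k)) = mat 1" for k
    using sol[of "complex_of_real (e k)"] e[of k] by (simp add: dyson_def mat_of_real)
  ultimately have inv: "\<eta> C ** C = mat 1" by (simp add: LIMSEQ_const_iff)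
  have rpC: "rp C = C" using psd_adj[OF psdC] by (simp add: rp_def scaleR_2[symmetric])
  have pos: "posdef_mat C"
    unfolding posdef_iff
  proof (intro conjI allI impI)
    show "hermitian_mat C" using psdC by (simp add: psd_def)
    fix v :: "complex^'n" assume v: "v \<noteq> 0"
    have "C *v v \<noteq> 0"
      using v inv by (metis matrix_vector_mul_assoc matrix_vector_mul_lid matrix_vector_mult_0_right)
    then show "0 < qform C v"
      using psd_qform[OF psdC, of v] psd_qform_eq_0[OF psdC, of v] by linarith
  qed
  have "dyson 0 C"
    using inv pos matrix_left_right_inverse[of "\<eta> C" C] by (simp add: dyson_def rpC)
  then show ?thesis using that lim pos unfolding C_def by blast
qed

end

context unsplittable_pencil
begin

text \<open>At \<open>u = 0\<close> two positive solutions can differ only by a scalar factor, and the equation fixes its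
  square.\<close>

lemma dyson_zero_unique:
  assumes D1: "dyson 0 C1" and D2: "dyson 0 C2" and pos: "posdef_mat C1" "posdef_mat C2"
  shows "C1 = C2"
proof -
  have rpC: "rp C2 = C2" using pos(2) by (simp add: posdef_iff hermitian_mat_def rp_def scaleR_2[symmetric])
  obtain B B' where B: "C1 - C2 = B ** rp C2" "\<And>i. i \<in> {1..r} \<Longrightarrow> A i ** B = B' ** A i"
    using dyson_no_loss[OF D1 D2] by (metis order_refl zero_complex.simps(1))
  obtain l where l: "B = mat l" using intertwining_scalar[of B B'] B(2) by blast
  define k where "k = 1 + l"
  have C1: "C1 = mat k ** C2"
    using B(1) by (simp add: rpC l k_def mat_plus matrix_add_rdistrib algebra_simps)
  have \<eta>C1: "\<eta> C1 = mat k ** \<eta> C2"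
    unfolding C1 covariance_map_def matrix_sum_right
    by (intro sum.cong refl) (simp only: matrix_mul_assoc mat_scalar_commute[of k "A _"])
  have "mat 1 = \<eta> C1 ** C1" using D1 by (simp add: dyson_def)
  also have "\<dots> = (mat k ** \<eta> C2) ** (mat k ** C2)" by (rule arg_cong2[OF \<eta>C1 C1])
  also have "\<dots> = mat k ** (\<eta> C2 ** mat k) ** C2" by (simp only: matrix_mul_assoc)
  also have "\<eta> C2 ** mat k = mat k ** \<eta> C2" by (rule mat_scalar_commute[symmetric])
  also have "mat k ** (mat k ** \<eta> C2) ** C2 = mat (k * k) ** (\<eta> C2 ** C2)"
    by (simp only: matrix_mul_assoc mat_mult_mat)
  also have "\<eta> C2 ** C2 = mat 1" using D2 by (simp add: dyson_def)
  finally have "mat 1 = (mat (k * k) :: complex^'n^'n)" by simp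
  then have "(mat 1 :: complex^'n^'n) $ undefined $ undefined = (mat (k * k) :: complex^'n^'n) $ undefined $ undefined"
    by (rule arg_cong)
  then have "k * k = 1" by (simp add: mat_def)
  then have "k = 1 \<or> k = - 1" using square_eq_1_iff by blast
  moreover have "k \<noteq> - 1"
  proof
    assume "k = - 1"
    then have "C1 = - C2" unfolding C1 by (simp add: vec_eq_iff mat_mult_nth)
    then have "qform C1 v = - qform C2 v" for v :: "complex^'n"
      using matrix_vector_mult_diff_rdistrib[of 0 C2 v] by (simp add: cip_minus_right)
    moreover have "(axis undefined 1 :: complex^'n) \<noteq> 0" by (simp add: axis_eq_0_iff)
    ultimately show False using pos unfolding posdef_iff by (metis less_asym neg_0_less_iff_less)
  qed
  ultimately show ?thesis using C1 by simp
qed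

lemma posdef_solution_iff: "posdef_mat C \<and> \<eta> C = matrix_inv C \<longleftrightarrow> posdef_mat C \<and> dyson 0 C"
proof (rule conj_cong[OF refl])
  assume pos: "posdef_mat C"
  then have rpC: "rp C = C" by (simp add: posdef_iff hermitian_mat_def rp_def scaleR_2[symmetric])
  obtain Q where "C ** Q = mat 1" "Q ** C = mat 1" using posdef_inverse[OF pos] .
  then have inv: "C ** matrix_inv C = mat 1" "matrix_inv C ** C = mat 1"
    using someI_ex[of "\<lambda>A'. C ** A' = mat 1 \<and> A' ** C = mat 1"] unfolding matrix_inv_def by blast+
  show "\<eta> C = matrix_inv C \<longleftrightarrow> dyson 0 C"
  proof
    assume "\<eta> C = matrix_inv C"
    then show "dyson 0 C" using inv pos by (simp add: dyson_def rpC)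
  next
    assume "dyson 0 C"
    then have "C ** \<eta> C = mat 1" by (simp add: dyson_def)
    then have "matrix_inv C ** (C ** \<eta> C) = matrix_inv C" by simp
    then show "\<eta> C = matrix_inv C" by (simp add: matrix_mul_assoc inv)
  qed
qed

end

lemma ntr_W_transform: "Im (- ntr (matrix_cauchy \<phi> S (\<i> * u))) = Re (ntr (W_transform \<phi> S u))"
  for S :: "'a::cstar_algebra^'n^'n"
proof -
  have "trace (mat \<i> ** G) = \<i> * trace G" for G :: "complex^'n^'n"
    by (simp add: trace_def mat_mult_nth sum_distrib_left)
  then have "ntr (W_transform \<phi> S u) = \<i> * ntr (matrix_cauchy \<phi> S (\<i> * u))"
    by (simp add: W_transform_def ntr_def)
  then show ?thesis by simp
qed

lemma ntr_hermitian_real: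
  assumes "hermitian_mat C"
  shows "complex_of_real (Re (ntr C)) = ntr C"
proof -
  have "cnj (trace C) = trace (adjoint_mat C)" by (simp add: trace_def)
  then have "trace C \<in> \<real>" using assms by (simp add: hermitian_mat_def Reals_cnj_iff)
  then have "ntr C \<in> \<real>" by (simp add: ntr_def)
  then show ?thesis by (rule of_real_Re)
qed

theorem theoremB:
  fixes \<phi> :: "'a::cstar_algebra \<Rightarrow> complex"
    and s :: "nat \<Rightarrow> 'a"
    and A :: "nat \<Rightarrow> complex^'n^'n"
    and r :: nat
  assumes "cstar_prob_space \<phi>"
    and "freely_independent \<phi> s {1..r}"
    and "\<forall>i\<in>{1..r}. semicircular \<phi> (s i)"
    and "\<forall>i\<in>{1..r}. hermitian_mat (A i)"
    and "unsplittable r A"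
  shows "nonsingular \<phi> (matrix_semicircle r A s) \<and>
    (\<exists>!C. posdef_mat C \<and> covariance_map r A C = matrix_inv C) \<and>
    (\<forall>C. posdef_mat C \<and> covariance_map r A C = matrix_inv C \<longrightarrow>
      (\<exists>d. has_spectral_density_at \<phi> (matrix_semicircle r A s) 0 d \<and>
        complex_of_real d = 1 / of_real pi * ntr C))"
proof -
  interpret unsplittable_pencil r A
    using assms(4,5) by unfold_locales (auto simp: hermitian_mat_def)
  interpret cstar_prob_space \<phi> by fact
  interpret semi: matrix_semicircle_setup r A \<phi> s
    using assms(2,3) by unfold_locales auto
  interpret W: dyson_family r A "W_transform \<phi> (matrix_semicircle r A s)"
    using semi.W_transform_dyson by unfold_locales
  have nonsing: "nonsingular \<phi> (matrix_semicircle r A s)"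
    unfolding nonsingular_def nonsingular_at_def using W.W_nonsingular by blast
  obtain C where lim: "((\<lambda>\<epsilon>. W_transform \<phi> (matrix_semicircle r A s) (complex_of_real \<epsilon>)) \<longlongrightarrow> C) (at_right 0)"
    and C: "dyson 0 C" "posdef_mat C"
    using W.W_limit_at_zero by blast
  have unique: "C' = C" if "posdef_mat C' \<and> covariance_map r A C' = matrix_inv C'" for C'
    using that C dyson_zero_unique unfolding posdef_solution_iff by blast
  have "\<exists>!C. posdef_mat C \<and> covariance_map r A C = matrix_inv C"
    using C unique posdef_solution_iff by blast
  moreover have "has_spectral_density_at \<phi> (matrix_semicircle r A s) 0 (1 / pi * Re (ntr C))"
  proof -
    have "((\<lambda>\<epsilon>. 1 / pi * Re (ntr (W_transform \<phi> (matrix_semicircle r A s) (complex_of_real \<epsilon>)))) \<longlongrightarrow> 1 / pi * Re (ntr C)) (at_right 0)"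
      unfolding ntr_def trace_def by (intro tendsto_intros lim) simp
    then show ?thesis
      by (simp add: has_spectral_density_at_def ntr_W_transform del: uminus_complex.sel)
  qed
  moreover have "complex_of_real (1 / pi * Re (ntr C)) = 1 / of_real pi * ntr C"
    using ntr_hermitian_real[of C] C(2) by (simp add: posdef_iff)
  ultimately show ?thesis using nonsing unique by blast
qed

end
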